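(* Let $s\in(\frac12,1)$. Suppose that $L$ is admissible and the data $(m_0,u_T)$ are admissible (in the sense of the context). If $(u,m,\mu)$ is a solution, for some $\theta\in(0,1]$, of $$\begin{cases} -\partial_t u+(-\Delta)^s u+H^\theta(x,Du,\mu(t))=0 & \text{in } \mathbb{T}^d\times(0,T),\\ \partial_t m+(-\Delta)^s m-\operatorname{div}\big(D_pH^\theta(x,Du,\mu(t))\,m\big)=0 & \text{in } \mathbb{T}^d\times(0,T),\\ \mu(t)=\big(I_d,-D_pH^\theta(\cdot,Du(\cdot,t),\mu(t))\big)\# m(t) & \text{for } t\in[0,T],\\ m(x,0)=m_0(x),\quad u(x,T)=\theta u_T(x) & \text{in } \mathbb{T}^d, \end{cases}$$ then $$\int_0^T\Lambda_{\tilde q}(\mu(t))^{\tilde q}\,dt\le 2C_0^2\,\theta^{\tilde q}(1+T).$$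
   Context: Notation. $T>0$, $\mathbb{T}^d=\mathbb{R}^d/\mathbb{Z}^d$ (identified with $[0,1]^d$ with periodic boundary conditions), $Q_T=\mathbb{T}^d\times[0,T]$. The fractional Laplacian is $(-\Delta)^s u(x)=(2\pi)^{2s}\sum_{k\in\mathbb{Z}^d}|k|^{2s}\widehat u(k)e^{2\pi i k\cdot x}$, where $\widehat u(k)=\int_{\mathbb{T}^d}u(x)e^{-2\pi i k\cdot x}dx$. $\mathcal{P}(E)$ is the set of Borel probability measures on $E$; $(I_d,v)\# m$ is the image of $m$ under $x\mapsto(x,v(x))$. For $\sigma\in\mathbb{R}$, $H_2^\sigma(\mathbb{T}^d)$ is the Bessel potential space with norm $\|f\|_{\sigma,2}=\|(I-\Delta)^{\sigma/2}f\|_{L^2(\mathbb{T}^d)}$. $\mathcal{C}^{k+\beta}$ denotes functions whose derivatives of order $k$ are $\beta$-H\"older continuous, with the usual norm. Fix $q\in(1,\infty)$, $\tilde q=\frac{q}{q-1}$, a constant $C_0>0$, $\beta_0\in(0,1)$ and $\varepsilon_0>0$. For $\mu\in\mathcal{P}(\mathbb{T}^d\times\mathbb{R}^d)$ let $\Lambda_{\tilde q}(\mu)=\left(\int|\alpha|^{\tilde q}d\mu(x,\alpha)\right)^{1/\tilde q}$ and $\Lambda_\infty(\mu)=\sup\{|\alpha|:(x,\alpha)\in\operatorname{supp}\mu\}$. $\mathcal{P}_{\infty,R}$ is the set of $\mu\in\mathcal P(\mathbb{T}^d\times\mathbb{R}^d)$ with $\Lambda_\infty(\mu)\le R$, endowed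 with the weak* topology. The Lagrangian is $L:\mathbb{T}^d\times\mathbb{R}^d\times\mathcal{P}(\mathbb{T}^d\times\mathbb{R}^d)\to\mathbb{R}$, and the Hamiltonian is $H(x,p,\mu)=\sup_{\alpha\in\mathbb{R}^d}\{-p\cdot\alpha-L(x,\alpha,\mu)\}$. For $\theta\in(0,1]$, $H^\theta(x,p,\mu)=\theta H(x,p,\Theta(\mu))$, where $\Theta(\mu)$ is the image of $\mu$ under $(x,\alpha)\mapsto(x,\theta^{-1}\alpha)$. "$L$ is admissible" means: (1) $D^2_{\alpha\alpha}L(x,\alpha,\mu)>0$; (2) $L$ is differentiable in $(x,\alpha)$ and twice differentiable in $x$, and $L$ and its derivatives ($D_xL$, $D_\alpha L$, $D^2_{xx}L$) are continuous on $\mathbb{T}^d\times\mathbb{R}^d\times\mathcal{P}_{\infty,R}$ for every $R>0$; (3) $\int (L(x,\alpha,\mu^1)-L(x,\alpha,\mu^2))\,d(\mu^1-\mu^2)(x,\alpha)\ge0$ for any $\mu^1,\mu^2\in\mathcal{P}(\mathbb{T}^d\times\mathbb{R}^d)$; (4) $L(x,\alpha,\mu)\ge C_0^{-1}|\alpha|^{\tilde q}-C_0(1+\Lambda_{\tilde q}(\mu)^{\tilde q})$; (5) $|L(x,\alpha,\mu)|+|D_xL(x,\alpha,\mu)|\le C_0(1+|\alpha|^{\tilde q}+\Lambda_{\tilde q}(\mu)^{\tilde q})$. "$(m_0,u_T)$ are admissible" means: $m_0$ is a probability measure on $\mathbb{T}^d$ with $m_0\in H_2^{s-1+\varepsilon_0}(\mathbb{T}^d)$,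 $u_T\in\mathcal{C}^{2+\beta_0}(\mathbb{T}^d)$, and $\int|x|^2dm_0(x)+\|m_0\|_{s-1+\varepsilon_0,2}+\|u_T\|_{\mathcal{C}^{2+\beta_0}}\le C_0$. Solution: $u\in\mathcal{C}^{2s,1}(Q_T;\mathbb{R})$ (order $2s$ in $x$, order $1$ in $t$) is a classical solution of the first equation with its terminal condition; $m\in\mathcal{C}^0([0,T];\mathcal{P}(\mathbb{T}^d))$ solves the second equation in the sense of distributions with its initial condition; $\mu(t)\in\mathcal{P}(\mathbb{T}^d\times\mathbb{R}^d)$ satisfies the third equation for every $t\in[0,T]$. *)

theory Defs
  imports "HOL-Probability.Probability"
begin

section \<open>The torus\<close>

text \<open>
  The torus \<open>\<real>\<^sup>d / \<int>\<^sup>d\<close> is handled through its fundamental cell.  A function on the torus is a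
  function on \<open>real ^ 'd\<close> that is 1-periodic in every coordinate, so that derivatives, continuity
  and Hoelder quotients are the ordinary ones.  A Borel measure on the torus is a Borel measure on
  \<open>real ^ 'd\<close> concentrated on the half-open cell, where every class has exactly one representative.
\<close>

definition cell :: "(real ^ 'd) set" where
  "cell = {x. \<forall>i. 0 \<le> x $ i \<and> x $ i < 1}"

definition periodic :: "(real ^ 'd \<Rightarrow> 'b) \<Rightarrow> bool" where
  "periodic f \<longleftrightarrow> (\<forall>x i. f (x + axis i 1) = f x)"

definition int_vec :: "int ^ 'd \<Rightarrow> real ^ 'd" where
  "int_vec k = (\<chi> i. real_of_int (k $ i))"


section \<open>Derivatives and function spaces\<close>

definition grad :: "(real ^ 'd \<Rightarrow> real) \<Rightarrow> real ^ 'd \<Rightarrow> real ^ 'd" where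
  "grad f x = (\<chi> i. frechet_derivative f (at x) (axis i 1))"

definition hess :: "(real ^ 'd \<Rightarrow> real) \<Rightarrow> real ^ 'd \<Rightarrow> real ^ 'd ^ 'd" where
  "hess f x = jacobian (grad f) (at x)"

definition twice_differentiable :: "(real ^ 'd \<Rightarrow> real) \<Rightarrow> bool" where
  "twice_differentiable f \<longleftrightarrow>
     (\<forall>x. f differentiable (at x)) \<and> (\<forall>x. grad f differentiable (at x))"

definition holder :: "real \<Rightarrow> (real ^ 'd \<Rightarrow> 'b::real_normed_vector) \<Rightarrow> bool" where
  "holder \<beta> f \<longleftrightarrow> (\<exists>C. \<forall>x y. norm (f x - f y) \<le> C * dist x y powr \<beta>)"

definition holder_seminorm :: "real \<Rightarrow> (real ^ 'd \<Rightarrow> 'b::real_normed_vector) \<Rightarrow> real" where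
  "holder_seminorm \<beta> f = (SUP (x, y)\<in>{(x, y). x \<noteq> y}. norm (f x - f y) / dist x y powr \<beta>)"

definition C2_holder :: "real \<Rightarrow> (real ^ 'd \<Rightarrow> real) \<Rightarrow> bool" where
  "C2_holder \<beta> f \<longleftrightarrow> periodic f \<and> twice_differentiable f \<and> holder \<beta> (hess f)"

definition C2_holder_norm :: "real \<Rightarrow> (real ^ 'd \<Rightarrow> real) \<Rightarrow> real" where
  "C2_holder_norm \<beta> f =
     (SUP x. \<bar>f x\<bar>) + (SUP x. norm (grad f x)) + (SUP x. norm (hess f x)) + holder_seminorm \<beta> (hess f)"

definition time_deriv :: "real \<Rightarrow> (real ^ 'd \<Rightarrow> real \<Rightarrow> real) \<Rightarrow> real ^ 'd \<Rightarrow> real \<Rightarrow> real" where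
  "time_deriv T u x t = vector_derivative (\<lambda>\<tau>. u x \<tau>) (at t within {0..T})"

text \<open>
  The space \<open>C^{2s,1}\<close> on the closed cylinder, for \<open>1/2 < s < 1\<close>: since \<open>2s = 1 + (2s - 1)\<close>, order
  \<open>2s\<close> in space means a spatial gradient that is \<open>(2s - 1)\<close>-Hoelder, uniformly in time.  Time
  derivatives at \<open>0\<close> and \<open>T\<close> are one-sided.
\<close>

definition C_2s_1 :: "real \<Rightarrow> real \<Rightarrow> (real ^ 'd \<Rightarrow> real \<Rightarrow> real) \<Rightarrow> bool" where
  "C_2s_1 s T u \<longleftrightarrow>
     (\<forall>t\<in>{0..T}. periodic (\<lambda>x. u x t)) \<and>
     (\<forall>x. \<forall>t\<in>{0..T}. (\<lambda>y. u y t) differentiable (at x)) \<and>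
     (\<forall>x. \<forall>t\<in>{0..T}. (\<lambda>\<tau>. u x \<tau>) differentiable (at t within {0..T})) \<and>
     continuous_on (UNIV \<times> {0..T}) (\<lambda>(x, t). u x t) \<and>
     continuous_on (UNIV \<times> {0..T}) (\<lambda>(x, t). grad (\<lambda>y. u y t) x) \<and>
     continuous_on (UNIV \<times> {0..T}) (\<lambda>(x, t). time_deriv T u x t) \<and>
     (\<exists>C. \<forall>t\<in>{0..T}. \<forall>x y.
        norm (grad (\<lambda>z. u z t) x - grad (\<lambda>z. u z t) y) \<le> C * dist x y powr (2 * s - 1))"

primrec C_k :: "nat \<Rightarrow> ('a::euclidean_space \<Rightarrow> real) \<Rightarrow> bool" where
  "C_k 0 f \<longleftrightarrow> continuous_on UNIV f"
| "C_k (Suc k) f \<longleftrightarrow> (\<forall>x. f differentiable (at x)) \<and>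
     (\<forall>b\<in>Basis. C_k k (\<lambda>x. frechet_derivative f (at x) b))"

definition test_function :: "real \<Rightarrow> ((real ^ 'd) \<times> real \<Rightarrow> real) \<Rightarrow> bool" where
  "test_function T \<phi> \<longleftrightarrow>
     (\<forall>k. C_k k \<phi>) \<and> (\<forall>t. periodic (\<lambda>x. \<phi> (x, t))) \<and>
     (\<exists>a b. 0 < a \<and> b < T \<and> (\<forall>x t. t \<notin> {a..b} \<longrightarrow> \<phi> (x, t) = 0))"


section \<open>Fourier series, fractional Laplacian, Bessel potentials\<close>

definition character :: "int ^ 'd \<Rightarrow> real ^ 'd \<Rightarrow> complex" where
  "character k x = cis (2 * pi * (int_vec k \<bullet> x))"

definition fourier_coeff :: "(real ^ 'd \<Rightarrow> complex) \<Rightarrow> int ^ 'd \<Rightarrow> complex" where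
  "fourier_coeff f k = (LINT x:cell|lborel. f x * cnj (character k x))"

definition fourier_coeff_measure :: "(real ^ 'd) measure \<Rightarrow> int ^ 'd \<Rightarrow> complex" where
  "fourier_coeff_measure m k = (LINT x|m. cnj (character k x))"

text \<open>
  \<open>frac_laplacian s v g\<close> says that \<open>(-\<Delta>)\<^sup>s v\<close> is the continuous function \<open>g\<close>.  For \<open>v\<close> of class
  \<open>C^{2s}\<close> the defining Fourier series need not converge absolutely, so it is summed
  (unconditionally) in \<open>L\<^sup>2\<close> of the torus; continuity makes \<open>g\<close> unique.
\<close>

definition frac_laplacian :: "real \<Rightarrow> (real ^ 'd \<Rightarrow> real) \<Rightarrow> (real ^ 'd \<Rightarrow> real) \<Rightarrow> bool" where
  "frac_laplacian s v g \<longleftrightarrow>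
     continuous_on UNIV g \<and> periodic g \<and>
     ((\<lambda>F. LINT x:cell|lborel.
         (cmod (of_real (g x) - of_real ((2 * pi) powr (2 * s)) *
            (\<Sum>k\<in>F. of_real (norm (int_vec k) powr (2 * s)) *
               fourier_coeff (\<lambda>y. of_real (v y)) k * character k x)))\<^sup>2)
       \<longlongrightarrow> 0) (finite_subsets_at_top UNIV)"

text \<open>
  \<open>bessel_potential \<sigma> m g\<close> says that \<open>(I - \<Delta>)\<^sup>\<sigma>\<^sup>/\<^sup>2 m\<close>, the distribution with Fourier coefficients
  \<open>(1 + 4\<pi>\<^sup>2|k|\<^sup>2)\<^sup>\<sigma>\<^sup>/\<^sup>2\<close> times those of \<open>m\<close>, is the \<open>L\<^sup>2\<close> function \<open>g\<close>.  Such a \<open>g\<close> is unique up to null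
  sets, so its norm does not depend on the choice made in \<open>H2_norm\<close>.
\<close>

definition bessel_potential :: "real \<Rightarrow> (real ^ 'd) measure \<Rightarrow> (real ^ 'd \<Rightarrow> complex) \<Rightarrow> bool" where
  "bessel_potential \<sigma> m g \<longleftrightarrow>
     g \<in> borel_measurable borel \<and> set_integrable lborel cell (\<lambda>x. (cmod (g x))\<^sup>2) \<and>
     (\<forall>k. fourier_coeff g k =
        of_real ((1 + 4 * pi\<^sup>2 * (norm (int_vec k))\<^sup>2) powr (\<sigma> / 2)) * fourier_coeff_measure m k)"

definition in_H2 :: "real \<Rightarrow> (real ^ 'd) measure \<Rightarrow> bool" where
  "in_H2 \<sigma> m \<longleftrightarrow> (\<exists>g. bessel_potential \<sigma> m g)"

definition H2_norm :: "real \<Rightarrow> (real ^ 'd) measure \<Rightarrow> real" where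
  "H2_norm \<sigma> m = sqrt (LINT x:cell|lborel. (cmod ((SOME g. bessel_potential \<sigma> m g) x))\<^sup>2)"


section \<open>Probability measures\<close>

definition prob_torus :: "(real ^ 'd) measure set" where
  "prob_torus = {m. prob_space m \<and> sets m = sets borel \<and> (AE x in m. x \<in> cell)}"

definition prob_torus_ctrl :: "((real ^ 'd) \<times> (real ^ 'd)) measure set" where
  "prob_torus_ctrl = {\<mu>. prob_space \<mu> \<and> sets \<mu> = sets borel \<and> (AE z in \<mu>. fst z \<in> cell)}"

definition weak_topology :: "'a measure set \<Rightarrow> ('a \<Rightarrow> real) set \<Rightarrow> 'a measure topology" where
  "weak_topology M F =
     topology_generated_by {{\<mu> \<in> M. (LINT z|\<mu>. \<phi> z) \<in> U} | \<phi> U. \<phi> \<in> F \<and> open U}"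

definition prob_torus_top :: "(real ^ 'd) measure topology" where
  "prob_torus_top = weak_topology prob_torus {\<phi>. continuous_on UNIV \<phi> \<and> periodic \<phi>}"

text \<open>
  Support in \<open>torus \<times> \<real>\<^sup>d\<close>: the integer translates make the neighbourhoods of \<open>x\<close> those of its
  class in the torus, so points near opposite faces of the cell count as close.
\<close>

definition ctrl_supp :: "((real ^ 'd) \<times> (real ^ 'd)) measure \<Rightarrow> ((real ^ 'd) \<times> (real ^ 'd)) set" where
  "ctrl_supp \<mu> = {(x, \<alpha>). \<forall>e>0.
     emeasure \<mu> {(y, \<beta>). (\<exists>k. dist y (x + int_vec k) < e) \<and> dist \<beta> \<alpha> < e} > 0}"

definition Lambda_inf :: "((real ^ 'd) \<times> (real ^ 'd)) measure \<Rightarrow> ennreal" where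
  "Lambda_inf \<mu> = (SUP (x, \<alpha>)\<in>ctrl_supp \<mu>. ennreal (norm \<alpha>))"

text \<open>Only used with a positive exponent.\<close>

definition ennpowr :: "ennreal \<Rightarrow> real \<Rightarrow> ennreal" where
  "ennpowr x a = (if x = \<top> then \<top> else ennreal (enn2real x powr a))"

definition Lambda :: "real \<Rightarrow> ((real ^ 'd) \<times> (real ^ 'd)) measure \<Rightarrow> ennreal" where
  "Lambda r \<mu> = ennpowr (\<integral>\<^sup>+ (x, \<alpha>). ennreal (norm \<alpha> powr r) \<partial>\<mu>) (1 / r)"

definition prob_inf :: "real \<Rightarrow> ((real ^ 'd) \<times> (real ^ 'd)) measure set" where
  "prob_inf R = {\<mu> \<in> prob_torus_ctrl. Lambda_inf \<mu> \<le> ennreal R}"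

definition prob_inf_top :: "real \<Rightarrow> ((real ^ 'd) \<times> (real ^ 'd)) measure topology" where
  "prob_inf_top R = weak_topology (prob_inf R)
     {\<phi>. continuous_on UNIV \<phi> \<and> bounded (range \<phi>) \<and> (\<forall>\<alpha>. periodic (\<lambda>x. \<phi> (x, \<alpha>)))}"

definition Theta :: "real \<Rightarrow> ((real ^ 'd) \<times> (real ^ 'd)) measure \<Rightarrow> ((real ^ 'd) \<times> (real ^ 'd)) measure" where
  "Theta \<theta> \<mu> = distr \<mu> borel (\<lambda>(x, \<alpha>). (x, \<alpha> /\<^sub>R \<theta>))"


section \<open>Lagrangian and Hamiltonian\<close>

type_synonym 'd lagrangian =
  "real ^ 'd \<Rightarrow> real ^ 'd \<Rightarrow> ((real ^ 'd) \<times> (real ^ 'd)) measure \<Rightarrow> real"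

definition jointly_continuous ::
  "real \<Rightarrow> (real ^ 'd \<Rightarrow> real ^ 'd \<Rightarrow> ((real ^ 'd) \<times> (real ^ 'd)) measure \<Rightarrow> 'b::topological_space) \<Rightarrow> bool" where
  "jointly_continuous R F \<longleftrightarrow>
     continuous_map (prod_topology euclidean (prod_topology euclidean (prob_inf_top R))) euclidean
       (\<lambda>(x, \<alpha>, \<mu>). F x \<alpha> \<mu>)"

text \<open>
  The monotonicity inequality is required whenever its integrals exist.  The two growth bounds
  carry no information when \<open>Lambda\<close> is infinite, hence the guards, which allow them to be written
  in the reals.
\<close>

definition admissible_lagrangian :: "real \<Rightarrow> real \<Rightarrow> 'd::finite lagrangian \<Rightarrow> bool" where
  "admissible_lagrangian r C0 L \<longleftrightarrow>
     (\<forall>\<mu>\<in>prob_torus_ctrl. \<forall>\<alpha>. periodic (\<lambda>x. L x \<alpha> \<mu>)) \<and>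
     (\<forall>\<mu>\<in>prob_torus_ctrl. \<forall>x. twice_differentiable (\<lambda>\<alpha>. L x \<alpha> \<mu>) \<and>
        (\<forall>\<alpha> v. v \<noteq> 0 \<longrightarrow> v \<bullet> (hess (\<lambda>\<alpha>. L x \<alpha> \<mu>) \<alpha> *v v) > 0)) \<and>
     (\<forall>\<mu>\<in>prob_torus_ctrl. \<forall>z. (\<lambda>(x, \<alpha>). L x \<alpha> \<mu>) differentiable (at z)) \<and>
     (\<forall>\<mu>\<in>prob_torus_ctrl. \<forall>\<alpha>. twice_differentiable (\<lambda>x. L x \<alpha> \<mu>)) \<and>
     (\<forall>R>0. jointly_continuous R L \<and>
        jointly_continuous R (\<lambda>x \<alpha> \<mu>. grad (\<lambda>y. L y \<alpha> \<mu>) x) \<and>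
        jointly_continuous R (\<lambda>x \<alpha> \<mu>. grad (\<lambda>a. L x a \<mu>) \<alpha>) \<and>
        jointly_continuous R (\<lambda>x \<alpha> \<mu>. hess (\<lambda>y. L y \<alpha> \<mu>) x)) \<and>
     (\<forall>\<mu>1\<in>prob_torus_ctrl. \<forall>\<mu>2\<in>prob_torus_ctrl.
        integrable \<mu>1 (\<lambda>(x, \<alpha>). L x \<alpha> \<mu>1 - L x \<alpha> \<mu>2) \<and>
        integrable \<mu>2 (\<lambda>(x, \<alpha>). L x \<alpha> \<mu>1 - L x \<alpha> \<mu>2) \<longrightarrow>
        (LINT (x, \<alpha>)|\<mu>1. L x \<alpha> \<mu>1 - L x \<alpha> \<mu>2) - (LINT (x, \<alpha>)|\<mu>2. L x \<alpha> \<mu>1 - L x \<alpha> \<mu>2) \<ge> 0) \<and>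
     (\<forall>\<mu>\<in>prob_torus_ctrl. Lambda r \<mu> < \<top> \<longrightarrow> (\<forall>x \<alpha>.
        L x \<alpha> \<mu> \<ge> norm \<alpha> powr r / C0 - C0 * (1 + enn2real (Lambda r \<mu>) powr r))) \<and>
     (\<forall>\<mu>\<in>prob_torus_ctrl. Lambda r \<mu> < \<top> \<longrightarrow> (\<forall>x \<alpha>.
        \<bar>L x \<alpha> \<mu>\<bar> + norm (grad (\<lambda>y. L y \<alpha> \<mu>) x)
          \<le> C0 * (1 + norm \<alpha> powr r + enn2real (Lambda r \<mu>) powr r)))"

definition hamiltonian :: "'d::finite lagrangian \<Rightarrow> 'd lagrangian" where
  "hamiltonian L x p \<mu> = (SUP \<alpha>. - (p \<bullet> \<alpha>) - L x \<alpha> \<mu>)"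

definition hamiltonian_scaled :: "real \<Rightarrow> 'd::finite lagrangian \<Rightarrow> 'd lagrangian" where
  "hamiltonian_scaled \<theta> L x p \<mu> = \<theta> * hamiltonian L x p (Theta \<theta> \<mu>)"

definition D_p_hamiltonian ::
  "real \<Rightarrow> 'd::finite lagrangian \<Rightarrow> real ^ 'd \<Rightarrow> real ^ 'd \<Rightarrow> ((real ^ 'd) \<times> (real ^ 'd)) measure \<Rightarrow> real ^ 'd" where
  "D_p_hamiltonian \<theta> L x p \<mu> = grad (\<lambda>p'. hamiltonian_scaled \<theta> L x p' \<mu>) p"

text \<open>
  The supremum is a real number only if the set is bounded above, and \<open>D_p_hamiltonian\<close> is
  meaningful only if the derivative exists.  For an admissible Lagrangian both hold at every \<open>\<mu>\<close>
  with finite \<open>Lambda\<close> (superlinear growth and strict convexity); for other \<open>\<mu>\<close> this predicate is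
  what it means for the expressions in the system to be defined.
\<close>

definition hamiltonian_defined ::
  "real \<Rightarrow> 'd::finite lagrangian \<Rightarrow> real ^ 'd \<Rightarrow> real ^ 'd \<Rightarrow> ((real ^ 'd) \<times> (real ^ 'd)) measure \<Rightarrow> bool" where
  "hamiltonian_defined \<theta> L x p \<mu> \<longleftrightarrow>
     (\<forall>\<^sub>F p' in nhds p. bdd_above (range (\<lambda>\<alpha>. - (p' \<bullet> \<alpha>) - L x \<alpha> (Theta \<theta> \<mu>)))) \<and>
     (\<lambda>p'. hamiltonian_scaled \<theta> L x p' \<mu>) differentiable (at p)"


section \<open>Data and solutions\<close>

definition admissible_data ::
  "real \<Rightarrow> real \<Rightarrow> real \<Rightarrow> real \<Rightarrow> (real ^ 'd) measure \<Rightarrow> (real ^ 'd \<Rightarrow> real) \<Rightarrow> bool" where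
  "admissible_data C0 \<beta>0 \<epsilon>0 s m0 uT \<longleftrightarrow>
     m0 \<in> prob_torus \<and> in_H2 (s - 1 + \<epsilon>0) m0 \<and> C2_holder \<beta>0 uT \<and>
     (LINT x|m0. (norm x)\<^sup>2) + H2_norm (s - 1 + \<epsilon>0) m0 + C2_holder_norm \<beta>0 uT \<le> C0"

text \<open>
  Classical solution of the backward equation: on the open time interval the fractional Laplacian
  of \<open>u\<close> is a continuous function \<open>g\<close> of space and time, and the equation holds at every point.
\<close>

definition solves_hjb ::
  "real \<Rightarrow> real \<Rightarrow> real \<Rightarrow> 'd::finite lagrangian \<Rightarrow> (real ^ 'd \<Rightarrow> real \<Rightarrow> real) \<Rightarrow>
     (real \<Rightarrow> ((real ^ 'd) \<times> (real ^ 'd)) measure) \<Rightarrow> bool" where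
  "solves_hjb s \<theta> T L u \<mu> \<longleftrightarrow>
     (\<exists>g. continuous_on (UNIV \<times> {0<..<T}) (\<lambda>(x, t). g x t) \<and>
        (\<forall>t\<in>{0<..<T}. frac_laplacian s (\<lambda>x. u x t) (\<lambda>x. g x t) \<and>
          (\<forall>x. - time_deriv T u x t + g x t +
             hamiltonian_scaled \<theta> L x (grad (\<lambda>y. u y t) x) (\<mu> t) = 0)))"

text \<open>
  Distributional solution of \<open>\<partial>\<^sub>t m + (-\<Delta>)\<^sup>s m - div (b m) = 0\<close>.  Integrability is demanded
  explicitly because Bochner integrals of non-integrable functions are zero by convention.
\<close>

definition solves_fokker_planck ::
  "real \<Rightarrow> real \<Rightarrow> (real ^ 'd \<Rightarrow> real \<Rightarrow> real ^ 'd) \<Rightarrow> (real \<Rightarrow> (real ^ 'd) measure) \<Rightarrow> bool" where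
  "solves_fokker_planck s T b m \<longleftrightarrow>
     (AE t in lborel. t \<in> {0<..<T} \<longrightarrow> integrable (m t) (\<lambda>x. b x t)) \<and>
     (\<forall>\<phi> \<psi>. test_function T \<phi> \<and> (\<forall>t. frac_laplacian s (\<lambda>x. \<phi> (x, t)) (\<lambda>x. \<psi> x t)) \<longrightarrow>
        (let I = (\<lambda>t. LINT x|m t.
               - vector_derivative (\<lambda>\<tau>. \<phi> (x, \<tau>)) (at t) + \<psi> x t + b x t \<bullet> grad (\<lambda>y. \<phi> (y, t)) x)
         in set_integrable lborel {0<..<T} I \<and> (LINT t:{0<..<T}|lborel. I t) = 0))"

definition mfgc_solution ::
  "real \<Rightarrow> real \<Rightarrow> real \<Rightarrow> 'd::finite lagrangian \<Rightarrow> (real ^ 'd) measure \<Rightarrow> (real ^ 'd \<Rightarrow> real) \<Rightarrow>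
     (real ^ 'd \<Rightarrow> real \<Rightarrow> real) \<Rightarrow> (real \<Rightarrow> (real ^ 'd) measure) \<Rightarrow>
     (real \<Rightarrow> ((real ^ 'd) \<times> (real ^ 'd)) measure) \<Rightarrow> bool" where
  "mfgc_solution s \<theta> T L m0 uT u m \<mu> \<longleftrightarrow>
     C_2s_1 s T u \<and>
     continuous_map (top_of_set {0..T}) prob_torus_top m \<and>
     (\<forall>t\<in>{0..T}. \<mu> t \<in> prob_torus_ctrl) \<and>
     (\<forall>t\<in>{0..T}. \<forall>x. hamiltonian_defined \<theta> L x (grad (\<lambda>y. u y t) x) (\<mu> t)) \<and>
     solves_hjb s \<theta> T L u \<mu> \<and>
     solves_fokker_planck s T (\<lambda>x t. D_p_hamiltonian \<theta> L x (grad (\<lambda>y. u y t) x) (\<mu> t)) m \<and>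
     (\<forall>t\<in>{0..T}. \<mu> t = distr (m t) borel
        (\<lambda>x. (x, - D_p_hamiltonian \<theta> L x (grad (\<lambda>y. u y t) x) (\<mu> t)))) \<and>
     m 0 = m0 \<and> (\<forall>x. u x T = \<theta> * uT x)"

end

theory Submission
  imports Defs
begin

text \<open>
  The estimate compares the solution with a competitor that uses the control \<open>0\<close>.

  Fix a time and write \<open>h = H\<^sup>\<theta>(x, Du, \<mu>)\<close>, \<open>b = D\<^sub>pH\<^sup>\<theta>(x, Du, \<mu>)\<close> and \<open>a = - b / \<theta>\<close>, so that
  \<open>\<nu> = \<Theta>(\<mu>)\<close> is the law of \<open>(x, a(x))\<close> under \<open>m\<close>.  Legendre duality gives \<open>\<theta> L(x, a, \<nu>) = b \<bullet> Du - h\<close>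
  and \<open>- \<theta> L(x, 0, \<nu>) \<le> h\<close>.  Coercivity of \<open>L\<close> at \<open>\<nu>\<close> itself is of no help, because the lower bound contains
  \<open>- C0 \<Lambda>(\<nu>)\<^sup>r\<close>.  The monotonicity condition removes this term: for any probability measure \<open>m'\<close> on the torus
  put \<open>\<nu>' = m' \<otimes> \<delta>\<^sub>0\<close>; testing monotonicity with \<open>\<nu>\<close> and \<open>\<nu>'\<close> replaces the measure argument \<open>\<nu>\<close> by \<open>\<nu>'\<close>,
  for which \<open>\<Lambda> = 0\<close>.  The result, \<open>energy_inequality\<close>, is
  \<open>(\<integral> |a|\<^sup>r dm) / C0 - 2 C0 \<le> (\<integral> (b \<bullet> Du - h) dm + \<integral> h dm') / \<theta>\<close>.

  Now let \<open>m'\<close> be the solution of the fractional heat equation that starts from \<open>m(t0)\<close>.  Since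
  \<open>\<partial>\<^sub>t u = (-\<Delta>)\<^sup>s u + h\<close>, the right-hand side is \<open>1 / \<theta>\<close> times the time derivative of \<open>\<integral> u d(m' - m)\<close>.
  Integrated over \<open>[t0, t1]\<close> it leaves nothing at \<open>t0\<close> and at most \<open>2 sup |u(t1)| / \<theta>\<close> at \<open>t1\<close>, which tends to
  \<open>2 sup |u\<^sub>T| \<le> 2 C0\<close> as \<open>t1 \<rightarrow> T\<close>.  Multiplication by \<open>C0\<close>, and by \<open>\<theta>\<^sup>r\<close> to return from \<open>a\<close> to \<open>b\<close>, gives the
  constant of the theorem.

  Three points carry the weight of the proof.

  \<^item> \<^emph>\<open>Existence of the competitor\<close> (\<open>heat_flow_competitor\<close>), that is, positivity of \<open>exp (- t (-\<Delta>)\<^sup>s)\<close>.  The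
    Fourier multipliers that map nonnegative trigonometric polynomials to nonnegative ones are closed under
    products, pointwise limits and integration over parameters.  They contain \<open>cos (2 \<pi> k \<bullet> h)\<close>, since this is an
    average of two translations, hence the Gaussians, and by subordination also \<open>exp (- t |2 \<pi> k|\<^sup>2\<^sup>s)\<close>.

  \<^item> \<^emph>\<open>The product rule for \<open>\<integral> u dm\<close>\<close> (\<open>duality_identity\<close>), where \<open>m\<close> is only a distributional solution and \<open>u\<close> is
    not smooth.  The function \<open>u\<close> is replaced by its Fejer means in space.  These are finite sums over
    frequencies, so it is enough that the Fourier coefficients of \<open>u\<close> are continuously differentiable and those of
    \<open>m\<close> absolutely continuous in time.  The competitor is smoothed with the same kernel, so that the boundary term
    at \<open>t0\<close> is exactly zero.  The Fejer means of \<open>Du\<close> and of \<open>h\<close> converge uniformly on \<open>[t0, t1]\<close>, and the error in the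
    drift term, at most a small multiple of \<open>1 + \<integral> |b|\<^sup>r dm\<close>, is absorbed on the left (\<open>energy_bound_interval\<close>).

  \<^item> \<^emph>\<open>Finiteness of all integrals\<close> (\<open>optimal_feedback\<close>).  That \<open>\<Lambda>(\<mu>(t))\<close> is finite is not a hypothesis.  The
    maximiser in the definition of the Hamiltonian is unique, and convexity makes it depend continuously on \<open>x\<close>; hence
    \<open>b\<close> is bounded on the torus at every time.
\<close>

section \<open>Characters and integration over the torus\<close>

lemma int_vec_simps [simp]:
  "int_vec (0 :: int ^ 'd) = 0"
  "int_vec (k + l :: int ^ 'd) = int_vec k + int_vec l"
  "int_vec (k - l :: int ^ 'd) = int_vec k - int_vec l"
  "int_vec (- k :: int ^ 'd) = - int_vec k"
  "int_vec (axis i 1 :: int ^ 'd) = axis i 1"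
  by (simp_all add: int_vec_def vec_eq_iff axis_def)

lemma character_simps [simp]:
  "character 0 x = 1"
  "cmod (character k x) = 1"
  "cnj (character k x) = character (- k) x"
  by (simp_all add: character_def cis_cnj)

lemma character_add: "character (k + l) x = character k x * character l x"
  by (simp add: character_def cis_mult inner_left_distrib algebra_simps)

lemma character_diff: "character (k - l) x = character k x * cnj (character l x)"
  using character_add [of k "- l" x] by simp

lemma character_shift: "character k (x + y) = character k x * character k y"
  by (simp add: character_def cis_mult inner_right_distrib algebra_simps)

lemma character_minus_arg: "character k (- x) = cnj (character k x)"
  by (simp add: character_def cis_cnj)

lemma continuous_on_character [continuous_intros]:
  "continuous_on S f \<Longrightarrow> continuous_on S (\<lambda>x. character k (f x))"
  unfolding character_def by (intro continuous_intros)

lemma borel_measurable_character [measurable]: "character k \<in> borel_measurable borel"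
  by (intro borel_measurable_continuous_onI continuous_intros)

lemma character_axis: "character k (axis i 1) = 1"
proof -
  have "int_vec k \<bullet> axis i 1 = of_int (k $ i)"
    by (simp add: int_vec_def inner_axis)
  then show ?thesis
    unfolding character_def using cis_multiple_2pi [of "of_int (k $ i)"] by simp
qed

lemma periodic_character: "periodic (character k)"
  by (simp add: periodic_def character_shift character_axis)

lemma periodic_axis_int:
  assumes "periodic f" shows "f (x + of_int n *\<^sub>R axis i 1) = f x"
proof -
  have nat: "f (y + real n *\<^sub>R axis i 1) = f y" for y and n :: nat
  proof (induction n arbitrary: y)
    case (Suc n)
    have "f (y + real (Suc n) *\<^sub>R axis i 1) = f ((y + real n *\<^sub>R axis i 1) + axis i 1)"
      by (simp add: algebra_simps)
    also have "\<dots> = f (y + real n *\<^sub>R axis i 1)"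
      using assms unfolding periodic_def by blast
    finally show ?case using Suc by simp
  qed simp
  show ?thesis
  proof (cases "n \<ge> 0")
    case True
    then show ?thesis using nat [of x "nat n"] by simp
  next
    case False
    then show ?thesis using nat [of "x + of_int n *\<^sub>R axis i 1" "nat (- n)"]
      by (simp add: algebra_simps)
  qed
qed

lemma periodic_int_vec:
  fixes f :: "real ^ 'd \<Rightarrow> 'b"
  assumes "periodic f" shows "f (x + int_vec k) = f x"
proof -
  have "f (x + (\<Sum>i\<in>S. of_int (k $ i) *\<^sub>R axis i 1)) = f x" if "finite S" for S
    using that
  proof (induction S)
    case (insert j S)
    have "x + (\<Sum>i\<in>insert j S. of_int (k $ i) *\<^sub>R axis i 1) =
          (x + (\<Sum>i\<in>S. of_int (k $ i) *\<^sub>R axis i 1)) + of_int (k $ j) *\<^sub>R axis j 1"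
      using insert by simp
    then show ?case
      using insert.IH by (simp only: periodic_axis_int [OF assms])
  qed simp
  moreover have "int_vec k = (\<Sum>i\<in>UNIV. of_int (k $ i) *\<^sub>R axis i 1)"
    by (simp add: vec_eq_iff int_vec_def axis_def if_distrib cong: if_cong)
  ultimately show ?thesis by simp
qed

lemma exists_cell_representative: "\<exists>k. x + int_vec k \<in> cell"
proof
  show "x + int_vec (\<chi> i. - \<lfloor>x $ i\<rfloor>) \<in> cell"
    by (auto simp: cell_def int_vec_def) linarith+
qed

lemma cell_subset_cbox: "cell \<subseteq> cbox (0 :: real ^ 'd) 1"
  by (simp add: cell_def mem_box_cart subset_iff less_imp_le)

lemma sets_cell [measurable]: "(cell :: (real ^ 'd) set) \<in> sets borel"
  unfolding cell_def by measurable

lemma cell_diff_null: "cbox 0 1 - (cell :: (real ^ 'd) set) \<in> null_sets lborel"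
proof -
  have "negligible (cbox (0 :: real ^ 'd) 1 - box 0 1)"
    using negligible_frontier_interval[of 0 1] by (simp add: negligible_subset Diff_mono)
  then have "negligible (cbox 0 1 - (cell :: (real ^ 'd) set))"
    by (rule negligible_subset) (auto simp: cell_def mem_box_cart intro: less_imp_le)
  then show ?thesis
    by (simp add: negligible_iff_null_sets null_sets_def emeasure_completion main_part_sets)
qed

lemma emeasure_cell: "emeasure lborel (cell :: (real ^ 'd) set) = 1"
proof -
  have "emeasure lborel (cbox (0 :: real ^ 'd) 1) = 1"
    by (auto simp: emeasure_lborel_cbox_eq Basis_vec_def inner_axis intro!: prod.neutral)
  moreover have "emeasure lborel ((cell :: (real ^ 'd) set) \<union> (cbox 0 1 - cell)) = emeasure lborel (cell :: (real ^ 'd) set)"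
    by (rule emeasure_Un_null_set [OF _ cell_diff_null]) simp
  ultimately show ?thesis
    using Un_absorb1 [OF cell_subset_cbox] by (metis Un_Diff_cancel)
qed

text \<open>
  Normalised Lebesgue measure of the torus, as a Borel measure on the whole space that charges only the cell.
  It is an element of \<open>prob_torus\<close>, so facts about \<open>m(t)\<close> apply to it as well.
\<close>

definition haar :: "(real ^ 'd) measure" where
  "haar = density lborel (indicator cell)"

lemma sets_haar [simp, measurable_cong]: "sets haar = sets borel"
  and space_haar [simp]: "space haar = UNIV"
  by (simp_all add: haar_def)

lemma prob_torusD:
  assumes "m \<in> prob_torus"
  shows "prob_space m" "sets m = sets borel" "AE x in m. x \<in> cell"
  using assms by (simp_all add: prob_torus_def)

lemma AE_haar: "(AE x in haar. P x) \<longleftrightarrow> (AE x in lborel. x \<in> cell \<longrightarrow> P x)"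
  unfolding haar_def by (subst AE_density) (auto simp: indicator_def split: if_splits)

lemma haar_in_prob_torus: "haar \<in> prob_torus"
proof -
  have "emeasure haar UNIV = 1"
    unfolding haar_def using emeasure_cell by (subst emeasure_density) auto
  then have "prob_space haar"
    by (intro prob_spaceI) simp
  then show ?thesis by (simp add: prob_torus_def AE_haar)
qed

lemma set_integral_cell:
  fixes f :: "real ^ 'd \<Rightarrow> 'b::{banach, second_countable_topology}"
  assumes [measurable]: "f \<in> borel_measurable borel"
  shows "(LINT x:cell|lborel. f x) = (LINT x|haar. f x)"
proof -
  have "haar = density lborel (\<lambda>x. ennreal (indicator (cell :: (real ^ 'd) set) x))"
    by (simp add: haar_def ennreal_indicator)
  then show ?thesis
    unfolding set_lebesgue_integral_def by (subst \<open>haar = _\<close>, subst integral_density) auto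
qed

text \<open>
  Continuous functions are bounded on the closed cube, and the cube carries all the mass.  Once the feedback is
  known to be continuous, this settles the integrability of its powers and of \<open>L\<close> along it.
\<close>

lemma integrable_continuous_torus:
  fixes f :: "real ^ 'd \<Rightarrow> 'b::{banach, second_countable_topology}"
  assumes "m \<in> prob_torus" "continuous_on UNIV f"
  shows "integrable m f"
proof -
  note m = prob_torusD(1) [OF assms(1)] and sets = prob_torusD(2) [OF assms(1)]
    and cell = prob_torusD(3) [OF assms(1)]
  have "compact (f ` cbox 0 1)"
    by (intro compact_continuous_image compact_cbox continuous_on_subset [OF assms(2)] subset_UNIV)
  then have "bounded (f ` cbox 0 1)"
    by (rule compact_imp_bounded)
  then obtain B where B: "\<And>x. x \<in> cbox 0 1 \<Longrightarrow> norm (f x) \<le> B"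
    unfolding bounded_iff by blast
  have bound: "AE x in m. norm (f x) \<le> B"
    using cell by eventually_elim (rule B [OF subsetD [OF cell_subset_cbox]])
  have "f \<in> borel_measurable m"
    unfolding measurable_cong_sets [OF sets refl] by (rule borel_measurable_continuous_onI [OF assms(2)])
  then show ?thesis
    using finite_measure.integrable_const_bound [OF prob_space.finite_measure [OF m] bound] by blast
qed

text \<open>
  The translated cell is cut at the face \<open>x\<^sub>i = 1\<close>; the part that sticks out is moved back by one period.
\<close>

lemma integral_haar_translate:
  fixes f :: "real ^ 'd \<Rightarrow> 'b::{banach, second_countable_topology}"
  assumes f: "continuous_on UNIV f" "periodic f" and s: "0 \<le> s" "s \<le> 1"
  shows "(LINT x|haar. f (x + s *\<^sub>R axis i 1)) = (LINT x|haar. f x)"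
proof -
  define a where "a = (axis i 1 :: real ^ 'd)"
  define A where "A = {x \<in> cell. (x :: real ^ 'd) $ i < 1 - s}"
  define B where "B = {x \<in> cell. (x :: real ^ 'd) $ i \<ge> 1 - s}"
  have [measurable]: "A \<in> sets borel" "B \<in> sets borel" "f \<in> borel_measurable borel"
    unfolding A_def B_def using borel_measurable_continuous_onI [OF f(1)] by measurable
  have cont: "continuous_on UNIV (\<lambda>x. f (x + c))" for c
    by (intro continuous_on_compose2 [OF f(1)] continuous_intros) auto
  have int: "set_integrable lborel cell (\<lambda>x. f (x + c))" for c
  proof -
    have "integrable haar (\<lambda>x. f (x + c))"
      by (rule integrable_continuous_torus [OF haar_in_prob_torus cont])
    moreover have "haar = density lborel (\<lambda>x. ennreal (indicator (cell :: (real ^ 'd) set) x))"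
      by (simp add: haar_def ennreal_indicator)
    ultimately show ?thesis
      unfolding set_integrable_def using integrable_density [of "\<lambda>x. f (x + c)" lborel "indicator cell"]
      by (simp add: borel_measurable_continuous_onI [OF cont])
  qed
  have cell: "cell = A \<union> B" "A \<inter> B = {}"
    unfolding A_def B_def by auto
  have sub: "A \<subseteq> cell" "B \<subseteq> cell" using cell by auto
  have a_nth: "a $ j = (if j = i then 1 else 0)" for j
    by (simp add: a_def axis_def)
  have mem: "x \<in> (\<lambda>x. x + c) ` S \<longleftrightarrow> x - c \<in> S" for x c :: "real ^ 'd" and S
    by force
  have shift: "(LINT x:S|lborel. f (x + c)) = (LINT x:(\<lambda>x. x + c) ` S|lborel. f x)"
    if [measurable]: "S \<in> sets borel" for S c
  proof -
    have eq: "(indicator S (x - c) :: real) = indicator ((\<lambda>x. x + c) ` S) x" for x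
      by (simp add: indicator_def mem)
    have "(LINT x:S|lborel. f (x + c)) = (LINT x|distr lborel borel ((+) c). indicator S (x - c) *\<^sub>R f x)"
      unfolding set_lebesgue_integral_def by (subst integral_distr) (auto simp: add.commute)
    then show ?thesis
      unfolding lborel_distr_plus eq set_lebesgue_integral_def .
  qed
  have image_sets: "(\<lambda>x. x + c) ` S \<in> sets borel" if [measurable]: "S \<in> sets borel" for S and c :: "real ^ 'd"
  proof -
    have "(\<lambda>x. x + c) ` S = (\<lambda>x. x - c) -` S \<inter> space borel"
      by (auto simp: mem)
    moreover have "(\<lambda>x. x - c) -` S \<inter> space borel \<in> sets borel"
      by (rule measurable_sets [of "\<lambda>x. x - c" borel borel]) (simp, rule that)
    ultimately show ?thesis by simp
  qed
  define A' where "A' = (\<lambda>x. x + s *\<^sub>R a) ` A"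
  define B' where "B' = (\<lambda>x. x + (s - 1) *\<^sub>R a) ` B"
  have cell_iff: "x \<in> cell \<longleftrightarrow> (\<forall>j. j \<noteq> i \<longrightarrow> 0 \<le> x $ j \<and> x $ j < 1) \<and> 0 \<le> x $ i \<and> x $ i < 1" for x :: "real ^ 'd"
    unfolding cell_def by auto
  have A': "x \<in> A' \<longleftrightarrow> x \<in> cell \<and> x $ i \<ge> s" for x
    using s unfolding A'_def mem A_def mem_Collect_eq cell_iff by (simp add: a_nth) argo
  have B': "x \<in> B' \<longleftrightarrow> x \<in> cell \<and> x $ i < s" for x
    using s unfolding B'_def mem B_def mem_Collect_eq cell_iff by (simp add: a_nth) argo
  have cell': "cell = A' \<union> B'" "A' \<inter> B' = {}"
    using A' B' by force+
  have [measurable]: "A' \<in> sets borel" "B' \<in> sets borel"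
    by (auto simp: A'_def B'_def intro!: image_sets)
  have per: "f (x + s *\<^sub>R a) = f (x + (s - 1) *\<^sub>R a)" for x
    using f(2) [unfolded periodic_def, rule_format, of "x + (s - 1) *\<^sub>R a" i]
    by (simp add: a_def algebra_simps)
  have "(LINT x:cell|lborel. f (x + s *\<^sub>R a)) =
        (LINT x:A|lborel. f (x + s *\<^sub>R a)) + (LINT x:B|lborel. f (x + s *\<^sub>R a))"
    unfolding cell(1)
    by (intro set_integral_Un cell(2) set_integrable_subset [OF int] sub) auto
  also have "(LINT x:A|lborel. f (x + s *\<^sub>R a)) = (LINT x:A'|lborel. f x)"
    unfolding A'_def by (rule shift) measurable
  also have "(LINT x:B|lborel. f (x + s *\<^sub>R a)) = (LINT x:B'|lborel. f x)"
    unfolding B'_def per by (rule shift) measurable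
  also have "(LINT x:A'|lborel. f x) + (LINT x:B'|lborel. f x) = (LINT x:cell|lborel. f x)"
    unfolding cell'(1)
    by (intro set_integral_Un [symmetric] cell'(2) set_integrable_subset [OF int [of 0, simplified]])
       (auto simp: cell'(1))
  finally show ?thesis
    unfolding a_def by (simp add: set_integral_cell borel_measurable_continuous_onI cont f(1))
qed

lemma integral_haar_character:
  fixes k :: "int ^ 'd"
  shows "(LINT x|haar. character k x) = (if k = 0 then 1 else 0)"
proof (cases "k = 0")
  case True
  interpret prob_space "haar :: (real ^ 'd) measure"
    by (rule prob_torusD(1) [OF haar_in_prob_torus])
  show ?thesis using True prob_space by simp
next
  case False
  then obtain i where i: "k $ i \<noteq> 0" by (auto simp: vec_eq_iff)
  define s where "s = 1 / (2 * \<bar>real_of_int (k $ i)\<bar>)"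
  have s: "0 \<le> s" "s \<le> 1"
    using i by (auto simp: s_def divide_simps)
  have H: "2 * pi * (int_vec k \<bullet> s *\<^sub>R axis i 1) = pi \<or> 2 * pi * (int_vec k \<bullet> s *\<^sub>R axis i 1) = - pi"
    using i by (auto simp: s_def int_vec_def inner_axis divide_simps abs_if)
  have minus: "cis (- pi) = -1"
    using cis_cnj [of pi] by simp
  \<comment> \<open>Translation by half a wavelength changes the sign of the character.\<close>
  with H have "character k (s *\<^sub>R axis i 1) = -1"
    unfolding character_def by (elim disjE) (simp_all only: cis_pi minus)
  then have "(LINT x|haar. character k x) = - (LINT x|haar. character k x)"
    using integral_haar_translate [OF _ periodic_character s, of k i]
    by (simp add: continuous_on_character character_shift)
  then show ?thesis using False by simp
qed

text \<open>
  Integration by parts on the torus.  By translation invariance the integral of every difference quotient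
  vanishes, and the quotients converge boundedly to the derivative.
\<close>

lemma integral_haar_partial_derivative:
  fixes f :: "real ^ 'd \<Rightarrow> real"
  assumes diff: "\<And>x. f differentiable (at x)" and cont: "continuous_on UNIV (\<lambda>x. grad f x $ i)"
    and per: "periodic f"
  shows "(LINT x|haar. grad f x $ i) = 0"
proof -
  define a where "a = (axis i 1 :: real ^ 'd)"
  have contf: "continuous_on UNIV f"
    using diff by (simp add: differentiable_imp_continuous_on differentiable_on_def)
  have deriv: "((\<lambda>s. f (x + s *\<^sub>R a)) has_real_derivative grad f (x + s *\<^sub>R a) $ i) (at s)" for x s
  proof -
    have "(f has_derivative frechet_derivative f (at (x + s *\<^sub>R a))) (at (x + s *\<^sub>R a))"
      using diff frechet_derivative_works by blast
    then have "((\<lambda>s. f (x + s *\<^sub>R a)) has_derivative (\<lambda>h. frechet_derivative f (at (x + s *\<^sub>R a)) (h *\<^sub>R a))) (at s)"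
      by (rule has_derivative_compose [rotated]) (auto intro!: derivative_eq_intros)
    moreover have "frechet_derivative f (at y) (h *\<^sub>R a) = grad f y $ i * h" for y h
      using linear_scale [OF linear_frechet_derivative [OF diff]] by (simp add: grad_def a_def)
    ultimately show ?thesis by (simp add: has_field_derivative_def)
  qed
  define q where "q n x = real (Suc n) * (f (x + (1 / real (Suc n)) *\<^sub>R a) - f x)" for n x
  have contq: "continuous_on UNIV (q n)" for n
    unfolding q_def by (intro continuous_intros continuous_on_compose2 [OF contf]) auto
  have mv: "\<exists>s. 0 \<le> s \<and> s \<le> 1 \<and> q n x = grad f (x + s *\<^sub>R a) $ i" for n x
  proof -
    obtain z where "0 < z" "z < 1 / real (Suc n)" and mvt:
      "f (x + (1 / real (Suc n)) *\<^sub>R a) - f (x + 0 *\<^sub>R a) = (1 / real (Suc n) - 0) * grad f (x + z *\<^sub>R a) $ i"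
      using MVT2 [of 0 "1 / real (Suc n)" "\<lambda>s. f (x + s *\<^sub>R a)" "\<lambda>s. grad f (x + s *\<^sub>R a) $ i"] deriv
      by auto
    moreover have "1 / real (Suc n) \<le> 1" by simp
    ultimately have "0 \<le> z" "z \<le> 1" by linarith+
    moreover have "q n x = grad f (x + z *\<^sub>R a) $ i"
      unfolding q_def using mvt by (simp del: of_nat_Suc)
    ultimately show ?thesis by blast
  qed
  obtain K where K: "\<And>x. x \<in> cbox 0 2 \<Longrightarrow> \<bar>grad f x $ i\<bar> \<le> K"
  proof -
    have "bounded ((\<lambda>x. grad f x $ i) ` cbox 0 2)"
      by (intro compact_imp_bounded compact_continuous_image compact_cbox continuous_on_subset [OF cont] subset_UNIV)
    then show ?thesis using that unfolding bounded_iff by auto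
  qed
  have q_bound: "norm (q n x) \<le> K" if "x \<in> cell" for n x
  proof -
    obtain s where "0 \<le> s" "s \<le> 1" "q n x = grad f (x + s *\<^sub>R a) $ i" using mv by blast
    moreover have "x + s *\<^sub>R a \<in> cbox 0 2"
      using that \<open>0 \<le> s\<close> \<open>s \<le> 1\<close>
      by (auto simp: cell_def mem_box_cart a_def axis_def; smt (verit, best))
    ultimately show ?thesis using K by simp
  qed
  have lim: "(\<lambda>n. q n x) \<longlonglongrightarrow> grad f x $ i" for x
  proof -
    have "((\<lambda>h. (f (x + h *\<^sub>R a) - f x) / h) \<longlongrightarrow> grad f x $ i) (at 0)"
      using deriv [of x 0] by (simp add: DERIV_def)
    moreover have "filterlim (\<lambda>n. 1 / real (Suc n)) (at 0) sequentially"
      unfolding filterlim_at using LIMSEQ_Suc [OF lim_const_over_n [of 1]] by simp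
    ultimately have "(\<lambda>n. (f (x + (1 / real (Suc n)) *\<^sub>R a) - f x) / (1 / real (Suc n))) \<longlonglongrightarrow> grad f x $ i"
      by (rule filterlim_compose [where g = "\<lambda>h. (f (x + h *\<^sub>R a) - f x) / h"])
    moreover have "(f (x + (1 / real (Suc n)) *\<^sub>R a) - f x) / (1 / real (Suc n)) = q n x" for n
      by (simp only: q_def divide_inverse inverse_mult_distrib inverse_inverse_eq mult_1_left mult.commute)
    ultimately show ?thesis by (simp only:)
  qed
  have "(\<lambda>n. LINT x|haar. q n x) \<longlonglongrightarrow> (LINT x|haar. grad f x $ i)"
  proof (rule integral_dominated_convergence [where w = "\<lambda>_. K"])
    show "(\<lambda>x. grad f x $ i) \<in> borel_measurable haar" "q n \<in> borel_measurable haar" for n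
      unfolding measurable_cong_sets [OF sets_haar refl]
      by (intro borel_measurable_continuous_onI cont contq)+
    show "integrable haar (\<lambda>_. K)"
      by (rule integrable_continuous_torus [OF haar_in_prob_torus]) simp
    show "AE x in haar. (\<lambda>n. q n x) \<longlonglongrightarrow> grad f x $ i" using lim by simp
    show "AE x in haar. norm (q n x) \<le> K" for n
      using q_bound by (simp add: AE_haar)
  qed
  moreover have "(LINT x|haar. q n x) = 0" for n
  proof -
    have "(LINT x|haar. q n x) =
      real (Suc n) * ((LINT x|haar. f (x + (1 / real (Suc n)) *\<^sub>R a)) - (LINT x|haar. f x))"
      unfolding q_def
      by (subst integral_mult_right_zero, subst Bochner_Integration.integral_diff)
         (auto intro!: integrable_continuous_torus [OF haar_in_prob_torus] continuous_on_compose2 [OF contf] continuous_intros)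
    also have "\<dots> = 0"
      unfolding a_def by (subst integral_haar_translate) (auto simp: contf per)
    finally show ?thesis .
  qed
  ultimately show ?thesis by (simp add: LIMSEQ_const_iff)
qed

section \<open>Positivity of the fractional heat semigroup\<close>

lemma Re_of_real_mult: "Re (of_real a * z) = a * Re z"
  by simp

text \<open>
  Positivity of the convolution operator with symbol \<open>\<phi>\<close>, expressed through its action on trigonometric
  polynomials only.  With this formulation products correspond to composition, limits to limits of finite sums, and no
  kernel has to be exhibited.
\<close>

definition positivity_preserving :: "(int ^ 'd \<Rightarrow> real) \<Rightarrow> bool" where
  "positivity_preserving \<phi> \<longleftrightarrow> (\<forall>S c. finite S \<longrightarrow>
     (\<forall>x. 0 \<le> (\<Sum>k\<in>S. Re (c k * character k x))) \<longrightarrow>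
     (\<forall>x. 0 \<le> (\<Sum>k\<in>S. \<phi> k * Re (c k * character k x))))"

lemma positivity_preservingD:
  assumes "positivity_preserving \<phi>" "finite S" "\<forall>x. 0 \<le> (\<Sum>k\<in>S. Re (c k * character k x))"
  shows "0 \<le> (\<Sum>k\<in>S. \<phi> k * Re (c k * character k x))"
  using assms unfolding positivity_preserving_def by blast

lemma positivity_preserving_const: "0 \<le> a \<Longrightarrow> positivity_preserving (\<lambda>_. a)"
  by (simp add: positivity_preserving_def flip: sum_distrib_left)

lemma positivity_preserving_add:
  "positivity_preserving \<phi> \<Longrightarrow> positivity_preserving \<psi> \<Longrightarrow> positivity_preserving (\<lambda>k. \<phi> k + \<psi> k)"
  by (simp add: positivity_preserving_def distrib_right sum.distrib)

lemma positivity_preserving_mult: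
  fixes \<phi> \<psi> :: "int ^ 'd \<Rightarrow> real"
  assumes "positivity_preserving \<phi>" "positivity_preserving \<psi>"
  shows "positivity_preserving (\<lambda>k. \<phi> k * \<psi> k)"
  unfolding positivity_preserving_def
proof (intro allI impI)
  fix S :: "(int ^ 'd) set" and c and x :: "real ^ 'd"
  assume S: "finite S" and pos: "\<forall>x. 0 \<le> (\<Sum>k\<in>S. Re (c k * character k x))"
  have "\<forall>x. 0 \<le> (\<Sum>k\<in>S. Re ((of_real (\<psi> k) * c k) * character k x))"
    unfolding mult.assoc Re_of_real_mult using positivity_preservingD [OF assms(2) S pos] by blast
  then have "0 \<le> (\<Sum>k\<in>S. \<phi> k * Re ((of_real (\<psi> k) * c k) * character k x))"
    by (rule positivity_preservingD [OF assms(1) S])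
  then show "0 \<le> (\<Sum>k\<in>S. \<phi> k * \<psi> k * Re (c k * character k x))"
    unfolding mult.assoc Re_of_real_mult .
qed

lemma positivity_preserving_power:
  "positivity_preserving \<phi> \<Longrightarrow> positivity_preserving (\<lambda>k. \<phi> k ^ n)"
  by (induction n) (simp_all add: positivity_preserving_const positivity_preserving_mult)

lemma positivity_preserving_prod:
  "finite I \<Longrightarrow> (\<And>i. i \<in> I \<Longrightarrow> positivity_preserving (\<phi> i)) \<Longrightarrow>
   positivity_preserving (\<lambda>k. \<Prod>i\<in>I. \<phi> i k)"
  by (induction rule: finite_induct) (simp_all add: positivity_preserving_const positivity_preserving_mult)

lemma positivity_preserving_limit:
  fixes \<phi> :: "nat \<Rightarrow> int ^ 'd \<Rightarrow> real"
  assumes "\<And>n. positivity_preserving (\<phi> n)" and lim: "\<And>k. (\<lambda>n. \<phi> n k) \<longlonglongrightarrow> \<psi> k"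
  shows "positivity_preserving \<psi>"
  unfolding positivity_preserving_def
proof (intro allI impI)
  fix S :: "(int ^ 'd) set" and c and x :: "real ^ 'd"
  assume S: "finite S" and pos: "\<forall>x. 0 \<le> (\<Sum>k\<in>S. Re (c k * character k x))"
  have "(\<lambda>n. \<Sum>k\<in>S. \<phi> n k * Re (c k * character k x)) \<longlonglongrightarrow> (\<Sum>k\<in>S. \<psi> k * Re (c k * character k x))"
    by (intro tendsto_intros lim)
  moreover have "0 \<le> (\<Sum>k\<in>S. \<phi> n k * Re (c k * character k x))" for n
    using positivity_preservingD [OF assms(1) S pos] .
  ultimately show "0 \<le> (\<Sum>k\<in>S. \<psi> k * Re (c k * character k x))"
    by (intro LIMSEQ_le_const) auto
qed

lemma positivity_preserving_integral:
  fixes \<phi> :: "'a \<Rightarrow> int ^ 'd \<Rightarrow> real"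
  assumes "\<And>y. positivity_preserving (\<phi> y)" and w: "\<And>y. 0 \<le> w y"
    and int: "\<And>k. integrable M (\<lambda>y. w y * \<phi> y k :: real)"
  shows "positivity_preserving (\<lambda>k. LINT y|M. w y * \<phi> y k)"
  unfolding positivity_preserving_def
proof (intro allI impI)
  fix S :: "(int ^ 'd) set" and c and x :: "real ^ 'd"
  assume S: "finite S" and pos: "\<forall>x. 0 \<le> (\<Sum>k\<in>S. Re (c k * character k x))"
  have "(\<Sum>k\<in>S. (LINT y|M. w y * \<phi> y k) * Re (c k * character k x)) =
        (LINT y|M. (\<Sum>k\<in>S. w y * \<phi> y k * Re (c k * character k x)))"
    using int by (subst Bochner_Integration.integral_sum) auto
  also have "\<dots> = (LINT y|M. w y * (\<Sum>k\<in>S. \<phi> y k * Re (c k * character k x)))"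
    by (simp only: sum_distrib_left mult.assoc)
  also have "\<dots> \<ge> 0"
    using w by (intro integral_nonneg_AE AE_I2 mult_nonneg_nonneg positivity_preservingD [OF assms(1) S pos])
  finally show "0 \<le> (\<Sum>k\<in>S. (LINT y|M. w y * \<phi> y k) * Re (c k * character k x))" .
qed

text \<open>
  This multiplier averages the translates of a polynomial by \<open>h\<close> and by \<open>- h\<close>.
\<close>

lemma positivity_preserving_cos:
  fixes h :: "real ^ 'd"
  shows "positivity_preserving (\<lambda>k. cos (2 * pi * (int_vec k \<bullet> h)))"
  unfolding positivity_preserving_def
proof (intro allI impI)
  fix S :: "(int ^ 'd) set" and c and x :: "real ^ 'd"
  assume pos: "\<forall>x. 0 \<le> (\<Sum>k\<in>S. Re (c k * character k x))"
  have "cos (2 * pi * (int_vec k \<bullet> h)) * Re (c k * character k x) =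
        (Re (c k * character k (x + h)) + Re (c k * character k (x + (- h)))) / 2" for k
  proof -
    have "character k (x + h) + character k (x + - h) =
          character k x * (character k h + cnj (character k h))"
      by (simp only: character_shift character_minus_arg distrib_left)
    also have "\<dots> = of_real (2 * cos (2 * pi * (int_vec k \<bullet> h))) * character k x"
      by (simp only: complex_add_cnj character_def cis.sel mult.commute)
    finally have "c k * character k (x + h) + c k * character k (x + - h) =
       of_real (2 * cos (2 * pi * (int_vec k \<bullet> h))) * (c k * character k x)"
      by (simp add: distrib_left [symmetric] mult_ac del: of_real_mult)
    then have "Re (c k * character k (x + h)) + Re (c k * character k (x + - h)) =
       2 * cos (2 * pi * (int_vec k \<bullet> h)) * Re (c k * character k x)"
      by (simp only: plus_complex.sel(1) [symmetric] Re_of_real_mult)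
    then show ?thesis by simp
  qed
  then have eq: "(\<Sum>k\<in>S. cos (2 * pi * (int_vec k \<bullet> h)) * Re (c k * character k x)) =
     ((\<Sum>k\<in>S. Re (c k * character k (x + h))) + (\<Sum>k\<in>S. Re (c k * character k (x + (- h))))) / 2"
    by (simp only: sum.distrib sum_divide_distrib add_divide_distrib)
  show "0 \<le> (\<Sum>k\<in>S. cos (2 * pi * (int_vec k \<bullet> h)) * Re (c k * character k x))"
    unfolding eq by (intro divide_nonneg_pos add_nonneg_nonneg pos [rule_format]) simp
qed

text \<open>
  Symbols of generators of positivity preserving semigroups (the condition of Schoenberg).
\<close>

definition negative_definite :: "(int ^ 'd \<Rightarrow> real) \<Rightarrow> bool" where
  "negative_definite \<psi> \<longleftrightarrow> (\<forall>t\<ge>0. positivity_preserving (\<lambda>k. exp (- (t * \<psi> k))))"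

lemma negative_definiteD:
  "negative_definite \<psi> \<Longrightarrow> 0 \<le> t \<Longrightarrow> positivity_preserving (\<lambda>k. exp (- (t * \<psi> k)))"
  unfolding negative_definite_def by blast

lemma negative_definite_scale:
  assumes "0 \<le> a" "negative_definite \<psi>"
  shows "negative_definite (\<lambda>k. a * \<psi> k)"
  using assms unfolding negative_definite_def by (simp flip: mult.assoc)

lemma negative_definite_sum:
  assumes "finite I" "\<And>i. i \<in> I \<Longrightarrow> negative_definite (\<psi> i)"
  shows "negative_definite (\<lambda>k. \<Sum>i\<in>I. \<psi> i k)"
  unfolding negative_definite_def
proof (intro allI impI)
  fix t :: real assume "0 \<le> t"
  have "positivity_preserving (\<lambda>k. \<Prod>i\<in>I. exp (- (t * \<psi> i k)))"
    by (rule positivity_preserving_prod [OF assms(1)]) (rule negative_definiteD [OF assms(2) \<open>0 \<le> t\<close>])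
  moreover have "(\<Prod>i\<in>I. exp (- (t * \<psi> i k))) = exp (- (t * (\<Sum>i\<in>I. \<psi> i k)))" for k
    using exp_sum [OF assms(1), of "\<lambda>i. - (t * \<psi> i k)"] by (simp add: sum_negf sum_distrib_left)
  ultimately show "positivity_preserving (\<lambda>k. exp (- (t * (\<Sum>i\<in>I. \<psi> i k))))"
    by simp
qed

lemma negative_definite_limit:
  assumes "\<And>n. negative_definite (\<psi> n)" "\<And>k. (\<lambda>n. \<psi> n k) \<longlonglongrightarrow> \<psi>' k"
  shows "negative_definite \<psi>'"
  unfolding negative_definite_def
proof (intro allI impI)
  fix t :: real assume "0 \<le> t"
  show "positivity_preserving (\<lambda>k. exp (- (t * \<psi>' k)))"
  proof (rule positivity_preserving_limit)
    show "positivity_preserving (\<lambda>k. exp (- (t * \<psi> n k)))" for n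
      by (rule negative_definiteD [OF assms(1) \<open>0 \<le> t\<close>])
    show "(\<lambda>n. exp (- (t * \<psi> n k))) \<longlonglongrightarrow> exp (- (t * \<psi>' k))" for k
      by (intro tendsto_intros assms(2))
  qed
qed

text \<open>
  The semigroup is the limit of the powers \<open>(1 - t (a - \<phi>) / n)\<^sup>n\<close>, and for large \<open>n\<close> the base is a sum of a
  nonnegative constant and a nonnegative multiple of \<open>\<phi>\<close>.
\<close>

lemma negative_definite_const_minus:
  assumes "positivity_preserving \<phi>"
  shows "negative_definite (\<lambda>k. a - \<phi> k)"
  unfolding negative_definite_def
proof (intro allI impI)
  fix t :: real assume t: "0 \<le> t"
  \<comment> \<open>From index \<open>N\<close> on, the base \<open>1 - t a / n + (t / n) \<phi>\<close> has nonnegative coefficients.\<close>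
  obtain N :: nat where N: "real N > t * a" using reals_Archimedean2 by blast
  have pos: "positivity_preserving (\<lambda>k. (1 + (- (t * (a - \<phi> k))) / real (Suc (n + N))) ^ (Suc (n + N)))" for n
  proof (intro positivity_preserving_power)
    define M where "M = real (Suc (n + N))"
    have M: "M > 0" "t * a \<le> M" using N by (auto simp: M_def)
    have "positivity_preserving (\<lambda>k. (1 - t * a / M) + (t / M) * \<phi> k)"
      using M t by (intro positivity_preserving_add positivity_preserving_mult positivity_preserving_const assms)
        (auto simp: field_simps)
    then show "positivity_preserving (\<lambda>k. 1 + (- (t * (a - \<phi> k))) / real (Suc (n + N)))"
      unfolding M_def [symmetric] by (simp add: algebra_simps diff_divide_distrib)
  qed
  have "(\<lambda>n. (1 + (- (t * (a - \<phi> k))) / real (Suc (n + N))) ^ (Suc (n + N))) \<longlonglongrightarrow> exp (- (t * (a - \<phi> k)))" for k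
    using LIMSEQ_ignore_initial_segment [OF tendsto_exp_limit_sequentially [of "- (t * (a - \<phi> k))"], of "Suc N"]
    by simp
  then show "positivity_preserving (\<lambda>k. exp (- (t * (a - \<phi> k))))"
    by (rule positivity_preserving_limit [OF pos])
qed

text \<open>
  The discrete Laplacians \<open>2 n\<^sup>2 (1 - cos (2 \<pi> k\<^sub>i / n))\<close> converge to \<open>(2 \<pi> k\<^sub>i)\<^sup>2\<close>.
\<close>

lemma negative_definite_norm_square:
  "negative_definite (\<lambda>k :: int ^ 'd. (2 * pi * norm (int_vec k))\<^sup>2)"
proof -
  have lim: "(\<lambda>n. 2 * (real n)\<^sup>2 * (1 - cos (z / real n))) \<longlonglongrightarrow> z\<^sup>2" for z
  proof (cases "z = 0")
    case False
    have "(\<lambda>n. z / 2 / real n) \<longlonglongrightarrow> 0" by (rule lim_const_over_n)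
    moreover have "eventually (\<lambda>n. z / 2 / real n \<noteq> 0) sequentially"
      using eventually_gt_at_top [of 0] by eventually_elim (use False in simp)
    ultimately have "filterlim (\<lambda>n. z / 2 / real n) (at 0) sequentially"
      unfolding filterlim_at by simp
    then have "(\<lambda>n. sin (z / 2 / real n) / (z / 2 / real n)) \<longlonglongrightarrow> 1"
      by (rule filterlim_compose [rotated]) (use DERIV_sin [of 0] in \<open>simp add: DERIV_def\<close>)
    then have "(\<lambda>n. z\<^sup>2 * (sin (z / 2 / real n) / (z / 2 / real n))\<^sup>2) \<longlonglongrightarrow> z\<^sup>2 * 1\<^sup>2"
      by (intro tendsto_intros)
    moreover have "z\<^sup>2 * (sin (z / 2 / real n) / (z / 2 / real n))\<^sup>2 = 2 * (real n)\<^sup>2 * (1 - cos (z / real n))" for n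
    proof -
      have "1 - cos (z / real n) = 2 * (sin (z / 2 / real n))\<^sup>2"
        using cos_double_sin [of "z / 2 / real n"] by simp
      then show ?thesis
        using False by (cases "n = 0") (simp_all add: power_divide power_mult_distrib)
    qed
    ultimately show ?thesis by simp
  qed simp
  have comp: "negative_definite (\<lambda>k :: int ^ 'd. (2 * pi * real_of_int (k $ i))\<^sup>2)" for i
  proof (rule negative_definite_limit)
    fix n :: nat
    show "negative_definite (\<lambda>k :: int ^ 'd. 2 * (real n)\<^sup>2 * (1 - cos (2 * pi * (int_vec k \<bullet> (axis i (1 / real n))))))"
      by (intro negative_definite_scale negative_definite_const_minus positivity_preserving_cos) simp
    show "(\<lambda>n. 2 * (real n)\<^sup>2 * (1 - cos (2 * pi * (int_vec k \<bullet> (axis i (1 / real n)))))) \<longlonglongrightarrow>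
       (2 * pi * real_of_int (k $ i))\<^sup>2" for k :: "int ^ 'd"
      using lim [of "2 * pi * real_of_int (k $ i)"] by (simp add: inner_axis int_vec_def)
  qed
  have "(2 * pi * norm (int_vec k))\<^sup>2 = (\<Sum>i\<in>UNIV. (2 * pi * real_of_int (k $ i))\<^sup>2)" for k :: "int ^ 'd"
  proof -
    have "(norm (int_vec k))\<^sup>2 = (\<Sum>i\<in>UNIV. (real_of_int (k $ i))\<^sup>2)"
      unfolding power2_norm_eq_inner inner_vec_def by (simp add: int_vec_def power2_eq_square)
    then show ?thesis by (simp add: power_mult_distrib sum_distrib_left)
  qed
  then show ?thesis
    using negative_definite_sum [OF finite comp] by simp
qed

lemma integrable_powr_tail:
  assumes "0 < \<epsilon>" "e < -1"
  shows "integrable lborel (\<lambda>r::real. indicator {\<epsilon>..} r * r powr e)"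
proof (rule integrableI_nonneg)
  have "(\<integral>\<^sup>+ r. ennreal (indicator {\<epsilon>..} r * r powr e) \<partial>lborel) = ennreal (- (\<epsilon> powr (e + 1)) / (e + 1))"
    by (rule nn_integral_has_integral_lebesgue [OF _ has_integral_powr_to_inf]) (use assms in auto)
  then show "(\<integral>\<^sup>+ r. ennreal (indicator {\<epsilon>..} r * r powr e) \<partial>lborel) < \<infinity>" by simp
qed auto

lemma integrable_powr_origin:
  assumes "-1 < e"
  shows "integrable lborel (\<lambda>r::real. indicator {0..1} r * r powr e)"
proof (rule integrableI_nonneg)
  have "(\<integral>\<^sup>+ r. ennreal (indicator {0..1} r * r powr e) \<partial>lborel) = ennreal (1 powr (e + 1) / (e + 1))"
    by (rule nn_integral_has_integral_lebesgue [OF _ has_integral_powr_from_0]) (use assms in auto)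
  then show "(\<integral>\<^sup>+ r. ennreal (indicator {0..1} r * r powr e) \<partial>lborel) < \<infinity>" by simp
qed auto

text \<open>
  Jump density of the \<open>s\<close>-stable subordinator, up to a constant factor.
\<close>

definition levy_density :: "real \<Rightarrow> real \<Rightarrow> real" where
  "levy_density s r = indicator {0<..} r * r powr (-1 - s)"

lemma levy_density_measurable [measurable]: "levy_density s \<in> borel_measurable borel"
  unfolding levy_density_def by measurable

lemma levy_density_nonneg: "0 \<le> levy_density s r"
  by (simp add: levy_density_def)

lemma integrable_levy:
  assumes s: "0 < s" "s < 1" and y: "0 \<le> y"
  shows "integrable lborel (\<lambda>r. levy_density s r * (1 - exp (- (r * y))))"
proof (rule Bochner_Integration.integrable_bound)
  show "integrable lborel (\<lambda>r. y * (indicator {0..1} r * r powr (- s)) + indicator {1..} r * r powr (-1 - s))"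
    using s by (intro Bochner_Integration.integrable_add integrable_mult_right integrable_powr_origin integrable_powr_tail) auto
  show "AE r in lborel. norm (levy_density s r * (1 - exp (- (r * y))))
      \<le> norm (y * (indicator {0..1} r * r powr (- s)) + indicator {1..} r * r powr (-1 - s))"
  proof (intro AE_I2)
    fix r :: real
    consider "r \<le> 0" | "0 < r" "r \<le> 1" | "1 < r" by linarith
    then show "norm (levy_density s r * (1 - exp (- (r * y))))
      \<le> norm (y * (indicator {0..1} r * r powr (- s)) + indicator {1..} r * r powr (-1 - s))"
    proof cases
      case 2
      have "1 - exp (- (r * y)) \<le> r * y"
        using exp_ge_add_one_self [of "- (r * y)"] by simp
      then have "r powr (-1 - s) * (1 - exp (- (r * y))) \<le> r powr (-1 - s) * (r * y)"
        by (intro mult_left_mono) auto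
      also have "\<dots> = y * r powr (- s)"
        using 2 powr_add [of r "-1 - s" 1] by simp
      also have "\<dots> \<le> y * (indicator {0..1} r * r powr (- s)) + indicator {1..} r * r powr (-1 - s)"
        using 2 by simp
      finally show ?thesis
        using 2 y by (simp add: levy_density_def)
    next
      case 3
      then have "r powr (-1 - s) * (1 - exp (- (r * y))) \<le> r powr (-1 - s) * 1"
        by (intro mult_left_mono) auto
      then show ?thesis using 3 y by (simp add: levy_density_def)
    qed (simp add: levy_density_def)
  qed
qed simp

text \<open>
  Substituting \<open>r / y\<close> for \<open>r\<close> shows that the integral is homogeneous of degree \<open>s\<close> in \<open>y\<close>, so up to a constant
  it is \<open>y\<^sup>s\<close>: this is Bochner's subordination formula.
\<close>

lemma levy_integral_scaling:
  assumes s: "0 < s" "s < 1" and y: "0 \<le> y"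
  shows "(LINT r|lborel. levy_density s r * (1 - exp (- (r * y)))) =
         y powr s * (LINT r|lborel. levy_density s r * (1 - exp (- r)))"
proof (cases "y = 0")
  case False
  with y have y: "y > 0" by simp
  have eq: "levy_density s (r / y) * (1 - exp (- r)) = y powr (1 + s) * (levy_density s r * (1 - exp (- r)))" for r
  proof (cases "r > 0")
    case True
    have "(r / y) powr (-1 - s) = r powr (-1 - s) * y powr (1 + s)"
      using True y powr_minus_divide [of y "1 + s"] by (simp add: powr_divide)
    then show ?thesis using True y by (simp add: levy_density_def)
  next
    case False
    with y have "\<not> 0 < r / y" by (simp add: zero_less_divide_iff)
    with False show ?thesis by (simp add: levy_density_def)
  qed
  have "(LINT r|lborel. levy_density s r * (1 - exp (- (r * y)))) =
        (1 / y) * (LINT r|lborel. levy_density s (r / y) * (1 - exp (- r)))"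
    using lborel_integral_real_affine [of "1 / y" "\<lambda>r. levy_density s r * (1 - exp (- (r * y)))" 0] y by simp
  also have "\<dots> = (1 / y * y powr (1 + s)) * (LINT r|lborel. levy_density s r * (1 - exp (- r)))"
    unfolding eq by simp
  also have "1 / y * y powr (1 + s) = y powr s"
    using y by (simp add: powr_add)
  finally show ?thesis .
qed simp

lemma levy_integral_pos:
  assumes s: "0 < s" "s < 1"
  shows "0 < (LINT r|lborel. levy_density s r * (1 - exp (- r)))"
proof -
  have int: "integrable lborel (\<lambda>r. levy_density s r * (1 - exp (- r)))"
    using integrable_levy [OF s, of 1] by simp
  have nonneg: "0 \<le> levy_density s r * (1 - exp (- r))" for r
    by (auto simp: levy_density_def indicator_def)
  have "(LINT r|lborel. levy_density s r * (1 - exp (- r))) \<noteq> 0"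
  proof
    assume "(LINT r|lborel. levy_density s r * (1 - exp (- r))) = 0"
    then have "AE r in lborel. levy_density s r * (1 - exp (- r)) = 0"
      using integral_nonneg_eq_0_iff_AE [OF int] nonneg by simp
    then have "AE r in lborel. (r::real) \<notin> {0<..<1}"
      by eventually_elim (auto simp: levy_density_def)
    then have "emeasure lborel {0<..<1::real} = 0"
      by (subst (asm) AE_iff_measurable [of "{0<..<1::real}"]) auto
    then show False by simp
  qed
  moreover have "0 \<le> (LINT r|lborel. levy_density s r * (1 - exp (- r)))"
    using nonneg by (intro integral_nonneg_AE) auto
  ultimately show ?thesis by linarith
qed

definition frac_symbol :: "real \<Rightarrow> int ^ 'd \<Rightarrow> real" where
  "frac_symbol s k = (2 * pi) powr (2 * s) * norm (int_vec k) powr (2 * s)"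

text \<open>
  With \<open>y = |2 \<pi> k|\<^sup>2\<close>, the power \<open>y\<^sup>s\<close> is an integral of the functions \<open>1 - exp (- r y)\<close> against the jump
  density.  Jumps shorter than \<open>1 / n\<close> are discarded first: the density then has finite mass, and the truncated symbol is a
  constant minus a mixture of Gaussians.
\<close>

lemma negative_definite_frac_symbol:
  assumes s: "0 < s" "s < 1"
  shows "negative_definite (frac_symbol s :: int ^ 'd \<Rightarrow> real)"
proof -
  define y where "y k = (2 * pi * norm (int_vec k))\<^sup>2" for k :: "int ^ 'd"
  have y: "0 \<le> y k" for k by (simp add: y_def)
  define c where "c = (LINT r|lborel. levy_density s r * (1 - exp (- r)))"
  define \<psi> where "\<psi> n k = (LINT r|lborel. indicator {1 / real (Suc n)..} r * levy_density s r * (1 - exp (- (r * y k))))" for n k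
  have int: "integrable lborel (\<lambda>r. indicator {1 / real (Suc n)..} r * levy_density s r)" for n
  proof -
    have "(\<lambda>r. indicator {1 / real (Suc n)..} r * levy_density s r) = (\<lambda>r. indicator {1 / real (Suc n)..} r * r powr (-1 - s))"
      by (auto simp: levy_density_def indicator_def fun_eq_iff) (smt (verit) divide_pos_pos of_nat_Suc of_nat_0_le_iff)
    then show ?thesis using s integrable_powr_tail [of "1 / real (Suc n)" "-1 - s"] by simp
  qed
  have int': "integrable lborel (\<lambda>r. indicator {1 / real (Suc n)..} r * levy_density s r * exp (- (r * y k)))" for n k
    by (rule Bochner_Integration.integrable_bound [OF int [of n]])
       (use y in \<open>auto simp: levy_density_def indicator_def intro!: mult_left_le\<close>)
  have gauss: "positivity_preserving (\<lambda>k. exp (- (r * y k)))" if "0 \<le> r" for r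
    unfolding y_def by (rule negative_definiteD [OF negative_definite_norm_square that])
  have pos: "positivity_preserving (\<lambda>k. LINT r|lborel. indicator {1 / real (Suc n)..} r * levy_density s r * exp (- (r * y k)))" for n
  proof -
    \<comment> \<open>For negative \<open>r\<close> the exponential is not a positive multiplier; the density vanishes there.\<close>
    have "positivity_preserving (\<lambda>k. LINT r|lborel. indicator {1 / real (Suc n)..} r * levy_density s r * exp (- (max 0 r * y k)))"
    proof (intro positivity_preserving_integral gauss)
      show "integrable lborel (\<lambda>r. indicator {1 / real (Suc n)..} r * levy_density s r * exp (- (max 0 r * y k)))" for k
        by (rule Bochner_Integration.integrable_bound [OF int [of n]])
           (use y in \<open>auto simp: levy_density_def indicator_def intro!: mult_left_le\<close>)
    qed (auto simp: levy_density_nonneg)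
    moreover have "levy_density s r * exp (- (max 0 r * y k)) = levy_density s r * exp (- (r * y k))" for r k
      by (simp add: levy_density_def max_def indicator_def)
    ultimately show ?thesis by (simp add: mult.assoc)
  qed
  have "negative_definite (\<psi> n)" for n
  proof -
    have "\<psi> n k = (LINT r|lborel. indicator {1 / real (Suc n)..} r * levy_density s r) -
       (LINT r|lborel. indicator {1 / real (Suc n)..} r * levy_density s r * exp (- (r * y k)))" for k
      unfolding \<psi>_def right_diff_distrib mult_1_right by (rule Bochner_Integration.integral_diff [OF int int'])
    then show ?thesis
      using negative_definite_const_minus [OF pos] by presburger
  qed
  moreover have "(\<lambda>n. \<psi> n k) \<longlonglongrightarrow> (LINT r|lborel. levy_density s r * (1 - exp (- (r * y k))))" for k
    unfolding \<psi>_def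
  proof (rule integral_dominated_convergence [OF _ _ integrable_norm [OF integrable_levy [OF s y]]])
    show "AE r in lborel. (\<lambda>n. indicator {1 / real (Suc n)..} r * levy_density s r * (1 - exp (- (r * y k))))
       \<longlonglongrightarrow> levy_density s r * (1 - exp (- (r * y k)))"
    proof (intro AE_I2)
      fix r :: real
      show "(\<lambda>n. indicator {1 / real (Suc n)..} r * levy_density s r * (1 - exp (- (r * y k))))
         \<longlonglongrightarrow> levy_density s r * (1 - exp (- (r * y k)))"
      proof (cases "r > 0")
        case True
        have "(\<lambda>n. 1 / real (Suc n)) \<longlonglongrightarrow> 0" by (rule LIMSEQ_Suc [OF lim_const_over_n])
        then have "eventually (\<lambda>n. 1 / real (Suc n) < r) sequentially"
          using True by (rule order_tendstoD)
        then have "eventually (\<lambda>n. indicator {1 / real (Suc n)..} r * levy_density s r * (1 - exp (- (r * y k)))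
            = levy_density s r * (1 - exp (- (r * y k)))) sequentially"
          by eventually_elim simp
        then show ?thesis by (rule tendsto_eventually)
      qed (simp add: levy_density_def)
    qed
    show "AE r in lborel. norm (indicator {1 / real (Suc n)..} r * levy_density s r * (1 - exp (- (r * y k))))
       \<le> norm (levy_density s r * (1 - exp (- (r * y k))))" for n
      by (auto simp: indicator_def)
  qed simp_all
  ultimately have "negative_definite (\<lambda>k. LINT r|lborel. levy_density s r * (1 - exp (- (r * y k))))"
    by (rule negative_definite_limit)
  then have "negative_definite (\<lambda>k. (1 / c) * (y k powr s * c))"
    unfolding levy_integral_scaling [OF s y] c_def [symmetric]
    using levy_integral_pos [OF s] by (intro negative_definite_scale) (simp add: c_def)
  moreover have "(1 / c) * (y k powr s * c) = frac_symbol s k" for k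
  proof -
    have "y k powr s = (2 * pi * norm (int_vec k)) powr (2 * s)"
      unfolding y_def by (simp add: powr_powr [symmetric] powr_numeral flip: powr_numeral)
    then show ?thesis
      using levy_integral_pos [OF s] by (simp add: c_def [symmetric] frac_symbol_def powr_mult)
  qed
  ultimately show ?thesis by simp
qed

section \<open>Fejer means\<close>

definition freq_box :: "nat \<Rightarrow> (int ^ 'd) set" where
  "freq_box N = {k. \<forall>i. 0 \<le> k $ i \<and> k $ i < int N}"

lemma card_vec_PiE:
  fixes A :: "'d::finite \<Rightarrow> int set"
  shows "card {k :: int ^ 'd. \<forall>i. k $ i \<in> A i} = (\<Prod>i\<in>UNIV. card (A i))"
proof -
  have "bij_betw vec_nth {k :: int ^ 'd. \<forall>i. k $ i \<in> A i} (PiE UNIV A)"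
    by (rule bij_betwI [where g = vec_lambda]) (auto simp: PiE_def)
  then show ?thesis by (simp add: bij_betw_same_card card_PiE)
qed

lemma freq_box_PiE: "freq_box N = {k :: int ^ 'd. \<forall>i. k $ i \<in> {0..<int N}}"
  by (auto simp: freq_box_def)

lemma card_freq_box: "card (freq_box N :: (int ^ 'd) set) = N ^ CARD('d)"
  unfolding freq_box_PiE card_vec_PiE by simp

lemma finite_freq_box [simp]: "finite (freq_box N :: (int ^ 'd) set)"
proof (cases "N = 0")
  case True
  then have "freq_box N = ({} :: (int ^ 'd) set)" by (auto simp: freq_box_def)
  then show ?thesis by simp
next
  case False
  then show ?thesis using card_freq_box [where 'd = 'd, of N] by (intro card_ge_0_finite) simp
qed

definition fejer_support :: "nat \<Rightarrow> (int ^ 'd) set" where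
  "fejer_support N = (\<lambda>(k, l). k - l) ` (freq_box N \<times> freq_box N)"

text \<open>
  The frequency \<open>p\<close> occurs in \<open>|\<Sum>\<^sub>k e\<^sub>k|\<^sup>2\<close>, with \<open>k\<close> running over the box, once for every pair with difference \<open>p\<close>.
\<close>

definition fejer_coeff :: "nat \<Rightarrow> int ^ 'd \<Rightarrow> real" where
  "fejer_coeff N p = real (card {z \<in> freq_box N \<times> freq_box N. fst z - snd z = p}) / real N ^ CARD('d)"

definition fejer_kernel :: "nat \<Rightarrow> real ^ 'd \<Rightarrow> real" where
  "fejer_kernel N x = (cmod (\<Sum>k\<in>freq_box N. character k x))\<^sup>2 / real N ^ CARD('d)"

lemma finite_fejer_support [simp]: "finite (fejer_support N)"
  by (simp add: fejer_support_def)

lemma fejer_kernel_nonneg: "0 \<le> fejer_kernel N x"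
  by (simp add: fejer_kernel_def)

lemma fejer_coeff_eq_0: "p \<notin> fejer_support N \<Longrightarrow> fejer_coeff N p = 0"
  by (force simp: fejer_coeff_def fejer_support_def card_eq_0_iff)

lemma fejer_kernel_eq:
  "of_real (fejer_kernel N x) = (\<Sum>p\<in>fejer_support N. of_real (fejer_coeff N p) * character p x)"
proof -
  let ?B = "freq_box N"
  let ?f = "\<lambda>z :: (int ^ 'a) \<times> (int ^ 'a). fst z - snd z"
  have supp: "fejer_support N = ?f ` (?B \<times> ?B)"
    by (simp add: fejer_support_def case_prod_unfold)
  have "of_real ((cmod (\<Sum>k\<in>?B. character k x))\<^sup>2) =
        (\<Sum>k\<in>?B. character k x) * cnj (\<Sum>l\<in>?B. character l x)"
    by (rule complex_norm_square)
  also have "\<dots> = (\<Sum>k\<in>?B. \<Sum>l\<in>?B. character (k - l) x)"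
    by (simp only: cnj_sum sum_product character_diff)
  also have "\<dots> = (\<Sum>z\<in>?B \<times> ?B. character (?f z) x)"
    by (simp add: sum.cartesian_product case_prod_unfold)
  also have "\<dots> = (\<Sum>p\<in>?f ` (?B \<times> ?B). \<Sum>z | z \<in> ?B \<times> ?B \<and> ?f z = p. character (?f z) x)"
    by (rule sum.image_gen) simp
  also have "\<dots> = (\<Sum>p\<in>fejer_support N. of_nat (card {z \<in> ?B \<times> ?B. ?f z = p}) * character p x)"
    unfolding supp by (intro sum.cong) auto
  finally show ?thesis
    by (simp add: fejer_kernel_def fejer_coeff_def sum_divide_distrib)
qed

lemma fejer_coeff_0:
  assumes "0 < N" shows "fejer_coeff N (0 :: int ^ 'd) = 1"
proof -
  have "{z \<in> freq_box N \<times> freq_box N. fst z - snd z = (0 :: int ^ 'd)} = (\<lambda>k. (k, k)) ` freq_box N"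
    by auto
  then have "card {z \<in> freq_box N \<times> freq_box N. fst z - snd z = (0 :: int ^ 'd)} = N ^ CARD('d)"
    by (simp add: card_image inj_on_def card_freq_box)
  then show ?thesis using assms by (simp add: fejer_coeff_def)
qed

text \<open>
  Shifting the box by one in a coordinate direction loses one face, a fraction \<open>1 / N\<close> of the box.  This single
  coefficient measures how far the kernel spreads.
\<close>

lemma fejer_coeff_axis:
  assumes "0 < N" shows "fejer_coeff N (- axis i 1 :: int ^ 'd) = 1 - 1 / real N"
proof -
  define A where "A = {k \<in> freq_box N. (k :: int ^ 'd) $ i \<noteq> int N - 1}"
  define F where "F = {k \<in> freq_box N. (k :: int ^ 'd) $ i = int N - 1}"
  have axis: "axis i 1 $ j = (if j = i then 1 else 0 :: int)" for j
    by (simp add: axis_def)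
  have eq: "{z \<in> freq_box N \<times> freq_box N. fst z - snd z = - axis i (1 :: int)} = (\<lambda>k. (k, k + axis i 1)) ` A"
  proof (intro set_eqI iffI)
    fix z :: "(int ^ 'd) \<times> (int ^ 'd)"
    assume "z \<in> {z \<in> freq_box N \<times> freq_box N. fst z - snd z = - axis i (1 :: int)}"
    moreover obtain k l where z: "z = (k, l)" by (cases z)
    ultimately have kl: "k \<in> freq_box N" "l \<in> freq_box N" and "k - l = - axis i 1" by auto
    then have l: "l = k + axis i 1" by (simp add: algebra_simps)
    have "l $ i < int N" using kl(2) by (simp add: freq_box_def)
    then have "k \<in> A" using kl(1) by (simp add: A_def l axis)
    then show "z \<in> (\<lambda>k. (k, k + axis i 1)) ` A" by (simp add: z l)
  next
    fix z :: "(int ^ 'd) \<times> (int ^ 'd)"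
    assume "z \<in> (\<lambda>k. (k, k + axis i 1)) ` A"
    then obtain k where k: "k \<in> A" and z: "z = (k, k + axis i 1)" by auto
    have "k + axis i 1 \<in> freq_box N"
      unfolding freq_box_def
    proof (intro CollectI allI)
      fix j
      have "0 \<le> k $ j \<and> k $ j < int N" "j = i \<longrightarrow> k $ j \<noteq> int N - 1"
        using k by (auto simp: A_def freq_box_def)
      then show "0 \<le> (k + axis i 1) $ j \<and> (k + axis i 1) $ j < int N"
        by (auto simp: axis)
    qed
    then show "z \<in> {z \<in> freq_box N \<times> freq_box N. fst z - snd z = - axis i (1 :: int)}"
      using k by (simp add: z A_def)
  qed
  have cardF: "real (card F) * real N = real N ^ CARD('d)"
  proof -
    have "F = {k :: int ^ 'd. \<forall>j. k $ j \<in> (if j = i then {int N - 1} else {0..<int N})}"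
    proof (intro set_eqI iffI)
      fix k :: "int ^ 'd" assume "k \<in> F"
      then show "k \<in> {k. \<forall>j. k $ j \<in> (if j = i then {int N - 1} else {0..<int N})}"
        by (simp add: F_def freq_box_def)
    next
      fix k :: "int ^ 'd" assume "k \<in> {k. \<forall>j. k $ j \<in> (if j = i then {int N - 1} else {0..<int N})}"
      then have *: "k $ j \<in> (if j = i then {int N - 1} else {0..<int N})" for j by blast
      have "0 \<le> k $ j \<and> k $ j < int N" for j
        using * [of j] assms by (cases "j = i") simp_all
      then show "k \<in> F" using * [of i] by (simp add: F_def freq_box_def)
    qed
    then have "card F = (\<Prod>j\<in>UNIV. card (if j = i then {int N - 1} else {0..<int N}))"
      by (simp only: card_vec_PiE)
    also have "\<dots> = (\<Prod>j\<in>UNIV - {i}. card (if j = i then {int N - 1} else {0..<int N}))"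
      by (subst prod.remove [of _ i]) auto
    also have "\<dots> = (\<Prod>j\<in>UNIV - {i}. N)"
      by (intro prod.cong) auto
    finally have "card F = N ^ (CARD('d) - 1)" by simp
    moreover have "CARD('d) = Suc (CARD('d) - 1)" by (simp add: Suc_diff_1)
    ultimately have "card F * N = N ^ CARD('d)" by (metis power_Suc2)
    then show ?thesis by (metis of_nat_mult of_nat_power)
  qed
  have "freq_box N = A \<union> F" "A \<inter> F = {}"
    by (auto simp: A_def F_def)
  moreover have "finite A" "finite F" by (simp_all add: A_def F_def)
  ultimately have "card (freq_box N :: (int ^ 'd) set) = card A + card F"
    by (simp add: card_Un_disjoint)
  then have "real N ^ CARD('d) = real (card A) + real (card F)"
    unfolding card_freq_box by (metis of_nat_add of_nat_power)
  moreover have "card ((\<lambda>k. (k, k + axis i 1)) ` A) = card A"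
    by (intro card_image) (auto simp: inj_on_def)
  ultimately have "fejer_coeff N (- axis i 1 :: int ^ 'd) = (real N ^ CARD('d) - real (card F)) / real N ^ CARD('d)"
    unfolding fejer_coeff_def eq by simp
  moreover have "real (card F) / real N ^ CARD('d) = 1 / real N"
    using assms by (subst frac_eq_eq) (simp_all only: cardF, simp_all)
  then have "(real N ^ CARD('d) - real (card F)) / real N ^ CARD('d) = 1 - 1 / real N"
    using assms by (simp only: diff_divide_distrib) simp
  ultimately show ?thesis by (simp only:)
qed

lemma continuous_on_fejer_kernel [continuous_intros]:
  "continuous_on S f \<Longrightarrow> continuous_on S (\<lambda>x. fejer_kernel N (f x))"
  unfolding fejer_kernel_def divide_inverse by (intro continuous_intros)

text \<open>
  The coefficient \<open>fourier_coeff\<close> of a real continuous function, written with \<open>haar\<close>.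
\<close>

definition fcoef :: "(real ^ 'd \<Rightarrow> real) \<Rightarrow> int ^ 'd \<Rightarrow> complex" where
  "fcoef f p = (LINT x|haar. of_real (f x) * cnj (character p x))"

definition fejer_mean :: "nat \<Rightarrow> (real ^ 'd \<Rightarrow> real) \<Rightarrow> real ^ 'd \<Rightarrow> real" where
  "fejer_mean N f x = (LINT y|haar. fejer_kernel N (x - y) * f y)"

lemma integrable_haar_continuous:
  "continuous_on UNIV f \<Longrightarrow> integrable haar f"
  for f :: "real ^ 'd \<Rightarrow> 'b::{banach, second_countable_topology}"
  by (rule integrable_continuous_torus [OF haar_in_prob_torus])

lemma character_diff_arg: "character p (x - y) = character p x * cnj (character p y)"
  using character_shift [of p x "- y"] by (simp add: character_minus_arg)

lemma integral_fejer_kernel: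
  fixes g :: "real ^ 'd \<Rightarrow> complex"
  assumes "continuous_on UNIV g"
  shows "(LINT y|haar. of_real (fejer_kernel N (x - y)) * g y) =
         (\<Sum>p\<in>fejer_support N. of_real (fejer_coeff N p) * character p x * (LINT y|haar. g y * cnj (character p y)))"
proof -
  have "(LINT y|haar. of_real (fejer_kernel N (x - y)) * g y) =
        (LINT y|haar. (\<Sum>p\<in>fejer_support N. of_real (fejer_coeff N p) * character p x * (g y * cnj (character p y))))"
    by (simp only: fejer_kernel_eq character_diff_arg sum_distrib_left sum_distrib_right mult_ac)
  also have "\<dots> = (\<Sum>p\<in>fejer_support N. LINT y|haar. of_real (fejer_coeff N p) * character p x * (g y * cnj (character p y)))"
    by (intro Bochner_Integration.integral_sum integrable_haar_continuous continuous_intros assms)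
  finally show ?thesis by simp
qed

lemma fejer_mean_eq:
  assumes "continuous_on UNIV f"
  shows "of_real (fejer_mean N f x) = (\<Sum>p\<in>fejer_support N. of_real (fejer_coeff N p) * fcoef f p * character p x)"
proof -
  have "of_real (fejer_mean N f x) = (LINT y|haar. of_real (fejer_kernel N (x - y)) * (of_real (f y) :: complex))"
    by (simp add: fejer_mean_def flip: integral_complex_of_real)
  also have "\<dots> = (\<Sum>p\<in>fejer_support N. of_real (fejer_coeff N p) * character p x * (LINT y|haar. of_real (f y) * cnj (character p y)))"
    by (intro integral_fejer_kernel continuous_intros assms)
  finally show ?thesis by (simp add: fcoef_def mult_ac)
qed

lemma continuous_on_fejer_mean:
  assumes "continuous_on UNIV f" shows "continuous_on UNIV (fejer_mean N f)"
proof -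
  have "fejer_mean N f = (\<lambda>x. Re (\<Sum>p\<in>fejer_support N. of_real (fejer_coeff N p) * fcoef f p * character p x))"
    by (rule ext) (simp only: fejer_mean_eq [OF assms, symmetric] Re_complex_of_real)
  then show ?thesis
    by (simp only:) (intro continuous_intros)
qed

lemma fejer_kernel_mass:
  fixes x :: "real ^ 'd"
  assumes "0 < N" shows "(LINT y|haar. fejer_kernel N (x - y)) = 1"
proof -
  have int: "(LINT y|haar. 1 * cnj (character p y)) = (if p = 0 then 1 else 0)" for p :: "int ^ 'd"
    using integral_haar_character [of "- p"] by simp
  have "of_real (LINT y|haar. fejer_kernel N (x - y)) = (LINT y|haar. of_real (fejer_kernel N (x - y)) * (1 :: complex))"
    by simp
  also have "\<dots> = (\<Sum>p\<in>fejer_support N. of_real (fejer_coeff N p) * character p x * (if p = 0 then 1 else 0))"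
    by (subst integral_fejer_kernel) (simp_all only: int continuous_on_const)
  also have "\<dots> = of_real (fejer_coeff N (0 :: int ^ 'd)) * character (0 :: int ^ 'd) x * (if 0 \<in> (fejer_support N :: (int ^ 'd) set) then 1 else 0)"
    by (simp add: if_distrib cong: if_cong)
  finally have "complex_of_real (LINT y|haar. fejer_kernel N (x - y)) = of_real (fejer_coeff N (0 :: int ^ 'd))"
    using fejer_coeff_eq_0 [of "0 :: int ^ 'd" N]
    by (cases "0 \<in> (fejer_support N :: (int ^ 'd) set)") simp_all
  then show ?thesis
    using fejer_coeff_0 [OF assms, where 'd = 'd] by (simp only: of_real_eq_iff)
qed

text \<open>
  A second moment of the kernel: \<open>1 - cos (2 \<pi> z\<^sub>i)\<close> is comparable to the square of the distance of \<open>z\<^sub>i\<close> to the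
  integers.
\<close>

lemma fejer_kernel_spread:
  fixes x :: "real ^ 'd"
  assumes "0 < N" shows "(LINT y|haar. fejer_kernel N (x - y) * (1 - cos (2 * pi * (x $ i - y $ i)))) = 1 / real N"
proof -
  define a where "a = (axis i 1 :: int ^ 'd)"
  have "int_vec a = axis i 1" by (simp add: a_def)
  then have cos: "cos (2 * pi * (x $ i - y $ i)) = Re (character a (x - y))" for y
    by (simp add: character_def inner_axis')
  have int: "(LINT y|haar. cnj (character a y) * cnj (character p y)) = (if p = - a then 1 else 0)" for p
  proof -
    have "cnj (character a y) * cnj (character p y) = character (- a - p) y" for y
      by (simp add: character_diff)
    then show ?thesis using integral_haar_character [of "- a - p"] by (auto simp: algebra_simps)
  qed
  have "(LINT y|haar. of_real (fejer_kernel N (x - y)) * cnj (character a y)) =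
     (\<Sum>p\<in>fejer_support N. of_real (fejer_coeff N p) * character p x * (if p = - a then 1 else 0))"
    by (subst integral_fejer_kernel) (simp_all only: int, intro continuous_intros)
  also have "\<dots> = (if - a \<in> fejer_support N then of_real (fejer_coeff N (- a)) * character (- a) x else 0)"
    by (simp add: if_distrib cong: if_cong)
  also have "\<dots> = of_real (fejer_coeff N (- a)) * character (- a) x"
    using fejer_coeff_eq_0 [of "- a" N] by auto
  finally have *: "(LINT y|haar. of_real (fejer_kernel N (x - y)) * cnj (character a y)) = of_real (fejer_coeff N (- a)) * character (- a) x" .
  have "(LINT y|haar. of_real (fejer_kernel N (x - y)) * character a (x - y)) =
        character a x * (LINT y|haar. of_real (fejer_kernel N (x - y)) * cnj (character a y))"
    unfolding character_diff_arg by (subst integral_mult_right_zero [symmetric]) (simp only: mult_ac)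
  also have "\<dots> = of_real (fejer_coeff N (- a)) * (character a x * character (- a) x)"
    unfolding * by (simp only: mult_ac)
  also have "character a x * character (- a) x = 1"
    using character_add [of a "- a" x] by simp
  finally have "(LINT y|haar. of_real (fejer_kernel N (x - y)) * character a (x - y)) = of_real (fejer_coeff N (- a))"
    by simp
  then have "fejer_coeff N (- a) = Re (LINT y|haar. of_real (fejer_kernel N (x - y)) * character a (x - y))"
    by simp
  also have "\<dots> = (LINT y|haar. Re (of_real (fejer_kernel N (x - y)) * character a (x - y)))"
    by (intro integral_Re [symmetric] integrable_haar_continuous continuous_intros)
  finally have "(LINT y|haar. fejer_kernel N (x - y) * cos (2 * pi * (x $ i - y $ i))) = fejer_coeff N (- a)"
    by (simp only: cos Re_of_real_mult)
  moreover have "(LINT y|haar. fejer_kernel N (x - y) * (1 - cos (2 * pi * (x $ i - y $ i)))) =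
     (LINT y|haar. fejer_kernel N (x - y)) - (LINT y|haar. fejer_kernel N (x - y) * cos (2 * pi * (x $ i - y $ i)))"
    unfolding right_diff_distrib mult_1_right
    by (intro Bochner_Integration.integral_diff integrable_haar_continuous continuous_intros)
  ultimately show ?thesis
    using fejer_coeff_axis [OF assms, of i] fejer_kernel_mass [OF assms, of x] by (simp add: a_def)
qed

text \<open>
  The hypothesis bounds the modulus of continuity of \<open>f\<close> by \<open>\<epsilon>\<close> plus a multiple of exactly those functions whose
  integrals against the kernel are known.
\<close>

lemma fejer_mean_error:
  fixes f :: "real ^ 'd \<Rightarrow> real"
  assumes "0 < N" and f: "continuous_on UNIV f"
    and mod: "\<And>y. \<bar>f y - f x\<bar> \<le> \<epsilon> + C * (\<Sum>i\<in>UNIV. 1 - cos (2 * pi * (x $ i - y $ i)))"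
  shows "\<bar>fejer_mean N f x - f x\<bar> \<le> \<epsilon> + C * CARD('d) / real N"
proof -
  have "fejer_mean N f x - f x = (LINT y|haar. fejer_kernel N (x - y) * f y) - (LINT y|haar. fejer_kernel N (x - y) * f x)"
    using fejer_kernel_mass [OF assms(1), of x] by (simp add: fejer_mean_def)
  also have "\<dots> = (LINT y|haar. fejer_kernel N (x - y) * (f y - f x))"
    unfolding right_diff_distrib
    by (intro Bochner_Integration.integral_diff [symmetric] integrable_haar_continuous continuous_intros f)
  finally have "\<bar>fejer_mean N f x - f x\<bar> \<le> (LINT y|haar. \<bar>fejer_kernel N (x - y) * (f y - f x)\<bar>)"
    by (simp only: integral_abs_bound)
  also have "\<dots> \<le> (LINT y|haar. \<epsilon> * fejer_kernel N (x - y) + C * (\<Sum>i\<in>UNIV. fejer_kernel N (x - y) * (1 - cos (2 * pi * (x $ i - y $ i)))))"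
  proof (rule integral_mono)
    fix y
    have "\<bar>fejer_kernel N (x - y) * (f y - f x)\<bar> \<le> fejer_kernel N (x - y) * (\<epsilon> + C * (\<Sum>i\<in>UNIV. 1 - cos (2 * pi * (x $ i - y $ i))))"
      unfolding abs_mult using fejer_kernel_nonneg [of N "x - y"] mod [of y] by (simp add: mult_left_mono)
    then show "\<bar>fejer_kernel N (x - y) * (f y - f x)\<bar> \<le> \<epsilon> * fejer_kernel N (x - y) + C * (\<Sum>i\<in>UNIV. fejer_kernel N (x - y) * (1 - cos (2 * pi * (x $ i - y $ i))))"
      by (simp only: distrib_left sum_distrib_left mult_ac)
  qed (intro integrable_haar_continuous continuous_intros f)+
  also have "\<dots> = \<epsilon> + C * CARD('d) / real N"
  proof -
    have "integrable haar (\<lambda>y. fejer_kernel N (x - y))"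
      "\<And>i. integrable haar (\<lambda>y. fejer_kernel N (x - y) * (1 - cos (2 * pi * (x $ i - y $ i))))"
      by (intro integrable_haar_continuous continuous_intros)+
    then show ?thesis
      using assms(1) by (simp add: fejer_kernel_mass fejer_kernel_spread)
  qed
  finally show ?thesis .
qed

lemma fejer_mean_bound:
  fixes f :: "real ^ 'd \<Rightarrow> real"
  assumes "0 < N" "continuous_on UNIV f" "\<And>x. \<bar>f x\<bar> \<le> B"
  shows "\<bar>fejer_mean N f x\<bar> \<le> B"
proof -
  have "\<bar>fejer_mean N f x\<bar> \<le> (LINT y|haar. \<bar>fejer_kernel N (x - y) * f y\<bar>)"
    unfolding fejer_mean_def by (rule integral_abs_bound)
  also have "\<dots> \<le> (LINT y|haar. fejer_kernel N (x - y) * B)"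
    by (intro integral_mono integrable_haar_continuous continuous_intros assms)
       (simp add: abs_mult fejer_kernel_nonneg mult_left_mono assms(3))
  finally show ?thesis using assms(1) by (simp add: fejer_kernel_mass)
qed

lemma continuous_on_slice:
  assumes "continuous_on (UNIV \<times> K) (\<lambda>(x, t). F x t)" "t \<in> K"
  shows "continuous_on UNIV (\<lambda>x. F x t)"
proof -
  have "continuous_on UNIV ((\<lambda>(x, t). F x t) \<circ> (\<lambda>x. (x, t)))"
    using assms(2) by (intro continuous_on_compose continuous_intros continuous_on_subset [OF assms(1)]) auto
  then show ?thesis by (simp add: o_def)
qed

text \<open>
  Nearby points are handled by uniform continuity.  For points that are not close modulo the lattice, one of the
  terms \<open>1 - cos\<close> is bounded below, and \<open>C\<close> is chosen so large that the bound is trivial there.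
\<close>

lemma torus_modulus_of_continuity:
  fixes F :: "real ^ 'd \<Rightarrow> 'k::metric_space \<Rightarrow> real"
  assumes K: "compact K" and cont: "continuous_on (UNIV \<times> K) (\<lambda>(x, t). F x t)"
    and per: "\<And>t. t \<in> K \<Longrightarrow> periodic (\<lambda>x. F x t)" and "0 < \<epsilon>"
  obtains C where "0 \<le> C" "\<And>t x y. t \<in> K \<Longrightarrow> \<bar>F y t - F x t\<bar> \<le> \<epsilon> + C * (\<Sum>i\<in>UNIV. 1 - cos (2 * pi * (x $ i - y $ i)))"
proof -
  define Q where "Q = cbox (vec (-1)) (vec 2 :: real ^ 'd)"
  have comp: "compact (Q \<times> K)" unfolding Q_def by (intro compact_Times compact_cbox K)
  have cont': "continuous_on (Q \<times> K) (\<lambda>(x, t). F x t)"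
    by (rule continuous_on_subset [OF cont]) auto
  have "uniformly_continuous_on (Q \<times> K) (\<lambda>(x, t). F x t)"
    by (rule compact_uniformly_continuous [OF cont' comp])
  then obtain \<delta> where \<delta>: "\<delta> > 0" "\<And>z z'. z \<in> Q \<times> K \<Longrightarrow> z' \<in> Q \<times> K \<Longrightarrow> dist z' z < \<delta> \<Longrightarrow>
      dist ((\<lambda>(x, t). F x t) z') ((\<lambda>(x, t). F x t) z) < \<epsilon>"
    unfolding uniformly_continuous_on_def using \<open>0 < \<epsilon>\<close> by metis
  have "bounded ((\<lambda>(x, t). F x t) ` (Q \<times> K))"
    by (intro compact_imp_bounded compact_continuous_image cont' comp)
  then obtain M where M: "\<And>x t. x \<in> Q \<Longrightarrow> t \<in> K \<Longrightarrow> \<bar>F x t\<bar> \<le> M"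
    unfolding bounded_iff by auto
  \<comment> \<open>Points whose coordinates differ by at most \<open>\<eta>\<close> are at distance less than \<open>\<delta>\<close>; up to \<open>1 / 2\<close>, \<open>cos (2 \<pi> z)\<close> decreases in \<open>z\<close>.\<close>
  define \<eta> where "\<eta> = min (\<delta> / (2 * CARD('d))) (1 / 2)"
  have \<eta>: "0 < \<eta>" "\<eta> \<le> 1 / 2" "\<eta> * CARD('d) < \<delta>"
  proof -
    have "\<eta> * CARD('d) \<le> \<delta> / (2 * CARD('d)) * CARD('d)"
      unfolding \<eta>_def by (intro mult_right_mono) auto
    also have "\<dots> < \<delta>" using \<delta>(1) by simp
    finally show "\<eta> * CARD('d) < \<delta>" .
  qed (use \<delta>(1) in \<open>auto simp: \<eta>_def\<close>)
  define \<kappa> where "\<kappa> = 1 - cos (2 * pi * \<eta>)"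
  have \<kappa>: "0 < \<kappa>"
  proof -
    have "cos (2 * pi * \<eta>) < cos 0"
      using \<eta> by (intro cos_monotone_0_pi) auto
    then show ?thesis by (simp add: \<kappa>_def)
  qed
  define C where "C = 2 * \<bar>M\<bar> / \<kappa>"
  have C: "0 \<le> C" using \<kappa> by (simp add: C_def)
  have main: "\<bar>F y t - F x t\<bar> \<le> \<epsilon> + C * (\<Sum>i\<in>UNIV. 1 - cos (2 * pi * (x $ i - y $ i)))" if t: "t \<in> K" for t x y
  proof -
    \<comment> \<open>Move \<open>x\<close> into the cell and \<open>y\<close> to its representative nearest to \<open>x\<close>.\<close>
    obtain k where k: "x + int_vec k \<in> cell" using exists_cell_representative by blast
    define x' where "x' = x + int_vec k"
    define l where "l = (\<chi> i. - round (y $ i - x' $ i))"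
    define y' where "y' = y + int_vec l"
    have near: "\<bar>y' $ i - x' $ i\<bar> \<le> 1 / 2" for i
      using of_int_round_abs_le [of "y $ i - x' $ i"] by (simp add: y'_def l_def int_vec_def abs_minus_commute algebra_simps)
    have x'_mem: "0 \<le> x' $ i \<and> x' $ i < 1" for i
      using k by (simp add: x'_def cell_def)
    have Q: "x' \<in> Q" "y' \<in> Q"
      using x'_mem near unfolding Q_def mem_box_cart
    proof (safe)
      fix i
      have "- 1 \<le> x' $ i" "x' $ i \<le> 2" "- 1 \<le> y' $ i" "y' $ i \<le> 2"
        using x'_mem [of i] near [of i] by linarith+
      then show "vec (- 1) $ i \<le> x' $ i" "x' $ i \<le> vec 2 $ i"
        "vec (- 1) $ i \<le> y' $ i" "y' $ i \<le> vec 2 $ i" by simp_all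
    qed
    have F: "F x' t = F x t" "F y' t = F y t"
      using periodic_int_vec [OF per [OF t], of x k] periodic_int_vec [OF per [OF t], of y l] by (simp_all add: x'_def y'_def)
    have cos_eq: "cos (2 * pi * (x $ i - y $ i)) = cos (2 * pi * \<bar>y' $ i - x' $ i\<bar>)" for i
    proof -
      have "2 * pi * (x $ i - y $ i) = 2 * pi * (x' $ i - y' $ i) + 2 * pi * of_int (l $ i - k $ i)"
        by (simp add: x'_def y'_def int_vec_def algebra_simps)
      then have "cos (2 * pi * (x $ i - y $ i)) = cos (2 * pi * (x' $ i - y' $ i))"
        by (simp only: cos_add cos_int_2pin sin_int_2pin mult_zero_right mult_1_right diff_zero)
      also have "\<dots> = cos (2 * pi * \<bar>y' $ i - x' $ i\<bar>)"
        using cos_minus [of "2 * pi * (x' $ i - y' $ i)"] by (simp add: abs_if right_diff_distrib)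
      finally show ?thesis .
    qed
    have nonneg: "0 \<le> 1 - cos (2 * pi * (x $ i - y $ i))" for i by simp
    show ?thesis
    proof (cases "\<forall>i. \<bar>y' $ i - x' $ i\<bar> \<le> \<eta>")
      case True
      have "dist y' x' \<le> (\<Sum>i\<in>UNIV. \<bar>(y' - x') $ i\<bar>)"
        unfolding dist_norm by (rule norm_le_l1_cart)
      also have "\<dots> \<le> (\<Sum>i\<in>(UNIV::'d set). \<eta>)"
        using True by (intro sum_mono) simp
      also have "\<dots> < \<delta>" using \<eta>(3) by (simp add: mult.commute)
      finally have "\<bar>F y' t - F x' t\<bar> < \<epsilon>"
        using \<delta>(2) [of "(x', t)" "(y', t)"] Q t by (simp add: dist_Pair_Pair dist_real_def)
      then show ?thesis
        using C nonneg F by (smt (verit, best) mult_nonneg_nonneg sum_nonneg)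
    next
      case False
      then obtain i where i: "\<eta> < \<bar>y' $ i - x' $ i\<bar>" by (auto simp: not_le)
      have "cos (2 * pi * \<bar>y' $ i - x' $ i\<bar>) \<le> cos (2 * pi * \<eta>)"
        using i \<eta> near [of i] by (intro cos_monotone_0_pi_le) auto
      then have "\<kappa> \<le> 1 - cos (2 * pi * (x $ i - y $ i))"
        by (simp add: \<kappa>_def cos_eq)
      also have "\<dots> \<le> (\<Sum>i\<in>UNIV. 1 - cos (2 * pi * (x $ i - y $ i)))"
        by (rule member_le_sum) auto
      finally have "C * \<kappa> \<le> C * (\<Sum>i\<in>UNIV. 1 - cos (2 * pi * (x $ i - y $ i)))"
        using C by (rule mult_left_mono)
      moreover have "C * \<kappa> = 2 * \<bar>M\<bar>" using \<kappa> by (simp add: C_def)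
      moreover have "\<bar>F y t - F x t\<bar> \<le> 2 * \<bar>M\<bar>"
        using M [OF Q(1) t] M [OF Q(2) t] F by linarith
      ultimately show ?thesis using \<open>0 < \<epsilon>\<close> by linarith
    qed
  qed
  show ?thesis using that [OF C main] .
qed

lemma fejer_mean_uniform_limit:
  fixes F :: "real ^ 'd \<Rightarrow> 'k::metric_space \<Rightarrow> real"
  assumes K: "compact K" and cont: "continuous_on (UNIV \<times> K) (\<lambda>(x, t). F x t)"
    and per: "\<And>t. t \<in> K \<Longrightarrow> periodic (\<lambda>x. F x t)" and "0 < \<epsilon>"
  shows "eventually (\<lambda>N. \<forall>t\<in>K. \<forall>x. \<bar>fejer_mean N (\<lambda>y. F y t) x - F x t\<bar> \<le> \<epsilon>) sequentially"
proof -
  obtain C where C: "0 \<le> C" "\<And>t x y. t \<in> K \<Longrightarrow>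
      \<bar>F y t - F x t\<bar> \<le> \<epsilon> / 2 + C * (\<Sum>i\<in>UNIV. 1 - cos (2 * pi * (x $ i - y $ i)))"
    by (rule torus_modulus_of_continuity [OF K cont per, of "\<epsilon> / 2"]) (use \<open>0 < \<epsilon>\<close> in auto)
  have "(\<lambda>N. C * CARD('d) / real N) \<longlonglongrightarrow> 0" by (rule lim_const_over_n)
  then have "eventually (\<lambda>N. C * CARD('d) / real N < \<epsilon> / 2) sequentially"
    using \<open>0 < \<epsilon>\<close> by (intro order_tendstoD) auto
  then show ?thesis
    using eventually_gt_at_top [of 0]
  proof eventually_elim
    case (elim N)
    show ?case
    proof (intro ballI allI)
      fix t x assume t: "t \<in> K"
      have "continuous_on UNIV (\<lambda>y. F y t)"
        by (rule continuous_on_slice [OF cont t])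
      then have "\<bar>fejer_mean N (\<lambda>y. F y t) x - F x t\<bar> \<le> \<epsilon> / 2 + C * CARD('d) / real N"
        by (rule fejer_mean_error [OF elim(2)]) (rule C(2) [OF t])
      then show "\<bar>fejer_mean N (\<lambda>y. F y t) x - F x t\<bar> \<le> \<epsilon>" using elim(1) by linarith
    qed
  qed
qed

section \<open>Fourier coefficients of derivatives\<close>

lemma grad_nth_eqI:
  assumes "(f has_derivative D) (at x)" shows "grad f x $ i = D (axis i 1)"
  using frechet_derivative_at [OF assms] by (simp add: grad_def)

lemma differentiable_has_grad:
  fixes f :: "real ^ 'd \<Rightarrow> real"
  assumes "f differentiable (at x)" shows "(f has_derivative (\<lambda>h. grad f x \<bullet> h)) (at x)"
proof -
  have D: "(f has_derivative frechet_derivative f (at x)) (at x)"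
    using assms frechet_derivative_works by blast
  then have lin: "linear (frechet_derivative f (at x))"
    by (rule has_derivative_linear)
  have "frechet_derivative f (at x) h = grad f x \<bullet> h" for h
  proof -
    have "h = (\<Sum>i\<in>UNIV. (h $ i) *\<^sub>R axis i 1)"
      by (simp add: vec_eq_iff axis_def if_distrib cong: if_cong)
    then have "frechet_derivative f (at x) h = (\<Sum>i\<in>UNIV. (h $ i) *\<^sub>R frechet_derivative f (at x) (axis i 1))"
      using linear_sum [OF lin] linear_scale [OF lin] by (metis (mono_tags, lifting) sum.cong)
    then show ?thesis by (simp add: inner_vec_def grad_def mult.commute)
  qed
  then show ?thesis using D by (metis (no_types, lifting) ext)
qed

text \<open>
  Integration by parts, applied to \<open>u\<close> times the real and the imaginary part of the character.
\<close>

lemma fcoef_partial_derivative: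
  fixes u :: "real ^ 'd \<Rightarrow> real"
  assumes diff: "\<And>x. u differentiable (at x)" and cont: "continuous_on UNIV (grad u)"
    and per: "periodic u"
  shows "fcoef (\<lambda>x. grad u x $ j) p = 2 * pi * \<i> * of_int (p $ j) * fcoef u p"
proof -
  define c where "c x = cos (2 * pi * (int_vec p \<bullet> x))" for x :: "real ^ 'd"
  define s where "s x = sin (2 * pi * (int_vec p \<bullet> x))" for x :: "real ^ 'd"
  define k where "k = 2 * pi * real_of_int (p $ j)"
  have contu: "continuous_on UNIV u"
    using diff by (simp add: differentiable_imp_continuous_on differentiable_on_def)
  have contg: "continuous_on UNIV (\<lambda>x. grad u x $ j)"
    by (intro continuous_intros cont)
  have contc: "continuous_on UNIV c" and conts: "continuous_on UNIV s"
    unfolding c_def s_def by (intro continuous_intros)+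
  have char: "character p x = Complex (c x) (s x)" for x
    by (simp add: character_def c_def s_def complex_eq_iff)
  have per_cs: "periodic c" "periodic s"
    using periodic_character [of p] by (auto simp: periodic_def char)
  have Dc: "((\<lambda>x. u x * c x) has_derivative (\<lambda>h. u x * (- s x * (2 * pi * (int_vec p \<bullet> h))) + (grad u x \<bullet> h) * c x)) (at x)" for x
    unfolding c_def s_def by (rule has_derivative_mult [OF differentiable_has_grad [OF diff]]) (auto intro!: derivative_eq_intros)
  have Ds: "((\<lambda>x. u x * s x) has_derivative (\<lambda>h. u x * (c x * (2 * pi * (int_vec p \<bullet> h))) + (grad u x \<bullet> h) * s x)) (at x)" for x
    unfolding c_def s_def by (rule has_derivative_mult [OF differentiable_has_grad [OF diff]]) (auto intro!: derivative_eq_intros)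
  have pj: "int_vec p \<bullet> axis j 1 = of_int (p $ j)" and gj: "grad u x \<bullet> axis j 1 = grad u x $ j" for x
    by (simp_all add: inner_axis int_vec_def)
  have gc: "grad (\<lambda>x. u x * c x) x $ j = grad u x $ j * c x - k * (u x * s x)" for x
    unfolding grad_nth_eqI [OF Dc] pj gj by (simp add: k_def)
  have gs: "grad (\<lambda>x. u x * s x) x $ j = grad u x $ j * s x + k * (u x * c x)" for x
    unfolding grad_nth_eqI [OF Ds] pj gj by (simp add: k_def)
  note int = integrable_haar_continuous
  have "(LINT x|haar. grad (\<lambda>x. u x * c x) x $ j) = 0"
  proof (rule integral_haar_partial_derivative)
    show "(\<lambda>x. u x * c x) differentiable (at x)" for x using Dc differentiable_def by blast
    show "continuous_on UNIV (\<lambda>x. grad (\<lambda>x. u x * c x) x $ j)"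
      unfolding gc by (intro continuous_intros contu contc conts contg)
    show "periodic (\<lambda>x. u x * c x)" using per per_cs by (simp add: periodic_def)
  qed
  then have C: "(LINT x|haar. grad u x $ j * c x) = k * (LINT x|haar. u x * s x)"
    unfolding gc by (subst (asm) Bochner_Integration.integral_diff)
      (auto intro!: int continuous_intros contu contc conts contg)
  have "(LINT x|haar. grad (\<lambda>x. u x * s x) x $ j) = 0"
  proof (rule integral_haar_partial_derivative)
    show "(\<lambda>x. u x * s x) differentiable (at x)" for x using Ds differentiable_def by blast
    show "continuous_on UNIV (\<lambda>x. grad (\<lambda>x. u x * s x) x $ j)"
      unfolding gs by (intro continuous_intros contu contc conts contg)
    show "periodic (\<lambda>x. u x * s x)" using per per_cs by (simp add: periodic_def)
  qed
  then have S: "(LINT x|haar. grad u x $ j * s x) = - k * (LINT x|haar. u x * c x)"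
    unfolding gs by (subst (asm) Bochner_Integration.integral_add)
      (auto intro!: int continuous_intros contu contc conts contg)
  have coef: "fcoef f p = Complex (LINT x|haar. f x * c x) (- (LINT x|haar. f x * s x))"
    if f: "continuous_on UNIV f" for f :: "real ^ 'd \<Rightarrow> real"
  proof -
    have eq: "of_real (f x) * cnj (character p x) = Complex (f x * c x) (- (f x * s x))" for x
      unfolding char by (simp add: complex_eq_iff)
    have "integrable haar (\<lambda>x. Complex (f x * c x) (- (f x * s x)))"
      unfolding eq [symmetric] by (intro int continuous_intros f)
    from integral_Re [OF this] integral_Im [OF this] show ?thesis
      unfolding fcoef_def eq by (simp add: complex_eq_iff)
  qed
  show ?thesis
    unfolding coef [OF contg] coef [OF contu] C S by (simp add: complex_eq_iff k_def)
qed

lemma fourier_coeff_fcoef: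
  fixes f :: "real ^ 'd \<Rightarrow> real"
  assumes "continuous_on UNIV f"
  shows "fourier_coeff (\<lambda>x. of_real (f x)) k = fcoef f k"
  unfolding fourier_coeff_def fcoef_def
  by (intro set_integral_cell borel_measurable_continuous_onI continuous_intros assms)

text \<open>
  Jensen's inequality, from the nonnegativity of the variance of \<open>|f|\<close>.
\<close>

lemma cmod_integral_power2_le:
  fixes f :: "real ^ 'd \<Rightarrow> complex"
  assumes f: "continuous_on UNIV f"
  shows "(cmod (LINT x|haar. f x))\<^sup>2 \<le> (LINT x|haar. (cmod (f x))\<^sup>2)"
proof -
  interpret prob_space "haar :: (real ^ 'd) measure"
    by (rule prob_torusD(1) [OF haar_in_prob_torus])
  define c where "c = (LINT x|haar. cmod (f x))"
  have int: "integrable haar (\<lambda>x. cmod (f x))" "integrable haar (\<lambda>x. (cmod (f x))\<^sup>2)"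
    by (intro integrable_haar_continuous continuous_intros f)+
  have "0 \<le> (LINT x|haar. (cmod (f x) - c)\<^sup>2)"
    by (intro integral_nonneg_AE) auto
  also have "\<dots> = (LINT x|haar. (cmod (f x))\<^sup>2 - 2 * c * cmod (f x) + c\<^sup>2)"
    by (intro Bochner_Integration.integral_cong) (auto simp: power2_diff)
  also have "\<dots> = (LINT x|haar. (cmod (f x))\<^sup>2) - 2 * c * c + c\<^sup>2"
    using int prob_space by (simp add: c_def)
  finally have "c\<^sup>2 \<le> (LINT x|haar. (cmod (f x))\<^sup>2)" by (simp add: power2_eq_square)
  moreover have "cmod (LINT x|haar. f x) \<le> c"
    unfolding c_def by (rule integral_norm_bound)
  ultimately show ?thesis by (meson norm_ge_zero order_trans power_mono)
qed

text \<open>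
  Each Fourier coefficient is continuous in \<open>L\<^sup>2\<close>.  It is therefore the limit of the coefficients of the partial
  sums, which are constant as soon as the frequency \<open>p\<close> is included.
\<close>

lemma fcoef_frac_laplacian:
  fixes v g :: "real ^ 'd \<Rightarrow> real"
  assumes v: "continuous_on UNIV v" and lap: "frac_laplacian s v g"
  shows "fcoef g p = of_real (frac_symbol s p) * fcoef v p"
proof -
  have g: "continuous_on UNIV g" using lap by (simp add: frac_laplacian_def)
  define D where "D F x = of_real (g x) - of_real ((2 * pi) powr (2 * s)) *
            (\<Sum>k\<in>F. of_real (norm (int_vec k) powr (2 * s)) * fourier_coeff (\<lambda>y. of_real (v y)) k * character k x)"
    for F and x :: "real ^ 'd"
  have contD: "continuous_on UNIV (D F)" for F
    unfolding D_def by (intro continuous_intros g)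
  define \<delta> where "\<delta> = fcoef g p - of_real (frac_symbol s p) * fcoef v p"
  have lim: "((\<lambda>F. LINT x:cell|lborel. (cmod (D F x))\<^sup>2) \<longlongrightarrow> 0) (finite_subsets_at_top UNIV)"
    using lap by (simp only: frac_laplacian_def D_def)
  have "(cmod \<delta>)\<^sup>2 \<le> (LINT x:cell|lborel. (cmod (D F x))\<^sup>2)" if F: "finite F" "p \<in> F" for F
  proof -
    have orth: "(LINT x|haar. character k x * cnj (character p x)) = (if k = p then 1 else 0)" for k
      using integral_haar_character [of "k - p"] by (simp add: character_diff)
    have D_eq: "D F x * cnj (character p x) = of_real (g x) * cnj (character p x) -
       (\<Sum>k\<in>F. of_real (frac_symbol s k) * fcoef v k * (character k x * cnj (character p x)))" for x
      unfolding D_def fourier_coeff_fcoef [OF v] frac_symbol_def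
      by (simp only: left_diff_distrib sum_distrib_left sum_distrib_right of_real_mult) (simp only: mult_ac)
    have "(LINT x|haar. D F x * cnj (character p x)) = fcoef g p -
       (LINT x|haar. (\<Sum>k\<in>F. of_real (frac_symbol s k) * fcoef v k * (character k x * cnj (character p x))))"
      unfolding D_eq fcoef_def
      by (intro Bochner_Integration.integral_diff integrable_haar_continuous continuous_intros g)
    also have "(LINT x|haar. (\<Sum>k\<in>F. of_real (frac_symbol s k) * fcoef v k * (character k x * cnj (character p x)))) =
       (\<Sum>k\<in>F. LINT x|haar. of_real (frac_symbol s k) * fcoef v k * (character k x * cnj (character p x)))"
      by (intro Bochner_Integration.integral_sum integrable_haar_continuous continuous_intros)
    also have "\<dots> = (\<Sum>k\<in>F. of_real (frac_symbol s k) * fcoef v k * (if k = p then 1 else 0))"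
      by (simp only: integral_mult_right_zero orth)
    also have "\<dots> = of_real (frac_symbol s p) * fcoef v p"
      using F by (simp add: if_distrib cong: if_cong)
    finally have "\<delta> = (LINT x|haar. D F x * cnj (character p x))"
      by (simp add: \<delta>_def)
    then have "(cmod \<delta>)\<^sup>2 \<le> (LINT x|haar. (cmod (D F x * cnj (character p x)))\<^sup>2)"
      by (simp only:) (intro cmod_integral_power2_le continuous_intros contD)
    also have "\<dots> = (LINT x:cell|lborel. (cmod (D F x))\<^sup>2)"
      by (subst set_integral_cell) (auto simp: norm_mult intro!: borel_measurable_continuous_onI continuous_intros contD)
    finally show ?thesis .
  qed
  then have "eventually (\<lambda>F. (cmod \<delta>)\<^sup>2 \<le> (LINT x:cell|lborel. (cmod (D F x))\<^sup>2)) (finite_subsets_at_top UNIV)"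
    unfolding eventually_finite_subsets_at_top by (intro exI [of _ "{p}"]) auto
  then have "(cmod \<delta>)\<^sup>2 \<le> 0"
    by (intro tendsto_lowerbound [OF lim]) auto
  then show ?thesis by (simp add: \<delta>_def)
qed

lemma integral_haar_cbox:
  fixes f :: "real ^ 'd \<Rightarrow> 'b::euclidean_space"
  assumes f: "continuous_on UNIV f"
  shows "(LINT x|haar. f x) = integral (cbox 0 1) f"
proof -
  have [measurable]: "f \<in> borel_measurable borel" by (rule borel_measurable_continuous_onI [OF f])
  have "(LINT x|haar. f x) = (LINT x:cell|lborel. f x)"
    by (simp add: set_integral_cell)
  also have "\<dots> = (LINT x:cbox 0 1|lborel. f x)"
    unfolding set_lebesgue_integral_def
  proof (rule integral_cong_AE)
    have "AE x in lborel. x \<notin> cbox 0 1 - (cell :: (real ^ 'd) set)"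
      by (rule AE_not_in [OF cell_diff_null])
    then show "AE x in lborel. indicator cell x *\<^sub>R f x = indicator (cbox 0 1) x *\<^sub>R f x"
      by eventually_elim (use cell_subset_cbox in \<open>auto simp: indicator_def\<close>)
  qed auto
  also have "\<dots> = integral (cbox 0 1) f"
    by (intro set_borel_integral_eq_integral(2)) 
       (auto simp: set_integrable_def intro!: borel_integrable_compact continuous_on_subset [OF f])
  finally show ?thesis .
qed

lemma fcoef_cbox:
  assumes "continuous_on UNIV f"
  shows "fcoef f p = integral (cbox 0 1) (\<lambda>x. of_real (f x) * cnj (character p x))"
  unfolding fcoef_def by (intro integral_haar_cbox continuous_intros assms)

lemma continuous_on_fcoef:
  fixes F :: "real ^ 'd \<Rightarrow> real \<Rightarrow> real"
  assumes "continuous_on (UNIV \<times> K) (\<lambda>(x, t). F x t)"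
  shows "continuous_on K (\<lambda>t. fcoef (\<lambda>x. F x t) p)"
proof -
  have "continuous_on K (\<lambda>t. integral (cbox 0 1) (\<lambda>x. of_real (F x t) * cnj (character p x)))"
  proof (rule integral_continuous_on_param)
    have "continuous_on (K \<times> cbox 0 1) (\<lambda>z. (case prod.swap z of (x, t) \<Rightarrow> F x t))"
      by (rule continuous_on_compose2 [OF assms]) (auto intro!: continuous_on_swap)
    then have "continuous_on (K \<times> cbox 0 1) (\<lambda>z. F (snd z) (fst z))"
      by (simp add: case_prod_unfold)
    then show "continuous_on (K \<times> cbox 0 1) (\<lambda>(t, x). of_real (F x t) * cnj (character p x))"
      unfolding case_prod_unfold by (intro continuous_intros)
  qed
  moreover have "fcoef (\<lambda>x. F x t) p = integral (cbox 0 1) (\<lambda>x. of_real (F x t) * cnj (character p x))" if "t \<in> K" for t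
    by (rule fcoef_cbox [OF continuous_on_slice [OF assms that]])
  ultimately show ?thesis by (simp cong: continuous_on_cong)
qed

lemma fcoef_time_derivative:
  fixes u :: "real ^ 'd \<Rightarrow> real \<Rightarrow> real"
  assumes u: "C_2s_1 s T u" and t: "t \<in> {0..T}"
  shows "((\<lambda>t. fcoef (\<lambda>x. u x t) p) has_vector_derivative fcoef (\<lambda>x. time_deriv T u x t) p) (at t within {0..T})"
proof -
  have cu: "continuous_on (UNIV \<times> {0..T}) (\<lambda>(x, t). u x t)"
    and cd: "continuous_on (UNIV \<times> {0..T}) (\<lambda>(x, t). time_deriv T u x t)"
    and dt: "\<And>x t. t \<in> {0..T} \<Longrightarrow> (\<lambda>\<tau>. u x \<tau>) differentiable (at t within {0..T})"
    using u unfolding C_2s_1_def by blast+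
  have D: "((\<lambda>t. u x t) has_vector_derivative time_deriv T u x t) (at t within {0..T})" if "t \<in> {0..T}" for x t
    unfolding time_deriv_def by (rule iffD1 [OF vector_derivative_works dt [OF that]])
  have "((\<lambda>t. integral (cbox 0 1) (\<lambda>x. of_real (u x t) * cnj (character p x))) has_vector_derivative
     integral (cbox 0 1) (\<lambda>x. of_real (time_deriv T u x t) * cnj (character p x))) (at t within {0..T})"
  proof (rule leibniz_rule_vector_derivative)
    show "((\<lambda>t. of_real (u x t) * cnj (character p x)) has_vector_derivative
        of_real (time_deriv T u x t) * cnj (character p x)) (at t within {0..T})" if "t \<in> {0..T}" for t x
      by (intro has_vector_derivative_mult_left has_vector_derivative_of_real
          D [unfolded has_real_derivative_iff_has_vector_derivative [symmetric]] that)
    show "(\<lambda>x. of_real (u x t) * cnj (character p x)) integrable_on cbox 0 1" if "t \<in> {0..T}" for t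
      by (intro integrable_continuous continuous_intros continuous_on_subset [OF continuous_on_slice [OF cu that]] subset_UNIV)
    have "continuous_on ({0..T} \<times> cbox 0 1) (\<lambda>z. (case prod.swap z of (x, t) \<Rightarrow> time_deriv T u x t))"
      by (rule continuous_on_compose2 [OF cd]) (auto intro!: continuous_on_swap)
    then have "continuous_on ({0..T} \<times> cbox 0 1) (\<lambda>z. time_deriv T u (snd z) (fst z))"
      by (simp add: case_prod_unfold)
    then show "continuous_on ({0..T} \<times> cbox 0 1) (\<lambda>(t, x). of_real (time_deriv T u x t) * cnj (character p x))"
      unfolding case_prod_unfold by (intro continuous_intros)
  qed (use t in auto)
  then show ?thesis
    unfolding fcoef_cbox [OF continuous_on_slice [OF cd t], symmetric]
    by (rule has_vector_derivative_transform [OF t, rotated])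
       (simp add: fcoef_cbox [OF continuous_on_slice [OF cu]])
qed

section \<open>Smooth cut-off functions in time\<close>

text \<open>
  Derivatives of every order on the line.  This is the property from which \<open>C_k\<close> of a product of a cut-off in
  time and a character is obtained by induction.
\<close>

primrec times_differentiable :: "nat \<Rightarrow> (real \<Rightarrow> real) \<Rightarrow> bool" where
  "times_differentiable 0 f \<longleftrightarrow> True"
| "times_differentiable (Suc n) f \<longleftrightarrow>
     (\<exists>f'. (\<forall>t. (f has_real_derivative f' t) (at t)) \<and> times_differentiable n f')"

definition smooth :: "(real \<Rightarrow> real) \<Rightarrow> bool" where
  "smooth f \<longleftrightarrow> (\<forall>n. times_differentiable n f)"

lemma times_differentiable_SucI:
  "(\<And>t. (f has_real_derivative f' t) (at t)) \<Longrightarrow> times_differentiable n f' \<Longrightarrow> times_differentiable (Suc n) f"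
  by auto

lemma times_differentiable_SucD:
  "times_differentiable (Suc n) f \<Longrightarrow> \<exists>f'. (\<forall>t. (f has_real_derivative f' t) (at t)) \<and> times_differentiable n f'"
  by simp

declare times_differentiable.simps(2) [simp del]

lemma times_differentiable_mono: "times_differentiable (Suc n) f \<Longrightarrow> times_differentiable n f"
proof (induction n arbitrary: f)
  case (Suc n)
  obtain f' where "\<And>t. (f has_real_derivative f' t) (at t)" "times_differentiable (Suc n) f'"
    using times_differentiable_SucD [OF Suc.prems] by auto
  then show ?case by (intro times_differentiable_SucI [of f f'] Suc.IH)
qed simp

lemma times_differentiable_add:
  "times_differentiable n f \<Longrightarrow> times_differentiable n g \<Longrightarrow> times_differentiable n (\<lambda>t. f t + g t)"
proof (induction n arbitrary: f g)
  case (Suc n)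
  obtain f' where f': "\<And>t. (f has_real_derivative f' t) (at t)" "times_differentiable n f'"
    using times_differentiable_SucD [OF Suc.prems(1)] by auto
  obtain g' where g': "\<And>t. (g has_real_derivative g' t) (at t)" "times_differentiable n g'"
    using times_differentiable_SucD [OF Suc.prems(2)] by auto
  show ?case
    by (rule times_differentiable_SucI [OF DERIV_add [OF f'(1) g'(1)]]) (intro Suc.IH f' g')
qed simp

lemma times_differentiable_mult:
  "times_differentiable n f \<Longrightarrow> times_differentiable n g \<Longrightarrow> times_differentiable n (\<lambda>t. f t * g t)"
proof (induction n arbitrary: f g)
  case (Suc n)
  obtain f' where f': "\<And>t. (f has_real_derivative f' t) (at t)" "times_differentiable n f'"
    using times_differentiable_SucD [OF Suc.prems(1)] by auto
  obtain g' where g': "\<And>t. (g has_real_derivative g' t) (at t)" "times_differentiable n g'"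
    using times_differentiable_SucD [OF Suc.prems(2)] by auto
  show ?case
    by (rule times_differentiable_SucI [OF DERIV_mult [OF f'(1) g'(1)]])
      (intro times_differentiable_add Suc.IH f' g' times_differentiable_mono [OF Suc.prems(1)]
        times_differentiable_mono [OF Suc.prems(2)])
qed simp

lemma times_differentiable_const: "times_differentiable n (\<lambda>t. c)"
proof (induction n arbitrary: c)
  case (Suc n)
  show ?case by (rule times_differentiable_SucI [OF DERIV_const Suc])
qed simp

lemma times_differentiable_affine:
  "times_differentiable n f \<Longrightarrow> times_differentiable n (\<lambda>t. f (a * t + b))"
proof (induction n arbitrary: f)
  case (Suc n)
  obtain f' where f': "\<And>t. (f has_real_derivative f' t) (at t)" "times_differentiable n f'"
    using times_differentiable_SucD [OF Suc.prems] by auto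
  have "((\<lambda>t. f (a * t + b)) has_real_derivative f' (a * t + b) * a) (at t)" for t
    by (rule DERIV_chain2 [OF f'(1)]) (auto intro!: derivative_eq_intros)
  then show ?case
    by (rule times_differentiable_SucI) (intro times_differentiable_mult times_differentiable_const Suc.IH f')
qed simp

lemma smooth_intros:
  "smooth (\<lambda>t. c)"
  "smooth f \<Longrightarrow> smooth g \<Longrightarrow> smooth (\<lambda>t. f t + g t)"
  "smooth f \<Longrightarrow> smooth g \<Longrightarrow> smooth (\<lambda>t. f t * g t)"
  "smooth f \<Longrightarrow> smooth (\<lambda>t. f (a * t + b))"
  by (auto simp: smooth_def intro: times_differentiable_const times_differentiable_add
      times_differentiable_mult times_differentiable_affine)

lemma smooth_deriv_ex:
  assumes "smooth f"
  shows "\<exists>f'. (\<forall>t. (f has_real_derivative f' t) (at t)) \<and> smooth f'"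
proof -
  have td: "times_differentiable (Suc n) f" for n
    using assms by (simp add: smooth_def)
  obtain f' where f': "\<And>t. (f has_real_derivative f' t) (at t)"
    using times_differentiable_SucD [OF td [of 0]] by auto
  have "times_differentiable n f'" for n
  proof -
    obtain g where g: "\<And>t. (f has_real_derivative g t) (at t)" "times_differentiable n g"
      using times_differentiable_SucD [OF td [of n]] by auto
    have "g = f'" by (rule ext) (rule DERIV_unique [OF g(1) f'])
    then show ?thesis using g(2) by simp
  qed
  then show ?thesis using f' by (auto simp: smooth_def)
qed

lemma smooth_of_deriv:
  assumes "\<And>t. (f has_real_derivative f' t) (at t)" "smooth f'"
  shows "smooth f"
  unfolding smooth_def
proof
  fix n show "times_differentiable n f"
  proof (cases n)
    case (Suc k)
    then show ?thesis using assms times_differentiable_SucI [of f f' k] by (simp add: smooth_def)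
  qed simp
qed

lemma smooth_imp_continuous:
  assumes "smooth f" shows "continuous_on S f"
proof -
  obtain f' where f': "\<And>t. (f has_real_derivative f' t) (at t)"
    using smooth_deriv_ex [OF assms] by auto
  show ?thesis
    by (rule DERIV_continuous_on [OF has_field_derivative_at_within [OF f']])
qed

text \<open>
  For \<open>P = 1\<close> this is the standard function that is smooth but flat at the origin.  The polynomial factor makes the
  family closed under differentiation.
\<close>

definition flat :: "real poly \<Rightarrow> real \<Rightarrow> real" where
  "flat P t = (if t > 0 then poly P (1 / t) * exp (- (1 / t)) else 0)"

lemma poly_exp_tendsto_0: "((\<lambda>y. poly P y * exp (- y)) \<longlongrightarrow> (0 :: real)) at_top"
proof -
  have "((\<lambda>y. \<Sum>i\<le>degree P. coeff P i * (y ^ i / exp y)) \<longlongrightarrow> (\<Sum>i\<le>degree P. coeff P i * 0)) at_top"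
    by (intro tendsto_intros tendsto_power_div_exp_0)
  then show ?thesis
    by (simp add: poly_altdef sum_divide_distrib exp_minus divide_inverse [symmetric])
qed

lemma flat_quotient_tendsto_0: "((\<lambda>t. flat P t / t) \<longlongrightarrow> 0) (at 0)"
proof -
  have "((\<lambda>t. poly (pCons 0 P) (inverse t) * exp (- inverse t)) \<longlongrightarrow> 0) (at_right 0)"
    by (rule filterlim_compose [OF poly_exp_tendsto_0 filterlim_inverse_at_top_right])
  moreover have "eventually (\<lambda>t. poly (pCons 0 P) (inverse t) * exp (- inverse t) = flat P t / t) (at_right (0::real))"
    unfolding eventually_at_right_field by (intro exI [of _ 1]) (auto simp: flat_def divide_inverse)
  ultimately have "((\<lambda>t. flat P t / t) \<longlongrightarrow> 0) (at_right 0)"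
    by (rule Lim_transform_eventually)
  moreover have "((\<lambda>t. flat P t / t) \<longlongrightarrow> 0) (at_left 0)"
    by (rule tendsto_eventually) (auto simp: flat_def eventually_at_left_field intro!: exI [of _ "-1"])
  ultimately show ?thesis by (simp add: filterlim_at_split)
qed

lemma flat_deriv: "(flat P has_real_derivative flat ([:0, 0, 1:] * (P - pderiv P)) t) (at t)"
proof -
  consider "t > 0" | "t < 0" | "t = 0" by linarith
  then show ?thesis
  proof cases
    case 1
    have "((\<lambda>t. poly P (1 / t) * exp (- (1 / t))) has_real_derivative
       flat ([:0, 0, 1:] * (P - pderiv P)) t) (at t)"
      using 1 by (auto intro!: derivative_eq_intros simp: flat_def field_simps power2_eq_square)
    then show ?thesis
      by (rule DERIV_cong_ev [THEN iffD1, OF refl _ refl, rotated])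
         (use 1 in \<open>auto simp: flat_def intro!: eventually_mono [OF eventually_nhds_in_open [of "{0<..}"]]\<close>)
  next
    case 2
    have "((\<lambda>t::real. 0) has_real_derivative flat ([:0, 0, 1:] * (P - pderiv P)) t) (at t)"
      using 2 by (simp add: flat_def)
    then show ?thesis
      by (rule DERIV_cong_ev [THEN iffD1, OF refl _ refl, rotated])
         (use 2 in \<open>auto simp: flat_def intro!: eventually_mono [OF eventually_nhds_in_open [of "{..<0}"]]\<close>)
  next
    case 3
    have "flat Q 0 = 0" for Q by (simp add: flat_def)
    then show ?thesis
      using flat_quotient_tendsto_0 [of P] 3 by (simp add: DERIV_def)
  qed
qed

lemma smooth_flat: "smooth (flat P)"
  unfolding smooth_def
proof
  fix n show "times_differentiable n (flat P)"
  proof (induction n arbitrary: P)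
    case (Suc n)
    show ?case by (rule times_differentiable_SucI [OF flat_deriv Suc])
  qed simp
qed

text \<open>
  A step \<open>\<Psi>\<close> from \<open>0\<close> to \<open>1\<close> on the unit interval together with its derivative \<open>\<eta>\<close>, a mollifier.
\<close>

definition smooth_step :: "(real \<Rightarrow> real) \<Rightarrow> (real \<Rightarrow> real) \<Rightarrow> bool" where
  "smooth_step \<Psi> \<eta> \<longleftrightarrow> smooth \<Psi> \<and> smooth \<eta> \<and> (\<forall>t. (\<Psi> has_real_derivative \<eta> t) (at t)) \<and>
     (\<forall>t\<le>0. \<Psi> t = 0) \<and> (\<forall>t\<ge>1. \<Psi> t = 1) \<and> (\<forall>t. 0 \<le> \<Psi> t) \<and> (\<forall>t. \<Psi> t \<le> 1) \<and>
     (\<forall>t. 0 \<le> \<eta> t) \<and> (\<forall>t. t \<notin> {0..1} \<longrightarrow> \<eta> t = 0)"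

lemma smooth_stepD:
  assumes "smooth_step \<Psi> \<eta>"
  shows "smooth \<Psi>" "smooth \<eta>" "\<And>t. (\<Psi> has_real_derivative \<eta> t) (at t)"
    "\<And>t. t \<le> 0 \<Longrightarrow> \<Psi> t = 0" "\<And>t. t \<ge> 1 \<Longrightarrow> \<Psi> t = 1" "\<And>t. 0 \<le> \<Psi> t" "\<And>t. \<Psi> t \<le> 1"
    "\<And>t. 0 \<le> \<eta> t" "\<And>t. t \<notin> {0..1} \<Longrightarrow> \<eta> t = 0"
  using assms unfolding smooth_step_def by blast+

lemma smooth_step_exists: "\<exists>\<Psi> \<eta>. smooth_step \<Psi> \<eta>"
proof -
  define \<eta>0 where "\<eta>0 t = flat 1 t * flat 1 ((-1) * t + 1)" for t
  have sm: "smooth \<eta>0" unfolding \<eta>0_def by (intro smooth_intros smooth_flat)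
  have nonneg: "0 \<le> \<eta>0 t" and pos: "t \<in> {0<..<1} \<Longrightarrow> 0 < \<eta>0 t" and zero: "t \<notin> {0<..<1} \<Longrightarrow> \<eta>0 t = 0" for t
    by (auto simp: \<eta>0_def flat_def)
  define \<Psi>0 where "\<Psi>0 t = (LBINT y=0..t. \<eta>0 y)" for t :: real
  have deriv: "(\<Psi>0 has_real_derivative \<eta>0 t) (at t)" for t
  proof -
    define a where "a = min (-1) (t - 1)"
    define b where "b = max 1 (t + 1)"
    have "(\<Psi>0 has_vector_derivative \<eta>0 t) (at t within {a..b})"
      unfolding \<Psi>0_def
      using interval_integral_FTC2 [of a 0 b \<eta>0 t] smooth_imp_continuous [OF sm]
      by (auto simp: a_def b_def zero_ereal_def)
    moreover have "t \<in> interior {a..b}" by (auto simp: a_def b_def)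
    then have "at t within {a..b} = at t" by (rule at_within_interior)
    ultimately show ?thesis
      unfolding has_real_derivative_iff_has_vector_derivative by (simp only:)
  qed
  have mvt: "\<exists>z. x < z \<and> z < y \<and> \<Psi>0 y - \<Psi>0 x = (y - x) * \<eta>0 z" if "x < y" for x y
    using MVT2 [OF that, of \<Psi>0 \<eta>0] deriv by auto
  have zero0: "\<Psi>0 0 = 0" by (simp add: \<Psi>0_def zero_ereal_def)
  have one_pos: "0 < \<Psi>0 1"
    using mvt [of 0 1] pos zero0 by auto
  have below: "\<Psi>0 t = 0" if "t \<le> 0" for t
    using mvt [of t 0] zero zero0 that by (cases "t = 0") auto
  have above: "\<Psi>0 t = \<Psi>0 1" if "t \<ge> 1" for t
    using mvt [of 1 t] zero that by (cases "t = 1") auto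
  have mono: "\<Psi>0 x \<le> \<Psi>0 y" if "x \<le> y" for x y
  proof (cases "x = y")
    case False
    with that obtain z where "\<Psi>0 y - \<Psi>0 x = (y - x) * \<eta>0 z" using mvt [of x y] by auto
    moreover have "0 \<le> (y - x) * \<eta>0 z" using that nonneg by simp
    ultimately show ?thesis by simp
  qed simp
  define c where "c = 1 / \<Psi>0 1"
  have c: "0 < c" "c * \<Psi>0 1 = 1" using one_pos by (auto simp: c_def)
  have "smooth_step (\<lambda>t. c * \<Psi>0 t) (\<lambda>t. c * \<eta>0 t)"
    unfolding smooth_step_def
  proof (intro conjI allI impI)
    show "smooth (\<lambda>t. c * \<Psi>0 t)" by (intro smooth_intros smooth_of_deriv [OF deriv sm])
    show "smooth (\<lambda>t. c * \<eta>0 t)" by (intro smooth_intros sm)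
    show "((\<lambda>t. c * \<Psi>0 t) has_real_derivative c * \<eta>0 t) (at t)" for t
      by (intro DERIV_cmult deriv)
    show "c * \<Psi>0 t = 0" if "t \<le> 0" for t using below [OF that] by simp
    show "c * \<Psi>0 t = 1" if "t \<ge> 1" for t using above [OF that] c by simp
    show "0 \<le> c * \<Psi>0 t" for t
      using mono [of 0 t] below [of t] c zero0 by (cases "t \<le> 0") auto
    show "c * \<Psi>0 t \<le> 1" for t
    proof -
      have "\<Psi>0 t \<le> \<Psi>0 1" using mono [of t 1] above [of t] by (cases "t \<le> 1") auto
      then have "c * \<Psi>0 t \<le> c * \<Psi>0 1" using c(1) by (intro mult_left_mono) auto
      then show ?thesis using c(2) by simp
    qed
    show "0 \<le> c * \<eta>0 t" for t using c nonneg by simp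
    show "c * \<eta>0 t = 0" if "t \<notin> {0..1}" for t using zero [of t] that by auto
  qed
  then show ?thesis by blast
qed

section \<open>From weak derivatives to absolute continuity\<close>

lemma approximate_identity_tendsto:
  fixes F :: "real \<Rightarrow> complex" and \<Psi> \<eta> :: "real \<Rightarrow> real"
  assumes *: "smooth_step \<Psi> \<eta>"
    and F: "continuous_on {a..e} F" and c: "a \<le> c" "c < e"
    and \<epsilon>: "\<And>n. 0 < \<epsilon> n" "\<And>n. c + \<epsilon> n \<le> e" "\<epsilon> \<longlonglongrightarrow> 0"
  shows "(\<lambda>n::nat. LINT t:{a..e}|lborel. (\<eta> ((t - c) / \<epsilon> n) / \<epsilon> n) *\<^sub>R F t) \<longlonglongrightarrow> F c"
proof (rule LIMSEQ_I)
  note step = smooth_stepD [OF *]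
  fix r :: real assume "0 < r"
  define w where "w n t = \<eta> ((t - c) / \<epsilon> n) / \<epsilon> n" for n t
  have contw: "continuous_on S (w n)" for n S
    unfolding w_def divide_inverse by (intro continuous_intros continuous_on_compose2 [OF smooth_imp_continuous [OF step(2)]]) auto
  have w_nonneg: "0 \<le> w n t" for n t using step(8) \<epsilon>(1) [of n] by (simp add: w_def)
  have mass: "(LINT t:{a..e}|lborel. w n t) = 1" for n
  proof -
    have "((\<lambda>t. \<Psi> ((t - c) / \<epsilon> n)) has_real_derivative w n t) (at t)" for t
    proof -
      have "((\<lambda>t. (t - c) / \<epsilon> n) has_real_derivative 1 / \<epsilon> n) (at t)"
        using \<epsilon>(1) [of n] by (auto intro!: derivative_eq_intros)
      from DERIV_chain2 [OF step(3) this] show ?thesis by (simp add: w_def)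
    qed
    then have "((\<lambda>t. \<Psi> ((t - c) / \<epsilon> n)) has_vector_derivative w n t) (at t within {a..e})" for t
      by (simp add: has_real_derivative_iff_has_vector_derivative [symmetric] has_field_derivative_at_within)
    then have "(LINT t:{a..e}|lborel. w n t) = \<Psi> ((e - c) / \<epsilon> n) - \<Psi> ((a - c) / \<epsilon> n)"
      unfolding set_lebesgue_integral_def using c by (intro integral_FTC_atLeastAtMost contw) auto
    also have "\<dots> = 1"
      using c \<epsilon>(1) [of n] \<epsilon>(2) [of n] by (subst step(5), simp add: field_simps, subst step(4)) (auto simp: divide_nonpos_pos)
    finally show ?thesis .
  qed
  have "continuous (at c within {a..e}) F"
    using F c by (simp add: continuous_on_eq_continuous_within)
  then obtain d where d: "d > 0" "\<And>t. t \<in> {a..e} \<Longrightarrow> dist t c < d \<Longrightarrow> dist (F t) (F c) < r / 2"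
    unfolding continuous_within_eps_delta using \<open>0 < r\<close> by (meson half_gt_zero)
  have ev: "eventually (\<lambda>n. \<epsilon> n < d) sequentially"
    using \<epsilon>(3) d(1) by (rule order_tendstoD)
  have int: "set_integrable lborel {a..e} (\<lambda>t. w n t *\<^sub>R F t)" "set_integrable lborel {a..e} (\<lambda>t. w n t *\<^sub>R F c)"
      "set_integrable lborel {a..e} (\<lambda>t. w n t * (r / 2))" "set_integrable lborel {a..e} (w n)" for n
    by (intro borel_integrable_atLeastAtMost' continuous_intros contw F)+
  have "norm ((LINT t:{a..e}|lborel. w n t *\<^sub>R F t) - F c) < r" if n: "\<epsilon> n < d" for n
  proof -
    have "(LINT t:{a..e}|lborel. w n t *\<^sub>R F c) = F c"
    proof -
      have "(LINT t:{a..e}|lborel. w n t *\<^sub>R F c) = (LINT t:{a..e}|lborel. w n t) *\<^sub>R F c"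
        using int(4) [of n] unfolding set_lebesgue_integral_def set_integrable_def scaleR_scaleR real_scaleR_def
        by (intro integral_scaleR_left)
      then show ?thesis by (simp add: mass)
    qed
    then have "(LINT t:{a..e}|lborel. w n t *\<^sub>R F t) - F c = (LINT t:{a..e}|lborel. w n t *\<^sub>R F t - w n t *\<^sub>R F c)"
      using set_integral_diff(2) [OF int(1) int(2)] by simp
    then have "norm ((LINT t:{a..e}|lborel. w n t *\<^sub>R F t) - F c) \<le> (LINT t:{a..e}|lborel. norm (w n t *\<^sub>R F t - w n t *\<^sub>R F c))"
      by (simp add: set_integral_norm_bound set_integral_diff(1) [OF int(1) int(2)])
    also have "\<dots> \<le> (LINT t:{a..e}|lborel. w n t * (r / 2))"
    proof (rule set_integral_mono)
      show "set_integrable lborel {a..e} (\<lambda>t. norm (w n t *\<^sub>R F t - w n t *\<^sub>R F c))"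
        by (intro borel_integrable_atLeastAtMost' continuous_intros contw F)
      show "set_integrable lborel {a..e} (\<lambda>t. w n t * (r / 2))" by (rule int)
      fix t assume t: "t \<in> {a..e}"
      show "norm (w n t *\<^sub>R F t - w n t *\<^sub>R F c) \<le> w n t * (r / 2)"
      proof (cases "(t - c) / \<epsilon> n \<in> {0..1}")
        case True
        then have "0 \<le> t - c" "t - c \<le> \<epsilon> n" using \<epsilon>(1) [of n] by (auto simp: field_simps)
        then have "dist t c < d" using n by (simp add: dist_real_def)
        then have "norm (F t - F c) \<le> r / 2" using d(2) [OF t] by (simp add: dist_norm)
        then show ?thesis
          using mult_left_mono [OF _ w_nonneg [of n t], of "norm (F t - F c)" "r / 2"] w_nonneg [of n t]
          by (simp add: scaleR_diff_right [symmetric])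
      next
        case False
        then have "w n t = 0" using step(9) by (simp add: w_def)
        then show ?thesis by simp
      qed
    qed
    also have "\<dots> = r / 2" using mass [of n] by simp
    finally show ?thesis using \<open>0 < r\<close> by simp
  qed
  then show "\<exists>N. \<forall>n\<ge>N. norm ((LINT t:{a..e}|lborel. (\<eta> ((t - c) / \<epsilon> n) / \<epsilon> n) *\<^sub>R F t) - F c) < r"
    using ev unfolding w_def eventually_sequentially by blast
qed

text \<open>
  The lemma of du Bois-Reymond.  The test function rises from \<open>0\<close> to \<open>1\<close> on a short interval after \<open>a\<close> and falls
  back to \<open>0\<close> on a short interval after \<open>b\<close>.  As the intervals shrink, its derivative evaluates \<open>F\<close> at \<open>a\<close> and \<open>b\<close>, and the
  function itself converges to the indicator of the interval.  A fixed test function equal to \<open>1\<close> on \<open>[a, b]\<close> gives the local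
  integrability of \<open>h\<close> that the limit requires.
\<close>

lemma weak_derivative_imp_integral:
  fixes F h :: "real \<Rightarrow> complex"
  assumes F: "continuous_on {0<..<T} F"
    and weak: "\<And>\<zeta> \<zeta>' c d. smooth \<zeta> \<Longrightarrow> (\<And>t. (\<zeta> has_real_derivative \<zeta>' t) (at t)) \<Longrightarrow> 0 < c \<Longrightarrow> d < T \<Longrightarrow>
       (\<And>t. t \<notin> {c..d} \<Longrightarrow> \<zeta> t = 0) \<Longrightarrow>
       set_integrable lborel {0<..<T} (\<lambda>t. \<zeta> t *\<^sub>R h t - \<zeta>' t *\<^sub>R F t) \<and>
       (LINT t:{0<..<T}|lborel. \<zeta> t *\<^sub>R h t - \<zeta>' t *\<^sub>R F t) = 0"
    and ab: "0 < a" "a \<le> b" "b < T"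
  shows "set_integrable lborel {a..b} h" "F b - F a = - (LINT t:{a..b}|lborel. h t)"
proof -
  obtain \<Psi> \<eta> where *: "smooth_step \<Psi> \<eta>" using smooth_step_exists by blast
  note step = smooth_stepD [OF *]
  define \<zeta> where "\<zeta> a b \<epsilon> t = \<Psi> ((t - a) / \<epsilon>) - \<Psi> ((t - b) / \<epsilon>)" for a b \<epsilon> t
  define w where "w c \<epsilon> t = \<eta> ((t - c) / \<epsilon>) / \<epsilon>" for c \<epsilon> t
  have contw: "continuous_on S (w c \<epsilon>)" for c \<epsilon> S
    unfolding w_def divide_inverse by (intro continuous_intros continuous_on_compose2 [OF smooth_imp_continuous [OF step(2)]]) auto
  have smooth: "smooth (\<zeta> a b \<epsilon>)" for a b \<epsilon>
  proof -
    have "\<zeta> a b \<epsilon> = (\<lambda>t. \<Psi> ((1 / \<epsilon>) * t + - a / \<epsilon>) + (-1) * \<Psi> ((1 / \<epsilon>) * t + - b / \<epsilon>))"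
      by (auto simp: \<zeta>_def fun_eq_iff diff_divide_distrib)
    then show ?thesis by (simp only:) (intro smooth_intros step(1))
  qed
  have deriv: "(\<zeta> a b \<epsilon> has_real_derivative w a \<epsilon> t - w b \<epsilon> t) (at t)" if "0 < \<epsilon>" for a b \<epsilon> t
  proof -
    have "((\<lambda>t. \<Psi> ((t - c) / \<epsilon>)) has_real_derivative w c \<epsilon> t) (at t)" for c
    proof -
      have "((\<lambda>t. (t - c) / \<epsilon>) has_real_derivative 1 / \<epsilon>) (at t)"
        using that by (auto intro!: derivative_eq_intros)
      from DERIV_chain2 [OF step(3) this] show ?thesis by (simp add: w_def)
    qed
    then show ?thesis unfolding \<zeta>_def by (intro DERIV_diff)
  qed
  have supp: "\<zeta> a b \<epsilon> t = 0" if "0 < \<epsilon>" "a \<le> b" "t \<notin> {a..b + \<epsilon>}" for a b \<epsilon> t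
  proof (cases "t < a")
    case True
    then show ?thesis using that by (simp add: \<zeta>_def step(4) divide_nonpos_pos)
  next
    case False
    then have "t > b + \<epsilon>" using that by auto
    then show ?thesis using that by (simp add: \<zeta>_def step(5) field_simps)
  qed
  have local: "set_integrable lborel {a..b} h" if ab: "0 < a" "a \<le> b" "b < T" for a b
  proof -
    define \<delta> where "\<delta> = min (a / 2) ((T - b) / 2)"
    have \<delta>: "0 < \<delta>" "a - \<delta> > 0" "b + \<delta> < T"
      using ab unfolding \<delta>_def by (auto simp: min_def field_simps split: if_splits)
    have "set_integrable lborel {0<..<T} (\<lambda>t. \<zeta> (a - \<delta>) b \<delta> t *\<^sub>R h t - (w (a - \<delta>) \<delta> t - w b \<delta> t) *\<^sub>R F t)"
      by (rule conjunct1 [OF weak [OF smooth deriv [OF \<delta>(1)] \<delta>(2) \<delta>(3) supp]]) (use \<delta> ab in auto)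
    then have "set_integrable lborel {a..b} (\<lambda>t. \<zeta> (a - \<delta>) b \<delta> t *\<^sub>R h t - (w (a - \<delta>) \<delta> t - w b \<delta> t) *\<^sub>R F t)"
      by (rule set_integrable_subset) (use ab in auto)
    moreover have "set_integrable lborel {a..b} (\<lambda>t. (w (a - \<delta>) \<delta> t - w b \<delta> t) *\<^sub>R F t)"
      by (intro borel_integrable_atLeastAtMost' continuous_intros contw continuous_on_subset [OF F]) (use ab in auto)
    ultimately have "set_integrable lborel {a..b} (\<lambda>t. \<zeta> (a - \<delta>) b \<delta> t *\<^sub>R h t)"
      using set_integral_add(1) by fastforce
    moreover have "\<zeta> (a - \<delta>) b \<delta> t = 1" if "t \<in> {a..b}" for t
      using that \<delta>(1) by (simp add: \<zeta>_def step(4) step(5) divide_nonpos_pos)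
    ultimately have "set_integrable lborel {a..b} (\<lambda>t. \<zeta> (a - \<delta>) b \<delta> t *\<^sub>R h t)"
      and "indicator {a..b} t *\<^sub>R \<zeta> (a - \<delta>) b \<delta> t *\<^sub>R h t = indicator {a..b} t *\<^sub>R h t" for t
      by (auto simp: indicator_def)
    then show ?thesis by (simp only: set_integrable_def)
  qed
  show h_int: "set_integrable lborel {a..b} h" by (rule local [OF ab])
  define \<delta> where "\<delta> = (T - b) / 2"
  define e where "e = b + \<delta>"
  have \<delta>: "0 < \<delta>" "e < T" "b < e" using ab by (auto simp: \<delta>_def e_def field_simps)
  define \<epsilon> where "\<epsilon> n = \<delta> / real (Suc n)" for n
  have \<epsilon>: "0 < \<epsilon> n" "\<epsilon> n \<le> \<delta>" for n
    using \<delta>(1) by (simp_all add: \<epsilon>_def field_simps)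
  have \<epsilon>_lim: "\<epsilon> \<longlonglongrightarrow> 0"
    unfolding \<epsilon>_def by (rule LIMSEQ_Suc [OF lim_const_over_n])
  have FJ: "continuous_on {a..e} F"
    by (rule continuous_on_subset [OF F]) (use ab \<delta> in auto)
  have hJ: "set_integrable lborel {a..e} h"
    by (rule local) (use ab \<delta> in auto)
  have lim_w: "(\<lambda>n. LINT t:{a..e}|lborel. w c (\<epsilon> n) t *\<^sub>R F t) \<longlonglongrightarrow> F c" if "a \<le> c" "c \<le> b" for c
    unfolding w_def
    by (rule approximate_identity_tendsto [OF * FJ])
       (use that \<delta> \<epsilon> \<epsilon>_lim e_def in \<open>auto intro: add_mono\<close>)
  have w_int: "set_integrable lborel {a..e} (\<lambda>t. w c (\<epsilon> n) t *\<^sub>R F t)" for c n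
    by (intro borel_integrable_atLeastAtMost' continuous_intros contw FJ)
  have \<zeta>_meas [measurable]: "\<zeta> a b (\<epsilon> n) \<in> borel_measurable borel" for n
    by (intro borel_measurable_continuous_onI smooth_imp_continuous smooth)
  have \<zeta>_bound: "\<bar>\<zeta> a b (\<epsilon> n) t\<bar> \<le> 1" for n t
    using step(6,7) [of "(t - a) / \<epsilon> n"] step(6,7) [of "(t - b) / \<epsilon> n"] unfolding \<zeta>_def by linarith
  have h_meas: "(\<lambda>t. indicator {a..e} t *\<^sub>R h t) \<in> borel_measurable lborel"
    using hJ unfolding set_integrable_def by (rule borel_measurable_integrable)
  have \<zeta>h_int: "set_integrable lborel {a..e} (\<lambda>t. \<zeta> a b (\<epsilon> n) t *\<^sub>R h t)" for n
    unfolding set_integrable_def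
  proof (rule Bochner_Integration.integrable_bound [OF hJ [unfolded set_integrable_def]])
    have "(\<lambda>t. \<zeta> a b (\<epsilon> n) t *\<^sub>R (indicator {a..e} t *\<^sub>R h t)) \<in> borel_measurable lborel"
      by (intro borel_measurable_scaleR h_meas) simp
    then show "(\<lambda>t. indicator {a..e} t *\<^sub>R \<zeta> a b (\<epsilon> n) t *\<^sub>R h t) \<in> borel_measurable lborel"
      by (simp add: mult.commute)
    show "AE t in lborel. norm (indicator {a..e} t *\<^sub>R \<zeta> a b (\<epsilon> n) t *\<^sub>R h t) \<le> norm (indicator {a..e} t *\<^sub>R h t)"
      using \<zeta>_bound [of n] by (auto simp: indicator_def mult_left_le_one_le)
  qed
  have eq: "(LINT t:{a..e}|lborel. \<zeta> a b (\<epsilon> n) t *\<^sub>R h t) =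
     (LINT t:{a..e}|lborel. w a (\<epsilon> n) t *\<^sub>R F t) - (LINT t:{a..e}|lborel. w b (\<epsilon> n) t *\<^sub>R F t)" for n
  proof -
    let ?I = "\<lambda>t. \<zeta> a b (\<epsilon> n) t *\<^sub>R h t - (w a (\<epsilon> n) t - w b (\<epsilon> n) t) *\<^sub>R F t"
    have e: "b + \<epsilon> n \<le> e" using \<epsilon>(2) [of n] by (simp add: e_def)
    have "(LINT t:{0<..<T}|lborel. ?I t) = 0"
      using weak [OF smooth deriv [OF \<epsilon>(1)], of a "b + \<epsilon> n" a b n] supp [OF \<epsilon>(1) ab(2)] ab e \<delta> by auto
    moreover have "(LINT t:{0<..<T}|lborel. ?I t) = (LINT t:{a..e}|lborel. ?I t)"
      unfolding set_lebesgue_integral_def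
    proof (intro Bochner_Integration.integral_cong refl)
      fix t
      show "indicator {0<..<T} t *\<^sub>R ?I t = indicator {a..e} t *\<^sub>R ?I t"
      proof (cases "t \<in> {a..e}")
        case False
        have "w c (\<epsilon> n) t = 0" if "a \<le> c" "c \<le> b" for c
        proof -
          have "(t - c) / \<epsilon> n \<notin> {0..1}"
            using False that e \<epsilon>(1) [of n] by (auto simp: field_simps)
          then show ?thesis by (simp add: w_def step(9))
        qed
        moreover have "\<zeta> a b (\<epsilon> n) t = 0"
          by (rule supp [OF \<epsilon>(1) ab(2)]) (use False e in auto)
        ultimately have "?I t = 0" using ab by simp
        then show ?thesis by (simp only: scaleR_zero_right)
      qed (use ab \<delta> in \<open>auto simp: indicator_def\<close>)
    qed
    moreover have "(LINT t:{a..e}|lborel. ?I t) = (LINT t:{a..e}|lborel. \<zeta> a b (\<epsilon> n) t *\<^sub>R h t) -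
        ((LINT t:{a..e}|lborel. w a (\<epsilon> n) t *\<^sub>R F t) - (LINT t:{a..e}|lborel. w b (\<epsilon> n) t *\<^sub>R F t))"
      unfolding scaleR_diff_left
      using set_integral_diff [OF \<zeta>h_int [of n] set_integral_diff(1) [OF w_int [of a n] w_int [of b n]]]
        set_integral_diff(2) [OF w_int [of a n] w_int [of b n]] by simp
    ultimately show ?thesis by simp
  qed
  have "(\<lambda>n. LINT t:{a..e}|lborel. \<zeta> a b (\<epsilon> n) t *\<^sub>R h t) \<longlonglongrightarrow> F a - F b"
    unfolding eq using ab by (intro tendsto_diff lim_w) auto
  moreover have "(\<lambda>n. LINT t:{a..e}|lborel. \<zeta> a b (\<epsilon> n) t *\<^sub>R h t) \<longlonglongrightarrow> (LINT t|lborel. indicator {a<..b} t *\<^sub>R h t)"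
    unfolding set_lebesgue_integral_def
  proof (rule integral_dominated_convergence)
    show "integrable lborel (\<lambda>t. norm (indicator {a..e} t *\<^sub>R h t))"
      using hJ unfolding set_integrable_def by (rule integrable_norm)
    show "(\<lambda>t. indicator {a..e} t *\<^sub>R \<zeta> a b (\<epsilon> n) t *\<^sub>R h t) \<in> borel_measurable lborel" for n
      using \<zeta>h_int [of n] unfolding set_integrable_def by (rule borel_measurable_integrable)
    have "set_integrable lborel {a<..b} h"
      by (rule set_integrable_subset [OF h_int]) auto
    then show "(\<lambda>t. indicator {a<..b} t *\<^sub>R h t) \<in> borel_measurable lborel"
      unfolding set_integrable_def by (rule borel_measurable_integrable)
    show "AE t in lborel. norm (indicator {a..e} t *\<^sub>R \<zeta> a b (\<epsilon> n) t *\<^sub>R h t) \<le> norm (indicator {a..e} t *\<^sub>R h t)" for n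
      using \<zeta>_bound [of n] by (auto simp: indicator_def mult_left_le_one_le)
    show "AE t in lborel. (\<lambda>n. indicator {a..e} t *\<^sub>R \<zeta> a b (\<epsilon> n) t *\<^sub>R h t) \<longlonglongrightarrow> indicator {a<..b} t *\<^sub>R h t"
    proof (intro AE_I2)
      fix t :: real
      have one: "eventually (\<lambda>n. \<Psi> ((t - c) / \<epsilon> n) = 1) sequentially" if "c < t" for c
      proof -
        have "eventually (\<lambda>n. \<epsilon> n < t - c) sequentially"
          using \<epsilon>_lim that by (intro order_tendstoD) auto
        then show ?thesis
        proof eventually_elim
          case (elim n)
          then show ?case using \<epsilon>(1) [of n] by (intro step(5)) (simp add: field_simps)
        qed
      qed
      have zero: "\<Psi> ((t - c) / \<epsilon> n) = 0" if "t \<le> c" for c n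
        using that \<epsilon>(1) [of n] by (intro step(4)) (simp add: divide_nonpos_pos)
      have "eventually (\<lambda>n. indicator {a..e} t *\<^sub>R \<zeta> a b (\<epsilon> n) t *\<^sub>R h t = indicator {a<..b} t *\<^sub>R h t) sequentially"
      proof -
        consider "t \<le> a" | "a < t" "t \<le> b" | "b < t" by linarith
        then show ?thesis
        proof cases
          case 1
          then show ?thesis using ab by (simp add: \<zeta>_def zero)
        next
          case 2
          then show ?thesis using one [of a] \<delta> by (auto elim!: eventually_mono simp: \<zeta>_def zero)
        next
          case 3
          then have "eventually (\<lambda>n. \<Psi> ((t - a) / \<epsilon> n) = 1 \<and> \<Psi> ((t - b) / \<epsilon> n) = 1) sequentially"
            using one [of a] one [of b] ab by (intro eventually_conj) auto
          then show ?thesis using 3 by (auto elim!: eventually_mono simp: \<zeta>_def)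
        qed
      qed
      then show "(\<lambda>n. indicator {a..e} t *\<^sub>R \<zeta> a b (\<epsilon> n) t *\<^sub>R h t) \<longlonglongrightarrow> indicator {a<..b} t *\<^sub>R h t"
        by (rule tendsto_eventually)
    qed
  qed
  ultimately have "F a - F b = (LINT t|lborel. indicator {a<..b} t *\<^sub>R h t)"
    by (rule LIMSEQ_unique)
  also have "\<dots> = (LINT t:{a..b}|lborel. h t)"
    unfolding set_lebesgue_integral_def
  proof (rule integral_cong_AE)
    show "(\<lambda>t. indicator {a..b} t *\<^sub>R h t) \<in> borel_measurable lborel"
      using h_int unfolding set_integrable_def by (rule borel_measurable_integrable)
    have "set_integrable lborel {a<..b} h"
      by (rule set_integrable_subset [OF h_int]) auto
    then show "(\<lambda>t. indicator {a<..b} t *\<^sub>R h t) \<in> borel_measurable lborel"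
      unfolding set_integrable_def by (rule borel_measurable_integrable)
    show "AE t in lborel. indicator {a<..b} t *\<^sub>R h t = indicator {a..b} t *\<^sub>R h t"
      using AE_lborel_singleton [of a] by eventually_elim (auto simp: indicator_def)
  qed
  finally show "F b - F a = - (LINT t:{a..b}|lborel. h t)" by (simp add: algebra_simps)
qed

text \<open>
  The function \<open>F\<close> has a derivative only almost everywhere, so the rule comes from Fubini's theorem for
  \<open>G'(t) \<phi>(\<tau>)\<close> on the triangle \<open>\<tau> \<le> t\<close>.
\<close>

lemma product_rule_absolutely_continuous:
  fixes F G \<phi> G' :: "real \<Rightarrow> complex"
  assumes ab: "a \<le> b" and \<phi>: "set_integrable lborel {a..b} \<phi>"
    and F: "\<And>t. t \<in> {a..b} \<Longrightarrow> F t - F a = (LINT \<tau>:{a..t}|lborel. \<phi> \<tau>)" "continuous_on {a..b} F"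
    and G: "\<And>t. t \<in> {a..b} \<Longrightarrow> (G has_vector_derivative G' t) (at t within {a..b})" "continuous_on {a..b} G'"
  shows "set_integrable lborel {a..b} (\<lambda>t. G' t * F t + G t * \<phi> t)"
    and "G b * F b - G a * F a = (LINT t:{a..b}|lborel. G' t * F t + G t * \<phi> t)"
proof -
  have contG: "continuous_on {a..b} G"
    by (rule continuous_on_vector_derivative [OF G(1)])
  define g where "g t = indicator {a..b} t *\<^sub>R G' t" for t
  define f where "f t = indicator {a..b} t *\<^sub>R \<phi> t" for t
  have g: "integrable lborel g" and f: "integrable lborel f"
    using borel_integrable_atLeastAtMost' [OF G(2)] \<phi> unfolding g_def f_def set_integrable_def by auto
  have [measurable]: "g \<in> borel_measurable borel" "f \<in> borel_measurable borel"
    using g f by (auto dest: borel_measurable_integrable)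
  \<comment> \<open>Integrated over \<open>\<tau>\<close> first, \<open>k\<close> produces increments of \<open>F\<close>; over \<open>t\<close> first, increments of \<open>G\<close>.\<close>
  define k where "k t \<tau> = (if \<tau> \<le> t then g t * f \<tau> else 0)" for t \<tau>
  have [measurable]: "(\<lambda>(t, \<tau>). k t \<tau>) \<in> borel_measurable (lborel \<Otimes>\<^sub>M lborel)"
    unfolding k_def by measurable
  have prod_int: "integrable (lborel \<Otimes>\<^sub>M lborel) (\<lambda>(t, \<tau>). g t * f \<tau>)"
  proof (rule lborel_pair.Fubini_integrable)
    show "(\<lambda>(t, \<tau>). g t * f \<tau>) \<in> borel_measurable (lborel \<Otimes>\<^sub>M lborel)" by measurable
    show "integrable lborel (\<lambda>t. LINT \<tau>|lborel. norm (case (t, \<tau>) of (t, \<tau>) \<Rightarrow> g t * f \<tau>))"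
      using g by (simp add: norm_mult)
    show "AE t in lborel. integrable lborel (\<lambda>\<tau>. case (t, \<tau>) of (t, \<tau>) \<Rightarrow> g t * f \<tau>)"
      using f by simp
  qed
  have k_int: "integrable (lborel \<Otimes>\<^sub>M lborel) (\<lambda>(t, \<tau>). k t \<tau>)"
    by (rule Bochner_Integration.integrable_bound [OF prod_int]) (auto simp: k_def)
  have swap: "(LINT t|lborel. LINT \<tau>|lborel. k t \<tau>) = (LINT \<tau>|lborel. LINT t|lborel. k t \<tau>)"
    using lborel_pair.Fubini_integral [OF k_int] by simp
  have inner1: "(LINT \<tau>|lborel. k t \<tau>) = g t * (F t - F a)" for t
  proof (cases "t \<in> {a..b}")
    case True
    have "k t \<tau> = g t * (indicator {a..t} \<tau> *\<^sub>R \<phi> \<tau>)" for \<tau>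
      using True by (auto simp: k_def f_def indicator_def)
    then show ?thesis
      using F(1) [OF True] unfolding set_lebesgue_integral_def by (simp only: integral_mult_right_zero)
  next
    case False
    then have g0: "g t = 0" by (simp add: g_def)
    then have "k t \<tau> = 0" for \<tau> by (simp add: k_def)
    then show ?thesis by (simp add: g0)
  qed
  have inner2: "(LINT t|lborel. k t \<tau>) = f \<tau> * (G b - G \<tau>)" for \<tau>
  proof (cases "\<tau> \<in> {a..b}")
    case True
    have "k t \<tau> = f \<tau> * (indicator {\<tau>..b} t *\<^sub>R G' t)" for t
      using True by (auto simp: k_def g_def f_def indicator_def)
    moreover have "(LINT t|lborel. indicator {\<tau>..b} t *\<^sub>R G' t) = G b - G \<tau>"
      by (rule integral_FTC_atLeastAtMost)
        (use True in \<open>auto intro!: continuous_on_subset [OF G(2)] has_vector_derivative_within_subset [OF G(1)]\<close>)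
    ultimately show ?thesis by (simp only: integral_mult_right_zero)
  next
    case False
    then have f0: "f \<tau> = 0" by (simp add: f_def)
    then have "k t \<tau> = 0" for t by (simp add: k_def)
    then show ?thesis by (simp add: f0)
  qed
  have GF: "set_integrable lborel {a..b} (\<lambda>t. G' t * F t)" "set_integrable lborel {a..b} G'"
    by (intro borel_integrable_atLeastAtMost' continuous_intros G(2) F(2))+
  have G\<phi>: "set_integrable lborel {a..b} (\<lambda>t. G t * \<phi> t)"
  proof -
    obtain K where K: "\<forall>t\<in>{a..b}. norm (G t) \<le> K"
      using compact_imp_bounded [OF compact_continuous_image [OF contG compact_Icc]]
      unfolding bounded_iff by auto
    have meas: "(\<lambda>t. indicator {a..b} t *\<^sub>R G t) \<in> borel_measurable lborel"
      using borel_integrable_atLeastAtMost' [OF contG] unfolding set_integrable_def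
      by (rule borel_measurable_integrable)
    have eq: "indicator {a..b} t *\<^sub>R (G t * \<phi> t) = (indicator {a..b} t *\<^sub>R G t) * f t" for t
      by (simp add: f_def indicator_def)
    show ?thesis
      unfolding set_integrable_def eq
    proof (rule Bochner_Integration.integrable_bound)
      show "integrable lborel (\<lambda>t. of_real K * f t)" using f by simp
      show "(\<lambda>t. (indicator {a..b} t *\<^sub>R G t) * f t) \<in> borel_measurable lborel"
        by (rule borel_measurable_times [OF meas borel_measurable_integrable [OF f]])
      show "AE t in lborel. norm ((indicator {a..b} t *\<^sub>R G t) * f t) \<le> norm (of_real K * f t)"
      proof (intro AE_I2)
        fix t
        have "norm (G t) \<le> \<bar>K\<bar>" if "t \<in> {a..b}" using bspec [OF K that] by linarith
        then show "norm ((indicator {a..b} t *\<^sub>R G t) * f t) \<le> norm (of_real K * f t)"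
          by (auto simp: f_def indicator_def norm_mult intro!: mult_right_mono)
      qed
    qed
  qed
  show "set_integrable lborel {a..b} (\<lambda>t. G' t * F t + G t * \<phi> t)"
    by (intro set_integral_add GF G\<phi>)
  have int_G': "(LINT t:{a..b}|lborel. G' t) = G b - G a"
    unfolding set_lebesgue_integral_def by (intro integral_FTC_atLeastAtMost ab G) auto
  have int_\<phi>: "(LINT t:{a..b}|lborel. \<phi> t) = F b - F a"
    using F(1) [of b] ab by simp
  have "(LINT t:{a..b}|lborel. G' t * F t) - (G b - G a) * F a = (LINT t|lborel. g t * (F t - F a))"
  proof -
    have "(LINT t|lborel. g t * (F t - F a)) = (LINT t:{a..b}|lborel. G' t * F t - G' t * F a)"
      by (simp add: set_lebesgue_integral_def g_def algebra_simps)
    also have "\<dots> = (LINT t:{a..b}|lborel. G' t * F t) - (LINT t:{a..b}|lborel. G' t * F a)"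
      by (intro set_integral_diff GF set_integrable_mult_left)
    finally show ?thesis by (simp add: int_G')
  qed
  also have "\<dots> = (LINT \<tau>|lborel. f \<tau> * (G b - G \<tau>))"
    using swap unfolding inner1 inner2 .
  also have "\<dots> = (LINT \<tau>:{a..b}|lborel. \<phi> \<tau> * G b - G \<tau> * \<phi> \<tau>)"
    by (simp add: set_lebesgue_integral_def f_def algebra_simps)
  also have "\<dots> = (F b - F a) * G b - (LINT \<tau>:{a..b}|lborel. G \<tau> * \<phi> \<tau>)"
  proof -
    have "set_integrable lborel {a..b} (\<lambda>\<tau>. \<phi> \<tau> * G b)" by (rule set_integrable_mult_left) (rule \<phi>)
    from set_integral_diff(2) [OF this G\<phi>] show ?thesis by (simp add: int_\<phi>)
  qed
  finally show "G b * F b - G a * F a = (LINT t:{a..b}|lborel. G' t * F t + G t * \<phi> t)"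
    using set_integral_add(2) [OF GF(1) G\<phi>] by (simp add: algebra_simps)
qed

section \<open>The Fokker-Planck equation, frequency by frequency\<close>

lemma C_k_add: "C_k k f \<Longrightarrow> C_k k g \<Longrightarrow> C_k k (\<lambda>x. f x + g x)"
proof (induction k arbitrary: f g)
  case (Suc k)
  have "(\<lambda>x. frechet_derivative (\<lambda>x. f x + g x) (at x) b) =
        (\<lambda>x. frechet_derivative f (at x) b + frechet_derivative g (at x) b)" for b
  proof
    fix x
    have "(f has_derivative frechet_derivative f (at x)) (at x)" "(g has_derivative frechet_derivative g (at x)) (at x)"
      using Suc.prems by (simp_all flip: frechet_derivative_works)
    from frechet_derivative_at [OF has_derivative_add [OF this]]
    show "frechet_derivative (\<lambda>x. f x + g x) (at x) b = frechet_derivative f (at x) b + frechet_derivative g (at x) b"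
      by (metis (no_types))
  qed
  then show ?case using Suc by (auto intro: differentiable_add)
qed (auto intro: continuous_intros)

lemma has_derivative_character:
  "(character p has_derivative (\<lambda>h. 2 * pi * \<i> * of_real (int_vec p \<bullet> h) * character p x)) (at x)"
proof -
  have "((\<lambda>x. cis (2 * pi * (int_vec p \<bullet> x))) has_derivative
     (\<lambda>h. (2 * pi * (int_vec p \<bullet> h)) *\<^sub>R (\<i> * cis (2 * pi * (int_vec p \<bullet> x))))) (at x)"
    by (auto intro!: derivative_eq_intros)
  then show ?thesis
    by (simp add: character_def [abs_def] scaleR_conv_of_real mult_ac)
qed

lemma has_derivative_Re_character:
  "((\<lambda>x. Re (z * character p x)) has_derivative (\<lambda>h. Re (z * (2 * pi * \<i>) * character p x) * (int_vec p \<bullet> h))) (at x)"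
proof -
  have "((\<lambda>x. Re (z * character p x)) has_derivative (\<lambda>h. Re (z * (2 * pi * \<i> * of_real (int_vec p \<bullet> h) * character p x)))) (at x)"
    by (intro derivative_intros has_derivative_Re has_derivative_character)
  moreover have "Re (z * (2 * pi * \<i> * of_real (int_vec p \<bullet> h) * character p x)) =
     Re (z * (2 * pi * \<i>) * character p x) * (int_vec p \<bullet> h)" for h
  proof -
    have "z * (2 * pi * \<i> * of_real (int_vec p \<bullet> h) * character p x) =
      of_real (int_vec p \<bullet> h) * (z * (2 * pi * \<i>) * character p x)" by (simp only: mult_ac)
    then show ?thesis by (simp only: Re_of_real_mult mult.commute)
  qed
  ultimately show ?thesis by simp
qed

text \<open>
  Every partial derivative of such a function is a sum of two functions of the same form, with another cut-off or
  another constant \<open>c\<close>.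
\<close>

lemma C_k_time_character:
  fixes p :: "int ^ 'd"
  assumes "smooth \<zeta>"
  shows "C_k k (\<lambda>z :: (real ^ 'd) \<times> real. \<zeta> (snd z) * Re (c * character p (fst z)))"
  using assms
proof (induction k arbitrary: \<zeta> c)
  case 0
  then show ?case
    by (auto intro!: continuous_intros continuous_on_compose2 [OF smooth_imp_continuous [OF 0, of UNIV]])
next
  case (Suc k)
  obtain \<zeta>' where \<zeta>': "\<And>t. (\<zeta> has_real_derivative \<zeta>' t) (at t)" "smooth \<zeta>'"
    using smooth_deriv_ex [OF Suc.prems] by auto
  let ?f = "\<lambda>z :: (real ^ 'd) \<times> real. \<zeta> (snd z) * Re (c * character p (fst z))"
  have D: "(?f has_derivative (\<lambda>h. \<zeta> (snd z) * (Re (c * (2 * pi * \<i>) * character p (fst z)) * (int_vec p \<bullet> fst h)) +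
      (\<zeta>' (snd z) * snd h) * Re (c * character p (fst z)))) (at z)" for z
  proof (rule has_derivative_mult)
    show "((\<lambda>z :: (real ^ 'd) \<times> real. \<zeta> (snd z)) has_derivative (\<lambda>h. \<zeta>' (snd z) * snd h)) (at z)"
      by (rule has_derivative_compose [OF _ \<zeta>'(1) [unfolded has_field_derivative_def]]) (auto intro!: derivative_eq_intros)
    show "((\<lambda>z :: (real ^ 'd) \<times> real. Re (c * character p (fst z))) has_derivative
       (\<lambda>h. Re (c * (2 * pi * \<i>) * character p (fst z)) * (int_vec p \<bullet> fst h))) (at z)"
      by (rule has_derivative_compose [OF _ has_derivative_Re_character]) (auto intro!: derivative_eq_intros)
  qed
  have "C_k k (\<lambda>z. frechet_derivative ?f (at z) b)" for b
  proof -
    have "frechet_derivative ?f (at z) b =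
       \<zeta> (snd z) * Re ((of_real (int_vec p \<bullet> fst b) * (c * (2 * pi * \<i>))) * character p (fst z)) +
       \<zeta>' (snd z) * Re ((of_real (snd b) * c) * character p (fst z))" for z
      unfolding frechet_derivative_at [OF D, symmetric] mult.assoc [of "of_real _"] Re_of_real_mult
      by (simp add: mult_ac)
    then show ?thesis
      by (simp only:) (intro C_k_add Suc.IH Suc.prems \<zeta>'(2))
  qed
  then show ?case using D differentiable_def by (simp only: C_k.simps) blast
qed

lemma fourier_coeff_Re_character:
  "fourier_coeff (\<lambda>x. of_real (Re (z * character p x))) k =
     ((if k = p then z else 0) + (if k = - p then cnj z else 0)) / 2"
proof -
  have Re: "of_real (Re w) = (w + cnj w) / 2" for w by (simp add: complex_add_cnj)
  have int: "(LINT x|haar. character l x * cnj (character k x)) = (if k = l then 1 else 0)" for l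
    using integral_haar_character [of "l - k"] by (auto simp add: character_diff)
  have "fourier_coeff (\<lambda>x. of_real (Re (z * character p x))) k =
        (LINT x|haar. of_real (Re (z * character p x)) * cnj (character k x))"
    unfolding fourier_coeff_def
    by (intro set_integral_cell borel_measurable_continuous_onI continuous_intros)
  also have "\<dots> = (LINT x|haar. (z / 2) * (character p x * cnj (character k x)) + (cnj z / 2) * (character (- p) x * cnj (character k x)))"
    unfolding Re by (intro Bochner_Integration.integral_cong) (simp_all add: field_simps)
  also have "\<dots> = (LINT x|haar. (z / 2) * (character p x * cnj (character k x))) + (LINT x|haar. (cnj z / 2) * (character (- p) x * cnj (character k x)))"
    by (intro Bochner_Integration.integral_add integrable_haar_continuous continuous_intros)
  also have "\<dots> = (z / 2) * (if k = p then 1 else 0) + (cnj z / 2) * (if k = - p then 1 else 0)"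
    by (simp only: integral_mult_right_zero int)
  finally show ?thesis by (simp add: add_divide_distrib)
qed

text \<open>
  The partial Fourier sums are exact as soon as they contain both \<open>p\<close> and \<open>- p\<close>.
\<close>

lemma frac_laplacian_character:
  "frac_laplacian s (\<lambda>x. Re (z * character p x)) (\<lambda>x. frac_symbol s p * Re (z * character p x))"
  unfolding frac_laplacian_def
proof (intro conjI)
  show "continuous_on UNIV (\<lambda>x. frac_symbol s p * Re (z * character p x))" by (intro continuous_intros)
  show "periodic (\<lambda>x. frac_symbol s p * Re (z * character p x))"
    using periodic_character [of p] by (simp add: periodic_def)
  have split: "A * (((if P then w else 0) + (if Q then v else 0)) / 2) * B =
      (if P then A * (w / 2) * B else 0) + (if Q then A * (v / 2) * B else 0)" for A B w v :: complex and P Q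
    by (cases P; cases Q) (simp_all add: algebra_simps add_divide_distrib)
  let ?S = "\<lambda>F x. of_real ((2 * pi) powr (2 * s)) * (\<Sum>k\<in>F. of_real (norm (int_vec k) powr (2 * s)) *
               fourier_coeff (\<lambda>x. of_real (Re (z * character p x))) k * character k x)"
  have "?S F x = of_real (frac_symbol s p * Re (z * character p x))" if F: "finite F" "{p, - p} \<subseteq> F" for F x
  proof -
    have "(\<Sum>k\<in>F. of_real (norm (int_vec k) powr (2 * s)) *
               fourier_coeff (\<lambda>x. of_real (Re (z * character p x))) k * character k x) =
      (\<Sum>k\<in>F. if k = p then of_real (norm (int_vec k) powr (2 * s)) * (z / 2) * character k x else 0) +
      (\<Sum>k\<in>F. if k = - p then of_real (norm (int_vec k) powr (2 * s)) * (cnj z / 2) * character k x else 0)"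
      unfolding sum.distrib [symmetric] fourier_coeff_Re_character by (intro sum.cong refl split)
    also have "\<dots> = of_real (norm (int_vec p) powr (2 * s)) * ((z * character p x + cnj (z * character p x)) / 2)"
      using F by (simp add: algebra_simps add_divide_distrib)
    also have "(z * character p x + cnj (z * character p x)) / 2 = of_real (Re (z * character p x))"
      by (simp only: complex_add_cnj) simp
    finally show ?thesis by (simp add: frac_symbol_def)
  qed
  then have "eventually (\<lambda>F. (LINT x:cell|lborel. (cmod (of_real (frac_symbol s p * Re (z * character p x)) - ?S F x))\<^sup>2) = 0)
     (finite_subsets_at_top UNIV)"
    unfolding eventually_finite_subsets_at_top by (intro exI [of _ "{p, - p}"]) (auto simp: set_lebesgue_integral_def)
  then show "((\<lambda>F. LINT x:cell|lborel. (cmod (of_real (frac_symbol s p * Re (z * character p x)) - ?S F x))\<^sup>2) \<longlongrightarrow> 0)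
     (finite_subsets_at_top UNIV)"
    by (rule tendsto_eventually)
qed

lemma set_integral_complexI:
  fixes W :: "real \<Rightarrow> complex"
  assumes "set_integrable M A (\<lambda>t. Re (W t))" "(LINT t:A|M. Re (W t)) = 0"
    and "set_integrable M A (\<lambda>t. Im (W t))" "(LINT t:A|M. Im (W t)) = 0"
  shows "set_integrable M A W \<and> (LINT t:A|M. W t) = 0"
proof -
  have eq: "indicator A t *\<^sub>R W t = of_real (indicator A t *\<^sub>R Re (W t)) + \<i> * of_real (indicator A t *\<^sub>R Im (W t))" for t
    by (simp add: complex_eq_iff)
  have "integrable M (\<lambda>t. of_real (indicator A t *\<^sub>R Re (W t)) :: complex)"
    "integrable M (\<lambda>t. of_real (indicator A t *\<^sub>R Im (W t)) :: complex)"
    by (rule integrable_of_real, rule assms [unfolded set_integrable_def])+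
  then show ?thesis
    using assms(2,4) unfolding set_integrable_def set_lebesgue_integral_def eq
    by (simp del: of_real_mult real_scaleR_def scaleR_conv_of_real)
qed

text \<open>
  Testing with a cut-off in time times the real part of \<open>z e\<^sub>p\<close>, for \<open>z = 1\<close> and \<open>z = - \<i>\<close>, turns the
  distributional equation into a weak equation in time for the Fourier coefficient of \<open>m\<close>.
\<close>

lemma fokker_planck_mode:
  fixes b :: "real ^ 'd \<Rightarrow> real \<Rightarrow> real ^ 'd" and p :: "int ^ 'd"
  assumes fp: "solves_fokker_planck s T b m"
    and m: "\<And>t. t \<in> {0<..<T} \<Longrightarrow> m t \<in> prob_torus"
    and cont: "continuous_on {0<..<T} (\<lambda>t. LINT x|m t. character p x)"
    and b: "\<And>t. t \<in> {0<..<T} \<Longrightarrow> integrable (m t) (\<lambda>x. b x t)"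
    and ab: "0 < t0" "t0 \<le> t1" "t1 < T"
  defines "F \<equiv> \<lambda>t. LINT x|m t. character p x"
  defines "h \<equiv> \<lambda>t. of_real (frac_symbol s p) * F t + 2 * pi * \<i> * (LINT x|m t. of_real (b x t \<bullet> int_vec p) * character p x)"
  shows "set_integrable lborel {t0..t1} h" "F t1 - F t0 = - (LINT t:{t0..t1}|lborel. h t)"
proof -
  have weak: "set_integrable lborel {0<..<T} (\<lambda>t. \<zeta> t *\<^sub>R h t - \<zeta>' t *\<^sub>R F t) \<and>
       (LINT t:{0<..<T}|lborel. \<zeta> t *\<^sub>R h t - \<zeta>' t *\<^sub>R F t) = 0"
    if \<zeta>: "smooth \<zeta>" "\<And>t. (\<zeta> has_real_derivative \<zeta>' t) (at t)" "0 < c" "d < T" "\<And>t. t \<notin> {c..d} \<Longrightarrow> \<zeta> t = 0"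
    for \<zeta> \<zeta>' c d
  proof -
    have main: "set_integrable lborel {0<..<T} (\<lambda>t. Re (z * (\<zeta> t *\<^sub>R h t - \<zeta>' t *\<^sub>R F t))) \<and>
       (LINT t:{0<..<T}|lborel. Re (z * (\<zeta> t *\<^sub>R h t - \<zeta>' t *\<^sub>R F t))) = 0" for z
    proof -
      define \<phi> where "\<phi> y = \<zeta> (snd y) * Re (z * character p (fst y))" for y :: "(real ^ 'd) \<times> real"
      define \<psi> where "\<psi> x t = frac_symbol s p * Re ((of_real (\<zeta> t) * z) * character p x)" for x t
      define I where "I t = (LINT x|m t. - vector_derivative (\<lambda>\<tau>. \<phi> (x, \<tau>)) (at t) + \<psi> x t + b x t \<bullet> grad (\<lambda>y. \<phi> (y, t)) x)" for t
      have "test_function T \<phi>"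
        unfolding test_function_def
      proof (intro conjI allI)
        show "C_k k \<phi>" for k unfolding \<phi>_def by (rule C_k_time_character [OF \<zeta>(1)])
        show "periodic (\<lambda>x. \<phi> (x, t))" for t
          using periodic_character [of p] by (simp add: periodic_def \<phi>_def)
        show "\<exists>a b. 0 < a \<and> b < T \<and> (\<forall>x t. t \<notin> {a..b} \<longrightarrow> \<phi> (x, t) = 0)"
          using \<zeta>(3-5) by (intro exI [of _ c] exI [of _ d]) (auto simp: \<phi>_def)
      qed
      moreover have "frac_laplacian s (\<lambda>x. \<phi> (x, t)) (\<lambda>x. \<psi> x t)" for t
        using frac_laplacian_character [of s "of_real (\<zeta> t) * z" p]
        unfolding \<phi>_def \<psi>_def fst_conv snd_conv mult.assoc [of "of_real _"] Re_of_real_mult .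
      ultimately have I: "set_integrable lborel {0<..<T} I" "(LINT t:{0<..<T}|lborel. I t) = 0"
        using fp unfolding solves_fokker_planck_def I_def Let_def by blast+
      have I_eq: "I t = Re (z * (\<zeta> t *\<^sub>R h t - \<zeta>' t *\<^sub>R F t))" if t: "t \<in> {0<..<T}" for t
      proof -
        define K where "K x = of_real (- \<zeta>' t + frac_symbol s p * \<zeta> t) * character p x +
            of_real (\<zeta> t) * (2 * pi * \<i>) * (of_real (b x t \<bullet> int_vec p) * character p x)" for x
        have "vector_derivative (\<lambda>\<tau>. \<phi> (x, \<tau>)) (at t) = \<zeta>' t * Re (z * character p x)" for x
        proof (rule vector_derivative_at)
          have "((\<lambda>\<tau>. \<phi> (x, \<tau>)) has_real_derivative \<zeta>' t * Re (z * character p x)) (at t)"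
            unfolding \<phi>_def fst_conv snd_conv by (intro DERIV_cmult_right \<zeta>(2))
          then show "((\<lambda>\<tau>. \<phi> (x, \<tau>)) has_vector_derivative \<zeta>' t * Re (z * character p x)) (at t)"
            by (simp only: has_real_derivative_iff_has_vector_derivative)
        qed
        moreover have "grad (\<lambda>y. \<phi> (y, t)) x = (\<zeta> t * Re (z * (2 * pi * \<i>) * character p x)) *\<^sub>R int_vec p" for x
        proof -
          have "((\<lambda>y. \<phi> (y, t)) has_derivative (\<lambda>h. \<zeta> t * (Re (z * (2 * pi * \<i>) * character p x) * (int_vec p \<bullet> h)))) (at x)"
            unfolding \<phi>_def fst_conv snd_conv by (intro has_derivative_mult_right has_derivative_Re_character)
          from grad_nth_eqI [OF this] show ?thesis
            by (simp add: vec_eq_iff inner_axis mult.assoc)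
        qed
        moreover have "\<psi> x t = frac_symbol s p * (\<zeta> t * Re (z * character p x))" for x
          unfolding \<psi>_def mult.assoc [of "of_real _"] Re_of_real_mult ..
        moreover have "- (\<zeta>' t * Re (z * character p x)) + frac_symbol s p * (\<zeta> t * Re (z * character p x)) +
            b x t \<bullet> ((\<zeta> t * Re (z * (2 * pi * \<i>) * character p x)) *\<^sub>R int_vec p) = Re (z * K x)" for x
        proof -
          have "z * K x = of_real (- \<zeta>' t + frac_symbol s p * \<zeta> t) * (z * character p x) +
            of_real (\<zeta> t * (b x t \<bullet> int_vec p)) * (z * (2 * pi * \<i>) * character p x)"
            by (simp add: K_def algebra_simps)
          then have "Re (z * K x) = (- \<zeta>' t + frac_symbol s p * \<zeta> t) * Re (z * character p x) +
            (\<zeta> t * (b x t \<bullet> int_vec p)) * Re (z * (2 * pi * \<i>) * character p x)"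
            by (simp only: plus_complex.sel Re_of_real_mult)
          then show ?thesis by (simp add: algebra_simps del: times_complex.sel)
        qed
        ultimately have "I t = (LINT x|m t. Re (z * K x))"
          unfolding I_def by (simp only:)
        moreover have char: "integrable (m t) (character p)"
          by (rule integrable_continuous_torus [OF m [OF t]]) (intro continuous_intros)
        moreover have bchar: "integrable (m t) (\<lambda>x. of_real (b x t \<bullet> int_vec p) * character p x)"
        proof (rule Bochner_Integration.integrable_bound)
          show int: "integrable (m t) (\<lambda>x. b x t \<bullet> int_vec p)"
            using b [OF t] by (intro integrable_inner_left) auto
          show "(\<lambda>x. of_real (b x t \<bullet> int_vec p) * character p x) \<in> borel_measurable (m t)"
            by (intro borel_measurable_times borel_measurable_integrable char integrable_of_real int)
        qed (simp add: norm_mult)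
        moreover have "integrable (m t) (\<lambda>x. z * K x)"
          unfolding K_def by (intro integrable_mult_right Bochner_Integration.integrable_add char bchar)
        ultimately have "I t = Re (LINT x|m t. z * K x)"
          by (simp only: integral_Re)
        also have "(LINT x|m t. z * K x) = z * (\<zeta> t *\<^sub>R h t - \<zeta>' t *\<^sub>R F t)"
        proof -
          have "(LINT x|m t. K x) = (LINT x|m t. of_real (- \<zeta>' t + frac_symbol s p * \<zeta> t) * character p x) +
             (LINT x|m t. of_real (\<zeta> t) * (2 * pi * \<i>) * (of_real (b x t \<bullet> int_vec p) * character p x))"
            unfolding K_def by (intro Bochner_Integration.integral_add integrable_mult_right char bchar)
          also have "\<dots> = \<zeta> t *\<^sub>R h t - \<zeta>' t *\<^sub>R F t"
            unfolding integral_mult_right_zero h_def F_def scaleR_conv_of_real by (simp add: algebra_simps)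
          finally show ?thesis by simp
        qed
        finally show ?thesis .
      qed
      have eq: "indicator {0<..<T} t *\<^sub>R I t = indicator {0<..<T} t *\<^sub>R Re (z * (\<zeta> t *\<^sub>R h t - \<zeta>' t *\<^sub>R F t))" for t
        using I_eq [of t] by (cases "t \<in> {0<..<T}") (simp_all only: indicator_simps scaleR_zero_left not_False_eq_True)
      show ?thesis
        using I unfolding set_integrable_def set_lebesgue_integral_def eq by blast
    qed
    show ?thesis
      using main [of 1] main [of "- \<i>"] by (intro set_integral_complexI) simp_all
  qed
  note cont_F = cont [folded F_def]
  show "set_integrable lborel {t0..t1} h"
    by (rule weak_derivative_imp_integral(1) [OF cont_F _ ab]) (rule weak)
  show "F t1 - F t0 = - (LINT t:{t0..t1}|lborel. h t)"
    by (rule weak_derivative_imp_integral(2) [OF cont_F _ ab]) (rule weak)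
qed

lemma weak_topology_continuous_integral:
  assumes "continuous_map (top_of_set S) (weak_topology M \<F>) m" "\<phi> \<in> \<F>"
  shows "continuous_on S (\<lambda>t. LINT z|m t. \<phi> z)" and "\<And>t. t \<in> S \<Longrightarrow> m t \<in> M"
proof -
  let ?B = "{{\<mu> \<in> M. (LINT z|\<mu>. \<phi> z) \<in> U} | \<phi> U. \<phi> \<in> \<F> \<and> open U}"
  have "topspace (weak_topology M \<F>) \<subseteq> M"
    unfolding weak_topology_def topology_generated_by_topspace by auto
  then show mem: "m t \<in> M" if "t \<in> S" for t
    using assms(1) that unfolding continuous_map_def by auto
  show "continuous_on S (\<lambda>t. LINT z|m t. \<phi> z)"
    unfolding continuous_on_open_invariant
  proof (intro allI impI)
    fix U :: "real set" assume U: "open U"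
    have "openin (weak_topology M \<F>) {\<mu> \<in> M. (LINT z|\<mu>. \<phi> z) \<in> U}"
      unfolding weak_topology_def using assms(2) U by (intro topology_generated_by_Basis) auto
    then have "openin (top_of_set S) {t \<in> topspace (top_of_set S). m t \<in> {\<mu> \<in> M. (LINT z|\<mu>. \<phi> z) \<in> U}}"
      by (rule openin_continuous_map_preimage [OF assms(1)])
    moreover have "{t \<in> topspace (top_of_set S). m t \<in> {\<mu> \<in> M. (LINT z|\<mu>. \<phi> z) \<in> U}} =
        (\<lambda>t. LINT z|m t. \<phi> z) -` U \<inter> S"
      using mem by auto
    ultimately have "openin (top_of_set S) ((\<lambda>t. LINT z|m t. \<phi> z) -` U \<inter> S)" by simp
    then show "\<exists>A. open A \<and> A \<inter> S = (\<lambda>t. LINT z|m t. \<phi> z) -` U \<inter> S"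
      unfolding openin_open by (metis inf_commute)
  qed
qed

section \<open>Legendre duality\<close>

text \<open>
  Two applications of the mean value theorem along the segment.
\<close>

lemma positive_hessian_above_tangent:
  fixes f :: "real ^ 'd \<Rightarrow> real"
  assumes f: "twice_differentiable f" and pos: "\<And>\<alpha> v. v \<noteq> 0 \<Longrightarrow> v \<bullet> (hess f \<alpha> *v v) > 0"
    and "\<beta> \<noteq> \<alpha>"
  shows "f \<alpha> + grad f \<alpha> \<bullet> (\<beta> - \<alpha>) < f \<beta>"
proof -
  define v where "v = \<beta> - \<alpha>"
  have v: "v \<noteq> 0" using assms(3) by (simp add: v_def)
  have D1: "((\<lambda>\<tau>. f (\<alpha> + \<tau> *\<^sub>R v)) has_real_derivative grad f (\<alpha> + \<tau> *\<^sub>R v) \<bullet> v) (at \<tau>)" for \<tau>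
  proof -
    have "((\<lambda>\<tau>. f (\<alpha> + \<tau> *\<^sub>R v)) has_derivative (\<lambda>h. grad f (\<alpha> + \<tau> *\<^sub>R v) \<bullet> (h *\<^sub>R v))) (at \<tau>)"
      by (rule has_derivative_compose [OF _ differentiable_has_grad])
        (use f in \<open>auto simp: twice_differentiable_def intro!: derivative_eq_intros\<close>)
    then show ?thesis by (simp add: has_field_derivative_def mult_commute_abs)
  qed
  have D2: "((\<lambda>\<tau>. grad f (\<alpha> + \<tau> *\<^sub>R v) \<bullet> v) has_real_derivative v \<bullet> (hess f (\<alpha> + \<tau> *\<^sub>R v) *v v)) (at \<tau>)" for \<tau>
  proof -
    have "(grad f has_derivative (\<lambda>h. hess f (\<alpha> + \<tau> *\<^sub>R v) *v h)) (at (\<alpha> + \<tau> *\<^sub>R v))"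
      using f unfolding twice_differentiable_def hess_def by (simp flip: jacobian_works)
    then have "((\<lambda>\<tau>. grad f (\<alpha> + \<tau> *\<^sub>R v)) has_derivative (\<lambda>h. hess f (\<alpha> + \<tau> *\<^sub>R v) *v (h *\<^sub>R v))) (at \<tau>)"
      by (rule has_derivative_compose [rotated]) (auto intro!: derivative_eq_intros)
    then have "((\<lambda>\<tau>. grad f (\<alpha> + \<tau> *\<^sub>R v) \<bullet> v) has_derivative (\<lambda>h. (hess f (\<alpha> + \<tau> *\<^sub>R v) *v (h *\<^sub>R v)) \<bullet> v)) (at \<tau>)"
      by (rule has_derivative_inner_left)
    moreover have "(hess f (\<alpha> + \<tau> *\<^sub>R v) *v (h *\<^sub>R v)) \<bullet> v = (v \<bullet> (hess f (\<alpha> + \<tau> *\<^sub>R v) *v v)) * h" for h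
      by (simp add: matrix_vector_mult_scaleR inner_commute)
    ultimately show ?thesis by (simp add: has_field_derivative_def)
  qed
  obtain z where z: "0 < z" "f (\<alpha> + v) - f \<alpha> = grad f (\<alpha> + z *\<^sub>R v) \<bullet> v"
    using MVT2 [of 0 1 "\<lambda>\<tau>. f (\<alpha> + \<tau> *\<^sub>R v)" "\<lambda>\<tau>. grad f (\<alpha> + \<tau> *\<^sub>R v) \<bullet> v"] D1 by auto
  obtain w where "grad f (\<alpha> + z *\<^sub>R v) \<bullet> v - grad f \<alpha> \<bullet> v = z * (v \<bullet> (hess f (\<alpha> + w *\<^sub>R v) *v v))"
    using MVT2 [of 0 z "\<lambda>\<tau>. grad f (\<alpha> + \<tau> *\<^sub>R v) \<bullet> v" "\<lambda>\<tau>. v \<bullet> (hess f (\<alpha> + \<tau> *\<^sub>R v) *v v)"] D2 z(1) by auto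
  moreover have "0 < z * (v \<bullet> (hess f (\<alpha> + w *\<^sub>R v) *v v))"
    using z(1) pos [OF v] by simp
  ultimately show ?thesis using z(2) by (simp add: v_def)
qed

lemma above_tangents_imp_convex:
  fixes f :: "real ^ 'd \<Rightarrow> real"
  assumes tan: "\<And>\<alpha> \<beta>. f \<alpha> + g \<alpha> \<bullet> (\<beta> - \<alpha>) \<le> f \<beta>" and \<tau>: "0 \<le> \<tau>" "\<tau> \<le> 1"
  shows "f ((1 - \<tau>) *\<^sub>R \<alpha> + \<tau> *\<^sub>R \<beta>) \<le> (1 - \<tau>) * f \<alpha> + \<tau> * f \<beta>"
proof -
  define \<gamma> where "\<gamma> = (1 - \<tau>) *\<^sub>R \<alpha> + \<tau> *\<^sub>R \<beta>"
  have "(1 - \<tau>) * (f \<gamma> + g \<gamma> \<bullet> (\<alpha> - \<gamma>)) + \<tau> * (f \<gamma> + g \<gamma> \<bullet> (\<beta> - \<gamma>)) \<le> (1 - \<tau>) * f \<alpha> + \<tau> * f \<beta>"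
    using tan \<tau> by (intro add_mono mult_left_mono) auto
  moreover have "(1 - \<tau>) * (f \<gamma> + g \<gamma> \<bullet> (\<alpha> - \<gamma>)) + \<tau> * (f \<gamma> + g \<gamma> \<bullet> (\<beta> - \<gamma>)) =
      f \<gamma> + g \<gamma> \<bullet> ((1 - \<tau>) *\<^sub>R (\<alpha> - \<gamma>) + \<tau> *\<^sub>R (\<beta> - \<gamma>))"
    by (simp add: inner_add_right algebra_simps)
  moreover have "(1 - \<tau>) *\<^sub>R (\<alpha> - \<gamma>) + \<tau> *\<^sub>R (\<beta> - \<gamma>) = 0"
    by (simp add: \<gamma>_def algebra_simps)
  ultimately show ?thesis by (simp add: \<gamma>_def)
qed

text \<open>
  Finiteness of the conjugate at the points \<open>p \<plusminus> (\<delta> / 2) e\<^sub>i\<close> bounds \<open>p \<bullet> \<alpha> + f(\<alpha>)\<close> below by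
  \<open>(\<delta> / 2) |\<alpha>\<^sub>i|\<close> minus a constant.  Summed over \<open>i\<close>, this is coercivity.
\<close>

lemma legendre_attained:
  fixes f :: "real ^ 'd \<Rightarrow> real"
  assumes cont: "continuous_on UNIV f"
    and bdd: "\<forall>\<^sub>F p' in nhds p. bdd_above (range (\<lambda>\<alpha>. - (p' \<bullet> \<alpha>) - f \<alpha>))"
  shows "\<exists>\<alpha>. \<forall>\<beta>. p \<bullet> \<alpha> + f \<alpha> \<le> p \<bullet> \<beta> + f \<beta>"
proof -
  obtain \<delta> where \<delta>: "\<delta> > 0" "\<And>p'. dist p' p < \<delta> \<Longrightarrow> bdd_above (range (\<lambda>\<alpha>. - (p' \<bullet> \<alpha>) - f \<alpha>))"
    using bdd unfolding eventually_nhds_metric by blast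
  define G where "G \<alpha> = p \<bullet> \<alpha> + f \<alpha>" for \<alpha>
  have "\<exists>K. \<forall>\<alpha>. \<delta> / 2 * \<bar>\<alpha> $ i\<bar> - K \<le> G \<alpha>" for i
  proof -
    have dist: "dist (p + c *\<^sub>R axis i 1) p < \<delta>" if "\<bar>c\<bar> = \<delta> / 2" for c
      using that \<delta>(1) by (simp add: dist_norm)
    obtain K1 where K1: "\<And>\<alpha>. - ((p + (\<delta> / 2) *\<^sub>R axis i 1) \<bullet> \<alpha>) - f \<alpha> \<le> K1"
      using \<delta>(2) [OF dist [of "\<delta> / 2"]] \<delta>(1) unfolding bdd_above_def by auto
    obtain K2 where K2: "\<And>\<alpha>. - ((p + (- \<delta> / 2) *\<^sub>R axis i 1) \<bullet> \<alpha>) - f \<alpha> \<le> K2"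
      using \<delta>(2) [OF dist [of "- \<delta> / 2"]] \<delta>(1) unfolding bdd_above_def by auto
    have "\<delta> / 2 * \<bar>\<alpha> $ i\<bar> - max K1 K2 \<le> G \<alpha>" for \<alpha>
      using K1 [of \<alpha>] K2 [of \<alpha>] by (auto simp: G_def inner_add_left inner_diff_left inner_axis' abs_if max_def)
    then show ?thesis by blast
  qed
  then obtain K where K: "\<And>i \<alpha>. \<delta> / 2 * \<bar>\<alpha> $ i\<bar> - K i \<le> G \<alpha>" by metis
  have coercive: "\<delta> / 2 * norm \<alpha> - (\<Sum>i\<in>UNIV. K i) \<le> CARD('d) * G \<alpha>" for \<alpha>
  proof -
    have "\<delta> / 2 * norm \<alpha> \<le> \<delta> / 2 * (\<Sum>i\<in>UNIV. \<bar>\<alpha> $ i\<bar>)"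
      using \<delta>(1) norm_le_l1_cart [of \<alpha>] by (intro mult_left_mono) auto
    moreover have "(\<Sum>i\<in>UNIV. \<delta> / 2 * \<bar>\<alpha> $ i\<bar> - K i) \<le> (\<Sum>i\<in>(UNIV :: 'd set). G \<alpha>)"
      by (intro sum_mono K)
    ultimately show ?thesis by (simp add: sum_subtractf sum_distrib_left)
  qed
  \<comment> \<open>Outside the ball of radius \<open>R\<close>, coercivity forces values of at least \<open>G 0\<close>.\<close>
  define R where "R = 2 / \<delta> * (\<bar>CARD('d) * G 0\<bar> + \<bar>\<Sum>i\<in>UNIV. K i\<bar>)"
  have "0 \<le> R" using \<delta>(1) by (simp add: R_def)
  have "continuous_on (cball 0 R) G"
    unfolding G_def by (intro continuous_intros continuous_on_subset [OF cont]) auto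
  then obtain \<alpha> where \<alpha>: "\<alpha> \<in> cball 0 R" "\<And>\<beta>. \<beta> \<in> cball 0 R \<Longrightarrow> G \<alpha> \<le> G \<beta>"
    using continuous_attains_inf [of "cball 0 R" G] \<open>0 \<le> R\<close> by auto
  have "G \<alpha> \<le> G \<beta>" for \<beta>
  proof (cases "\<beta> \<in> cball 0 R")
    case False
    then have "R \<le> norm \<beta>" by simp
    then have "\<delta> / 2 * R \<le> \<delta> / 2 * norm \<beta>" using \<delta>(1) by (intro mult_left_mono) auto
    moreover have "\<delta> / 2 * R = \<bar>CARD('d) * G 0\<bar> + \<bar>\<Sum>i\<in>UNIV. K i\<bar>"
      using \<delta>(1) by (simp add: R_def)
    ultimately have "CARD('d) * G 0 \<le> CARD('d) * G \<beta>"
      using coercive [of \<beta>] by linarith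
    then have "G 0 \<le> G \<beta>" by simp
    then show ?thesis using \<alpha>(2) [of 0] \<open>0 \<le> R\<close> by simp
  qed (rule \<alpha>(2))
  then show ?thesis unfolding G_def by blast
qed

text \<open>
  The conjugate lies above the affine function \<open>p' \<mapsto> - p' \<bullet> \<alpha> - f(\<alpha>)\<close> and touches it at \<open>p\<close>, so where it is
  differentiable it has the same gradient.
\<close>

lemma legendre_gradient:
  fixes f :: "real ^ 'd \<Rightarrow> real"
  assumes bdd: "\<forall>\<^sub>F p' in nhds p. bdd_above (range (\<lambda>\<alpha>. - (p' \<bullet> \<alpha>) - f \<alpha>))"
    and diff: "(\<lambda>p'. \<theta> * (SUP \<alpha>. - (p' \<bullet> \<alpha>) - f \<alpha>)) differentiable (at p)"
    and \<theta>: "0 < \<theta>" and min: "\<And>\<beta>. p \<bullet> \<alpha> + f \<alpha> \<le> p \<bullet> \<beta> + f \<beta>"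
  shows "(SUP \<alpha>. - (p \<bullet> \<alpha>) - f \<alpha>) = - (p \<bullet> \<alpha>) - f \<alpha>"
    and "grad (\<lambda>p'. \<theta> * (SUP \<alpha>. - (p' \<bullet> \<alpha>) - f \<alpha>)) p = - \<theta> *\<^sub>R \<alpha>"
proof -
  define H where "H p' = (SUP \<alpha>. - (p' \<bullet> \<alpha>) - f \<alpha>)" for p'
  have H_p: "H p = - (p \<bullet> \<alpha>) - f \<alpha>"
    unfolding H_def
  proof (rule cSup_eq_maximum)
    fix y assume "y \<in> range (\<lambda>\<alpha>. - (p \<bullet> \<alpha>) - f \<alpha>)"
    then obtain \<beta> where "y = - (p \<bullet> \<beta>) - f \<beta>" by auto
    then show "y \<le> - (p \<bullet> \<alpha>) - f \<alpha>" using min [of \<beta>] by simp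
  qed auto
  then show "(SUP \<alpha>. - (p \<bullet> \<alpha>) - f \<alpha>) = - (p \<bullet> \<alpha>) - f \<alpha>" by (simp add: H_def)
  obtain S where "open S \<and> p \<in> S \<and> (\<forall>p'\<in>S. bdd_above (range (\<lambda>\<alpha>. - (p' \<bullet> \<alpha>) - f \<alpha>)))"
    using bdd [unfolded eventually_nhds] by (elim exE)
  then have S: "open S" "p \<in> S" "\<And>p'. p' \<in> S \<Longrightarrow> bdd_above (range (\<lambda>\<alpha>. - (p' \<bullet> \<alpha>) - f \<alpha>))"
    by auto
  have D: "((\<lambda>p'. \<theta> * H p') has_derivative (\<lambda>h. grad (\<lambda>p'. \<theta> * H p') p \<bullet> h)) (at p)"
    using diff unfolding H_def by (rule differentiable_has_grad)
  have "((\<lambda>p'. \<theta> * H p' + \<theta> * (p' \<bullet> \<alpha>)) has_derivative (\<lambda>h. grad (\<lambda>p'. \<theta> * H p') p \<bullet> h + \<theta> * (h \<bullet> \<alpha>))) (at p)"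
    by (intro has_derivative_add D) (auto intro!: derivative_eq_intros)
  moreover have "\<forall>p'\<in>S. \<theta> * H p + \<theta> * (p \<bullet> \<alpha>) \<le> \<theta> * H p' + \<theta> * (p' \<bullet> \<alpha>)"
  proof
    fix p' assume "p' \<in> S"
    then have "- (p' \<bullet> \<alpha>) - f \<alpha> \<le> H p'"
      unfolding H_def by (intro cSup_upper S(3)) auto
    then have "H p + p \<bullet> \<alpha> \<le> H p' + p' \<bullet> \<alpha>" by (simp add: H_p)
    then have "\<theta> * (H p + p \<bullet> \<alpha>) \<le> \<theta> * (H p' + p' \<bullet> \<alpha>)" using \<theta> by (intro mult_left_mono) auto
    then show "\<theta> * H p + \<theta> * (p \<bullet> \<alpha>) \<le> \<theta> * H p' + \<theta> * (p' \<bullet> \<alpha>)" by (simp add: distrib_left)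
  qed
  ultimately have "(\<lambda>h. grad (\<lambda>p'. \<theta> * H p') p \<bullet> h + \<theta> * (h \<bullet> \<alpha>)) = (\<lambda>h. 0)"
    using S(1,2) by (intro differential_zero_maxmin [of p S]) auto
  then have "grad (\<lambda>p'. \<theta> * H p') p \<bullet> h + \<theta> * (h \<bullet> \<alpha>) = 0" for h
    by (rule fun_cong)
  then have "(grad (\<lambda>p'. \<theta> * H p') p + \<theta> *\<^sub>R \<alpha>) \<bullet> h = 0" for h
    by (simp add: inner_add_left inner_commute [of \<alpha> h])
  then have "grad (\<lambda>p'. \<theta> * H p') p + \<theta> *\<^sub>R \<alpha> = 0"
    by (metis inner_eq_zero_iff)
  then show "grad (\<lambda>p'. \<theta> * (SUP \<alpha>. - (p' \<bullet> \<alpha>) - f \<alpha>)) p = - \<theta> *\<^sub>R \<alpha>"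
    unfolding H_def by (simp add: eq_neg_iff_add_eq_0)
qed

text \<open>
  On a small sphere around the minimiser at \<open>x0\<close> the values of \<open>G(x0, \<cdot>)\<close> exceed the value at the centre.  By
  compactness the same holds for \<open>x\<close> near \<open>x0\<close>, and convexity along the segment to the minimiser at \<open>x\<close> keeps that
  minimiser inside the sphere.
\<close>

lemma continuous_argmin:
  fixes G :: "real ^ 'd \<Rightarrow> real ^ 'd \<Rightarrow> real"
  assumes cont: "continuous_on UNIV (\<lambda>(x, \<alpha>). G x \<alpha>)"
    and convex: "\<And>x \<alpha> \<beta> \<tau>. 0 \<le> \<tau> \<Longrightarrow> \<tau> \<le> 1 \<Longrightarrow> G x ((1 - \<tau>) *\<^sub>R \<alpha> + \<tau> *\<^sub>R \<beta>) \<le> (1 - \<tau>) * G x \<alpha> + \<tau> * G x \<beta>"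
    and min: "\<And>x \<beta>. \<beta> \<noteq> A x \<Longrightarrow> G x (A x) < G x \<beta>"
  shows "continuous_on UNIV A"
  unfolding continuous_on_iff
proof (intro ballI allI impI)
  fix x0 and e :: real assume e: "0 < e"
  define S where "S = sphere (A x0) e"
  define W where "W = {z. 0 < G (fst z) (snd z) - G (fst z) (A x0)}"
  have contG: "continuous_on UNIV (\<lambda>z. G (fst z) (snd z))"
    using cont by (simp add: case_prod_unfold)
  have pair: "continuous_on UNIV (\<lambda>z :: (real ^ 'd) \<times> (real ^ 'd). (fst z, A x0))"
    by (intro continuous_intros)
  have "continuous_on UNIV (\<lambda>z :: (real ^ 'd) \<times> (real ^ 'd). G (fst z) (A x0))"
    using continuous_on_compose2 [OF contG pair] by simp
  with contG have "continuous_on UNIV (\<lambda>z. G (fst z) (snd z) - G (fst z) (A x0))"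
    by (intro continuous_intros)
  then have "open W"
    unfolding W_def using open_Collect_less [of "\<lambda>_. 0" "\<lambda>z. G (fst z) (snd z) - G (fst z) (A x0)"] by simp
  moreover have "{x0} \<times> S \<subseteq> W"
    using min e by (auto simp: W_def S_def)
  moreover have "compact S" by (simp add: S_def)
  ultimately obtain X where X: "open X" "x0 \<in> X" "X \<times> S \<subseteq> W"
    using Elementary_Topology.tube_lemma [of S W x0] by blast
  then obtain d where d: "d > 0" "ball x0 d \<subseteq> X" by (meson openE)
  have "dist (A x) (A x0) < e" if "dist x x0 < d" for x
  proof (rule ccontr)
    assume "\<not> dist (A x) (A x0) < e"
    then have far: "e \<le> norm (A x - A x0)" by (simp add: dist_norm)
    have "x \<in> X" using that d(2) by (auto simp: dist_commute)
    define \<tau> where "\<tau> = e / norm (A x - A x0)"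
    have \<tau>: "0 \<le> \<tau>" "\<tau> \<le> 1" using far e by (auto simp: \<tau>_def divide_simps)
    define \<beta> where "\<beta> = (1 - \<tau>) *\<^sub>R A x0 + \<tau> *\<^sub>R A x"
    have "\<beta> - A x0 = \<tau> *\<^sub>R (A x - A x0)" by (simp add: \<beta>_def algebra_simps)
    then have "norm (\<beta> - A x0) = e" using far e by (auto simp: \<tau>_def)
    then have "\<beta> \<in> S" by (simp add: S_def dist_norm norm_minus_commute)
    then have "(x, \<beta>) \<in> W" using X(3) \<open>x \<in> X\<close> by blast
    then have "G x (A x0) < G x \<beta>" by (simp add: W_def)
    also have "\<dots> \<le> (1 - \<tau>) * G x (A x0) + \<tau> * G x (A x)"
      unfolding \<beta>_def by (rule convex [OF \<tau>])
    also have "\<dots> \<le> (1 - \<tau>) * G x (A x0) + \<tau> * G x (A x0)"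
    proof (intro add_left_mono mult_left_mono)
      show "G x (A x) \<le> G x (A x0)"
        using min [of "A x0" x] by (cases "A x0 = A x") auto
    qed (use \<tau> in auto)
    finally show False by (simp add: algebra_simps)
  qed
  then show "\<exists>d>0. \<forall>x\<in>UNIV. dist x x0 < d \<longrightarrow> dist (A x) (A x0) < e"
    using d(1) by blast
qed

section \<open>The energy inequality at a fixed time\<close>

lemma distr_graph_in_prob_torus_ctrl:
  fixes A :: "real ^ 'd \<Rightarrow> real ^ 'd"
  assumes m: "m \<in> prob_torus" and A: "continuous_on UNIV A"
  shows "distr m borel (\<lambda>x. (x, A x)) \<in> prob_torus_ctrl"
    and "(\<lambda>x. (x, A x)) \<in> measurable m borel"
proof -
  have "continuous_on UNIV (\<lambda>x. (x, A x))" by (intro continuous_intros A)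
  then show meas: "(\<lambda>x. (x, A x)) \<in> measurable m borel"
    unfolding measurable_cong_sets [OF prob_torusD(2) [OF m] refl] by (rule borel_measurable_continuous_onI)
  have "prob_space (distr m borel (\<lambda>x. (x, A x)))"
    by (rule prob_space.prob_space_distr [OF prob_torusD(1) [OF m] meas])
  moreover have "AE z in distr m borel (\<lambda>x. (x, A x)). fst z \<in> cell"
  proof (subst AE_distr_iff [OF meas])
    have "{z :: (real ^ 'd) \<times> (real ^ 'd). fst z \<in> cell} = fst -` cell \<inter> space borel" by auto
    also have "\<dots> \<in> sets borel" by (rule measurable_sets [OF borel_measurable_continuous_onI]) (auto intro: continuous_intros)
    finally show "{z \<in> space (borel :: ((real ^ 'd) \<times> (real ^ 'd)) measure). fst z \<in> cell} \<in> sets borel" by simp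
  qed (use prob_torusD(3) [OF m] in simp)
  ultimately show "distr m borel (\<lambda>x. (x, A x)) \<in> prob_torus_ctrl"
    by (simp add: prob_torus_ctrl_def)
qed

text \<open>
  For a control given by a continuous feedback the moments are finite.
\<close>

lemma Lambda_distr_graph:
  fixes A :: "real ^ 'd \<Rightarrow> real ^ 'd"
  assumes m: "m \<in> prob_torus" and A: "continuous_on UNIV A" and r: "0 < r"
  shows "Lambda r (distr m borel (\<lambda>x. (x, A x))) = ennreal ((LINT x|m. norm (A x) powr r) powr (1 / r))"
    and "ennpowr (Lambda r (distr m borel (\<lambda>x. (x, A x)))) r = ennreal (LINT x|m. norm (A x) powr r)"
proof -
  have cont: "continuous_on UNIV (\<lambda>x. norm (A x) powr r)"
    using r by (intro continuous_on_powr' continuous_intros A) auto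
  have cont2: "continuous_on UNIV (\<lambda>z :: (real ^ 'd) \<times> (real ^ 'd). norm (snd z) powr r)"
    using r by (intro continuous_on_powr' continuous_intros) auto
  have "(\<integral>\<^sup>+ (x, \<alpha>). ennreal (norm \<alpha> powr r) \<partial>distr m borel (\<lambda>x. (x, A x))) = (\<integral>\<^sup>+ x. ennreal (norm (A x) powr r) \<partial>m)"
    using borel_measurable_continuous_onI [OF cont2]
    by (subst nn_integral_distr [OF distr_graph_in_prob_torus_ctrl(2) [OF m A]]) (simp_all add: case_prod_unfold)
  also have "\<dots> = ennreal (LINT x|m. norm (A x) powr r)"
    by (intro nn_integral_eq_integral integrable_continuous_torus [OF m cont]) auto
  finally show *: "Lambda r (distr m borel (\<lambda>x. (x, A x))) = ennreal ((LINT x|m. norm (A x) powr r) powr (1 / r))"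
    by (simp add: Lambda_def ennpowr_def integral_nonneg_AE)
  show "ennpowr (Lambda r (distr m borel (\<lambda>x. (x, A x)))) r = ennreal (LINT x|m. norm (A x) powr r)"
    unfolding * using r by (simp add: ennpowr_def powr_powr integral_nonneg_AE)
qed

text \<open>
  Monotonicity between \<open>\<nu>\<close> and the measure \<open>\<nu>'\<close> of the control \<open>0\<close> distributed as \<open>m'\<close>.  Afterwards the growth bounds
  are used only at \<open>\<nu>'\<close>, where \<open>\<Lambda>\<close> vanishes: this is what leaves the coefficient \<open>1 / C0\<close> uncompensated.
\<close>

lemma monotonicity_coercivity:
  fixes L :: "'d::finite lagrangian" and A :: "real ^ 'd \<Rightarrow> real ^ 'd"
  assumes adm: "admissible_lagrangian r C0 L" and r: "0 < r" and C0: "0 < C0"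
    and m: "m \<in> prob_torus" and m': "m' \<in> prob_torus" and A: "continuous_on UNIV A"
  defines "\<nu> \<equiv> distr m borel (\<lambda>x. (x, A x))"
  shows "(LINT x|m. norm (A x) powr r) / C0 - 2 * C0 \<le> (LINT x|m. L x (A x) \<nu>) - (LINT x|m'. L x 0 \<nu>)"
proof -
  define \<nu>' where "\<nu>' = distr m' borel (\<lambda>x. (x, 0 :: real ^ 'd))"
  have \<nu>: "\<nu> \<in> prob_torus_ctrl" "\<nu>' \<in> prob_torus_ctrl"
    unfolding \<nu>_def \<nu>'_def by (intro distr_graph_in_prob_torus_ctrl m m' A continuous_on_const)+
  have \<Lambda>': "Lambda r \<nu>' = 0"
    unfolding \<nu>'_def using Lambda_distr_graph(1) [OF m' continuous_on_const r] r by simp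
  have diffL: "\<forall>\<mu>\<in>prob_torus_ctrl. \<forall>z. (\<lambda>(x, \<alpha>). L x \<alpha> \<mu>) differentiable (at z)"
    and monoL: "\<forall>\<mu>1\<in>prob_torus_ctrl. \<forall>\<mu>2\<in>prob_torus_ctrl.
        integrable \<mu>1 (\<lambda>(x, \<alpha>). L x \<alpha> \<mu>1 - L x \<alpha> \<mu>2) \<and>
        integrable \<mu>2 (\<lambda>(x, \<alpha>). L x \<alpha> \<mu>1 - L x \<alpha> \<mu>2) \<longrightarrow>
        (LINT (x, \<alpha>)|\<mu>1. L x \<alpha> \<mu>1 - L x \<alpha> \<mu>2) - (LINT (x, \<alpha>)|\<mu>2. L x \<alpha> \<mu>1 - L x \<alpha> \<mu>2) \<ge> 0"
    and lowL: "\<forall>\<mu>\<in>prob_torus_ctrl. Lambda r \<mu> < \<top> \<longrightarrow> (\<forall>x \<alpha>.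
        L x \<alpha> \<mu> \<ge> norm \<alpha> powr r / C0 - C0 * (1 + enn2real (Lambda r \<mu>) powr r))"
    and upL: "\<forall>\<mu>\<in>prob_torus_ctrl. Lambda r \<mu> < \<top> \<longrightarrow> (\<forall>x \<alpha>.
        \<bar>L x \<alpha> \<mu>\<bar> + norm (grad (\<lambda>y. L y \<alpha> \<mu>) x)
          \<le> C0 * (1 + norm \<alpha> powr r + enn2real (Lambda r \<mu>) powr r))"
    using adm unfolding admissible_lagrangian_def by blast+
  have contL: "continuous_on UNIV (\<lambda>z. L (fst z) (snd z) \<mu>)" if "\<mu> \<in> prob_torus_ctrl" for \<mu>
    using diffL that by (simp add: case_prod_unfold differentiable_imp_continuous_on differentiable_on_def)
  have contB: "continuous_on UNIV (\<lambda>x. L x (B x) \<mu>)" if "\<mu> \<in> prob_torus_ctrl" "continuous_on UNIV B" for \<mu> B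
  proof -
    have "continuous_on UNIV (\<lambda>x. (x, B x))" by (intro continuous_intros that(2))
    from continuous_on_compose2 [OF contL [OF that(1)] this] show ?thesis by simp
  qed
  have contD: "(\<lambda>z. L (fst z) (snd z) \<nu> - L (fst z) (snd z) \<nu>') \<in> borel_measurable borel"
    by (intro borel_measurable_continuous_onI continuous_intros contL \<nu>)
  have graph: "integrable (distr n borel (\<lambda>x. (x, B x))) (\<lambda>(x, \<alpha>). L x \<alpha> \<nu> - L x \<alpha> \<nu>')"
    "(LINT (x, \<alpha>)|distr n borel (\<lambda>x. (x, B x)). L x \<alpha> \<nu> - L x \<alpha> \<nu>') = (LINT x|n. L x (B x) \<nu>) - (LINT x|n. L x (B x) \<nu>')"
    if n: "n \<in> prob_torus" and B: "continuous_on UNIV B" for n B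
  proof -
    note meas = distr_graph_in_prob_torus_ctrl(2) [OF n B]
    have int: "integrable n (\<lambda>x. L x (B x) \<nu>)" "integrable n (\<lambda>x. L x (B x) \<nu>')"
      by (intro integrable_continuous_torus [OF n] contB \<nu> B)+
    show "integrable (distr n borel (\<lambda>x. (x, B x))) (\<lambda>(x, \<alpha>). L x \<alpha> \<nu> - L x \<alpha> \<nu>')"
      unfolding case_prod_unfold using int by (subst integrable_distr_eq [OF meas contD]) simp
    show "(LINT (x, \<alpha>)|distr n borel (\<lambda>x. (x, B x)). L x \<alpha> \<nu> - L x \<alpha> \<nu>') = (LINT x|n. L x (B x) \<nu>) - (LINT x|n. L x (B x) \<nu>')"
      unfolding case_prod_unfold using int by (subst integral_distr [OF meas contD]) simp
  qed
  have zero: "continuous_on UNIV (\<lambda>x :: real ^ 'd. 0 :: real ^ 'd)" by simp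
  have "(LINT (x, \<alpha>)|\<nu>. L x \<alpha> \<nu> - L x \<alpha> \<nu>') - (LINT (x, \<alpha>)|\<nu>'. L x \<alpha> \<nu> - L x \<alpha> \<nu>') \<ge> 0"
    using monoL \<nu> graph(1) [OF m A] graph(1) [OF m' zero] by (simp add: \<nu>_def [symmetric] \<nu>'_def [symmetric])
  then have "(LINT x|m. L x (A x) \<nu>') - (LINT x|m'. L x 0 \<nu>') \<le> (LINT x|m. L x (A x) \<nu>) - (LINT x|m'. L x 0 \<nu>)"
    using graph(2) [OF m A] graph(2) [OF m' zero] by (simp add: \<nu>_def [symmetric] \<nu>'_def [symmetric])
  moreover have "(LINT x|m. norm (A x) powr r) / C0 - C0 \<le> (LINT x|m. L x (A x) \<nu>')"
  proof -
    interpret prob_space m by (rule prob_torusD(1) [OF m])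
    have int: "integrable m (\<lambda>x. norm (A x) powr r)"
      using r by (intro integrable_continuous_torus [OF m] continuous_on_powr' continuous_intros A) auto
    have "(LINT x|m. norm (A x) powr r / C0 - C0) \<le> (LINT x|m. L x (A x) \<nu>')"
      using lowL [rule_format, OF \<nu>(2)] \<Lambda>' r
      by (intro integral_mono integrable_continuous_torus [OF m contB [OF \<nu>(2) A]] Bochner_Integration.integrable_diff
          integrable_divide_zero int) auto
    then show ?thesis using int prob_space by simp
  qed
  moreover have "(LINT x|m'. L x 0 \<nu>') \<le> C0"
  proof -
    interpret prob_space m' by (rule prob_torusD(1) [OF m'])
    have "(LINT x|m'. L x 0 \<nu>') \<le> (LINT x|m'. C0)"
    proof (intro integral_mono integrable_continuous_torus [OF m' contB [OF \<nu>(2) zero]])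
      show "L x 0 \<nu>' \<le> C0" for x
      proof -
        have "\<bar>L x 0 \<nu>'\<bar> + norm (grad (\<lambda>y. L y 0 \<nu>') x) \<le> C0"
          using upL [rule_format, OF \<nu>(2), of x 0] \<Lambda>' r by simp
        then show ?thesis
          using norm_ge_zero [of "grad (\<lambda>y. L y 0 \<nu>') x"] by linarith
      qed
    qed simp
    then show ?thesis using prob_space by simp
  qed
  ultimately show ?thesis by linarith
qed

lemma Theta_in_prob_torus_ctrl:
  fixes \<mu> :: "((real ^ 'd) \<times> (real ^ 'd)) measure"
  assumes \<mu>: "\<mu> \<in> prob_torus_ctrl"
  shows "Theta \<theta> \<mu> \<in> prob_torus_ctrl"
proof -
  have sets: "sets \<mu> = sets borel" and ps: "prob_space \<mu>" and cell: "AE z in \<mu>. fst z \<in> cell"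
    using \<mu> by (simp_all add: prob_torus_ctrl_def)
  have "continuous_on UNIV (\<lambda>z :: (real ^ 'd) \<times> (real ^ 'd). (fst z, snd z /\<^sub>R \<theta>))"
    by (intro continuous_intros)
  then have meas: "(\<lambda>z. (fst z, snd z /\<^sub>R \<theta>)) \<in> measurable \<mu> borel"
    unfolding measurable_cong_sets [OF sets refl] by (rule borel_measurable_continuous_onI)
  have "AE z in distr \<mu> borel (\<lambda>z. (fst z, snd z /\<^sub>R \<theta>)). fst z \<in> cell"
  proof (subst AE_distr_iff [OF meas])
    have "{z :: (real ^ 'd) \<times> (real ^ 'd). fst z \<in> cell} = fst -` cell \<inter> space borel" by auto
    also have "\<dots> \<in> sets borel" by (rule measurable_sets [OF borel_measurable_continuous_onI]) (auto intro: continuous_intros)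
    finally show "{z \<in> space (borel :: ((real ^ 'd) \<times> (real ^ 'd)) measure). fst z \<in> cell} \<in> sets borel" by simp
  qed (use cell in simp)
  then show ?thesis
    using prob_space.prob_space_distr [OF ps meas]
    by (simp add: prob_torus_ctrl_def Theta_def case_prod_unfold)
qed

text \<open>
  The minimiser of \<open>P x \<bullet> \<alpha> + L x \<alpha> (\<Theta> \<mu>)\<close> is \<open>- b x / \<theta>\<close>.  Here \<open>L\<close> is continuous in \<open>(x, \<alpha>)\<close> because it is
  differentiable in these variables, at every measure and in particular before the controls of \<open>\<mu>\<close> are known to be bounded.
\<close>

lemma optimal_feedback:
  fixes L :: "'d::finite lagrangian" and P :: "real ^ 'd \<Rightarrow> real ^ 'd"
  assumes adm: "admissible_lagrangian r C0 L" and \<mu>: "\<mu> \<in> prob_torus_ctrl" and \<theta>: "0 < \<theta>"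
    and P: "continuous_on UNIV P" and ham: "\<And>x. hamiltonian_defined \<theta> L x (P x) \<mu>"
  defines "b \<equiv> \<lambda>x. D_p_hamiltonian \<theta> L x (P x) \<mu>"
  shows "continuous_on UNIV b"
    and "hamiltonian_scaled \<theta> L x (P x) \<mu> = b x \<bullet> P x - \<theta> * L x (- (b x /\<^sub>R \<theta>)) (Theta \<theta> \<mu>)"
    and "- \<theta> * (P x \<bullet> \<alpha> + L x \<alpha> (Theta \<theta> \<mu>)) \<le> hamiltonian_scaled \<theta> L x (P x) \<mu>"
proof -
  define \<nu> where "\<nu> = Theta \<theta> \<mu>"
  have \<nu>: "\<nu> \<in> prob_torus_ctrl" unfolding \<nu>_def by (rule Theta_in_prob_torus_ctrl [OF \<mu>])
  have "\<forall>\<mu>\<in>prob_torus_ctrl. \<forall>x. twice_differentiable (\<lambda>\<alpha>. L x \<alpha> \<mu>) \<and>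
        (\<forall>\<alpha> v. v \<noteq> 0 \<longrightarrow> v \<bullet> (hess (\<lambda>\<alpha>. L x \<alpha> \<mu>) \<alpha> *v v) > 0)"
    and diffL: "\<forall>\<mu>\<in>prob_torus_ctrl. \<forall>z. (\<lambda>(x, \<alpha>). L x \<alpha> \<mu>) differentiable (at z)"
    using adm unfolding admissible_lagrangian_def by blast+
  then have td: "twice_differentiable (\<lambda>\<alpha>. L x \<alpha> \<nu>)"
    and pos: "v \<noteq> 0 \<Longrightarrow> v \<bullet> (hess (\<lambda>\<alpha>. L x \<alpha> \<nu>) \<alpha> *v v) > 0" for x \<alpha> v
    using \<nu> by auto
  have contL: "continuous_on UNIV (\<lambda>z. L (fst z) (snd z) \<nu>)"
    using diffL \<nu> by (simp add: case_prod_unfold differentiable_imp_continuous_on differentiable_on_def)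
  have bdd: "\<forall>\<^sub>F p' in nhds (P x). bdd_above (range (\<lambda>\<alpha>. - (p' \<bullet> \<alpha>) - L x \<alpha> \<nu>))"
    and diff: "(\<lambda>p'. \<theta> * (SUP \<alpha>. - (p' \<bullet> \<alpha>) - L x \<alpha> \<nu>)) differentiable (at (P x))" for x
    using ham [of x] unfolding hamiltonian_defined_def hamiltonian_scaled_def hamiltonian_def \<nu>_def by auto
  have contLx: "continuous_on UNIV (\<lambda>\<alpha>. L x \<alpha> \<nu>)" for x
    using td by (simp add: twice_differentiable_def differentiable_imp_continuous_on differentiable_on_def)
  have "\<forall>x. \<exists>\<alpha>. \<forall>\<beta>. P x \<bullet> \<alpha> + L x \<alpha> \<nu> \<le> P x \<bullet> \<beta> + L x \<beta> \<nu>"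
    using legendre_attained [OF contLx bdd] by blast
  then obtain A where A: "\<And>x \<beta>. P x \<bullet> A x + L x (A x) \<nu> \<le> P x \<bullet> \<beta> + L x \<beta> \<nu>"
    by metis
  have b_eq: "b x = - \<theta> *\<^sub>R A x" for x
    using legendre_gradient(2) [OF bdd diff \<theta> A, of x]
    unfolding b_def D_p_hamiltonian_def hamiltonian_scaled_def hamiltonian_def \<nu>_def by simp
  have A_eq: "- (b x /\<^sub>R \<theta>) = A x" for x
    using \<theta> by (simp add: b_eq)
  have H_eq: "hamiltonian_scaled \<theta> L x (P x) \<mu> = \<theta> * (- (P x \<bullet> A x) - L x (A x) \<nu>)" for x
    using legendre_gradient(1) [OF bdd diff \<theta> A, of x]
    unfolding hamiltonian_scaled_def hamiltonian_def \<nu>_def by simp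
  show "hamiltonian_scaled \<theta> L x (P x) \<mu> = b x \<bullet> P x - \<theta> * L x (- (b x /\<^sub>R \<theta>)) (Theta \<theta> \<mu>)"
    unfolding A_eq \<nu>_def [symmetric] H_eq by (simp add: b_eq inner_commute algebra_simps)
  show "- \<theta> * (P x \<bullet> \<alpha> + L x \<alpha> (Theta \<theta> \<mu>)) \<le> hamiltonian_scaled \<theta> L x (P x) \<mu>"
    unfolding \<nu>_def [symmetric] H_eq using mult_left_mono [OF A [of x \<alpha>], of \<theta>] \<theta> by (simp add: algebra_simps)
  define G where "G x \<alpha> = P x \<bullet> \<alpha> + L x \<alpha> \<nu>" for x \<alpha>
  have tangent: "G x \<alpha> + (P x + grad (\<lambda>\<alpha>. L x \<alpha> \<nu>) \<alpha>) \<bullet> (\<beta> - \<alpha>) < G x \<beta>" if "\<beta> \<noteq> \<alpha>" for x \<alpha> \<beta>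
    using positive_hessian_above_tangent [OF td pos that, of x]
    by (simp add: G_def inner_add_left inner_diff_right)
  have "continuous_on UNIV A"
  proof (rule continuous_argmin)
    have "continuous_on UNIV (\<lambda>z :: (real ^ 'd) \<times> (real ^ 'd). P (fst z) \<bullet> snd z + L (fst z) (snd z) \<nu>)"
      by (intro continuous_intros contL continuous_on_compose2 [OF P]) auto
    then show "continuous_on UNIV (\<lambda>(x, \<alpha>). G x \<alpha>)"
      by (simp add: case_prod_unfold G_def)
    show "G x ((1 - \<tau>) *\<^sub>R \<alpha> + \<tau> *\<^sub>R \<beta>) \<le> (1 - \<tau>) * G x \<alpha> + \<tau> * G x \<beta>"
      if "0 \<le> \<tau>" "\<tau> \<le> 1" for x \<alpha> \<beta> \<tau>
    proof (rule above_tangents_imp_convex [OF _ that])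
      show "G x \<alpha> + (P x + grad (\<lambda>\<alpha>. L x \<alpha> \<nu>) \<alpha>) \<bullet> (\<beta> - \<alpha>) \<le> G x \<beta>" for \<alpha> \<beta>
        using tangent [of \<beta> \<alpha> x] by (cases "\<beta> = \<alpha>") auto
    qed
    show "G x (A x) < G x \<beta>" if "\<beta> \<noteq> A x" for x \<beta>
    proof -
      have "((\<lambda>\<alpha>. L x \<alpha> \<nu>) has_derivative (\<lambda>h. grad (\<lambda>\<alpha>. L x \<alpha> \<nu>) (A x) \<bullet> h)) (at (A x))"
        by (rule differentiable_has_grad) (use td in \<open>simp add: twice_differentiable_def\<close>)
      then have "(G x has_derivative (\<lambda>h. P x \<bullet> h + grad (\<lambda>\<alpha>. L x \<alpha> \<nu>) (A x) \<bullet> h)) (at (A x))"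
        unfolding G_def by (auto intro!: derivative_eq_intros)
      then have "(\<lambda>h. P x \<bullet> h + grad (\<lambda>\<alpha>. L x \<alpha> \<nu>) (A x) \<bullet> h) = (\<lambda>h. 0)"
        using A unfolding G_def by (intro differential_zero_maxmin [of "A x" UNIV]) auto
      then have "P x \<bullet> h + grad (\<lambda>\<alpha>. L x \<alpha> \<nu>) (A x) \<bullet> h = 0" for h
        by (rule fun_cong)
      then show ?thesis using tangent [OF that, of x] by (simp add: inner_add_left)
    qed
  qed
  then have "continuous_on UNIV (\<lambda>x. - \<theta> *\<^sub>R A x)" by (intro continuous_intros)
  then show "continuous_on UNIV b" by (simp add: b_eq [abs_def])
qed

text \<open>
  The two values of \<open>L\<close> in \<open>monotonicity_coercivity\<close> are replaced with the help of the Hamiltonian: the first is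
  known exactly along the optimal feedback, the second is bounded by testing the supremum with \<open>\<alpha> = 0\<close>.
\<close>

lemma energy_inequality:
  fixes L :: "'d::finite lagrangian" and P :: "real ^ 'd \<Rightarrow> real ^ 'd"
  assumes adm: "admissible_lagrangian r C0 L" and r: "0 < r" and C0: "0 < C0" and \<mu>: "\<mu> \<in> prob_torus_ctrl" and \<theta>: "0 < \<theta>"
    and P: "continuous_on UNIV P" and ham: "\<And>x. hamiltonian_defined \<theta> L x (P x) \<mu>"
    and m: "m \<in> prob_torus" and m': "m' \<in> prob_torus"
    and graph: "\<mu> = distr m borel (\<lambda>x. (x, - D_p_hamiltonian \<theta> L x (P x) \<mu>))"
  defines "b \<equiv> \<lambda>x. D_p_hamiltonian \<theta> L x (P x) \<mu>"
  defines "H \<equiv> \<lambda>x. hamiltonian_scaled \<theta> L x (P x) \<mu>"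
  shows "ennpowr (Lambda r \<mu>) r = ennreal (LINT x|m. norm (b x) powr r)"
    and "(LINT x|m. norm (b x) powr r) / (C0 * \<theta> powr r) - 2 * C0
      \<le> ((LINT x|m. b x \<bullet> P x - H x) + (LINT x|m'. H x)) / \<theta>"
proof -
  have b: "continuous_on UNIV b"
    unfolding b_def by (rule optimal_feedback(1) [OF adm \<mu> \<theta> P ham])
  have \<mu>_eq: "\<mu> = distr m borel (\<lambda>x. (x, - b x))"
    using graph by (simp only: b_def)
  have "continuous_on UNIV (\<lambda>x. - b x)" by (intro continuous_intros b)
  from Lambda_distr_graph(2) [OF m this r]
  show "ennpowr (Lambda r \<mu>) r = ennreal (LINT x|m. norm (b x) powr r)"
    unfolding \<mu>_eq [symmetric] by simp
  define A where "A x = - (b x /\<^sub>R \<theta>)" for x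
  have A: "continuous_on UNIV A"
    unfolding A_def by (intro continuous_intros b)
  have \<nu>_eq: "Theta \<theta> \<mu> = distr m borel (\<lambda>x. (x, A x))"
  proof -
    have "continuous_on UNIV (\<lambda>z :: (real ^ 'd) \<times> (real ^ 'd). (fst z, snd z /\<^sub>R \<theta>))"
      by (intro continuous_intros)
    then have "Theta \<theta> \<mu> = distr m borel ((\<lambda>z. (fst z, snd z /\<^sub>R \<theta>)) \<circ> (\<lambda>x. (x, - b x)))"
      unfolding Theta_def case_prod_unfold
      by (subst \<mu>_eq, intro distr_distr borel_measurable_continuous_onI distr_graph_in_prob_torus_ctrl(2) [OF m]) (intro continuous_intros b)+
    then show ?thesis by (simp add: o_def A_def)
  qed
  define \<nu> where "\<nu> = Theta \<theta> \<mu>"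
  have mono: "(LINT x|m. norm (A x) powr r) / C0 - 2 * C0 \<le> (LINT x|m. L x (A x) \<nu>) - (LINT x|m'. L x 0 \<nu>)"
    unfolding \<nu>_def \<nu>_eq by (rule monotonicity_coercivity [OF adm r C0 m m' A])
  have diffL: "\<forall>\<mu>\<in>prob_torus_ctrl. \<forall>z. (\<lambda>(x, \<alpha>). L x \<alpha> \<mu>) differentiable (at z)"
    using adm unfolding admissible_lagrangian_def by blast
  have \<nu>: "\<nu> \<in> prob_torus_ctrl" unfolding \<nu>_def by (rule Theta_in_prob_torus_ctrl [OF \<mu>])
  have contL: "continuous_on UNIV (\<lambda>z. L (fst z) (snd z) \<nu>)"
    using diffL \<nu> by (simp add: case_prod_unfold differentiable_imp_continuous_on differentiable_on_def)
  have contB: "continuous_on UNIV (\<lambda>x. L x (B x) \<nu>)" if "continuous_on UNIV B" for B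
  proof -
    have "continuous_on UNIV (\<lambda>x. (x, B x))" by (intro continuous_intros that)
    from continuous_on_compose2 [OF contL this] show ?thesis by simp
  qed
  have H_eq: "H x = b x \<bullet> P x - \<theta> * L x (A x) \<nu>" for x
    unfolding H_def A_def b_def \<nu>_def by (rule optimal_feedback(2) [OF adm \<mu> \<theta> P ham])
  have H_ge: "- \<theta> * L x 0 \<nu> \<le> H x" for x
    using optimal_feedback(3) [OF adm \<mu> \<theta> P ham, of x 0] unfolding H_def \<nu>_def by simp
  have contH: "continuous_on UNIV H"
    unfolding H_eq [abs_def] by (intro continuous_intros b P contB A)
  have "(LINT x|m. L x (A x) \<nu>) = (LINT x|m. b x \<bullet> P x - H x) / \<theta>"
    using \<theta> by (simp add: H_eq)
  moreover have "- (LINT x|m'. L x 0 \<nu>) \<le> (LINT x|m'. H x) / \<theta>"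
  proof -
    have "(LINT x|m'. - \<theta> * L x 0 \<nu>) \<le> (LINT x|m'. H x)"
      using H_ge by (intro integral_mono integrable_continuous_torus [OF m'] contH continuous_intros contB) auto
    then show ?thesis using \<theta> by (simp add: field_simps)
  qed
  moreover have "norm (A x) powr r = norm (b x) powr r / \<theta> powr r" for x
    using \<theta> by (simp add: A_def powr_divide divide_inverse mult.commute [of "inverse \<theta>"] powr_mult inverse_powr)
  ultimately show "(LINT x|m. norm (b x) powr r) / (C0 * \<theta> powr r) - 2 * C0
      \<le> ((LINT x|m. b x \<bullet> P x - H x) + (LINT x|m'. H x)) / \<theta>"
    using mono by (simp add: add_divide_distrib mult.commute)
qed

section \<open>The competitor and the duality identity\<close>

lemma Re_eqI: "complex_of_real a = z \<Longrightarrow> a = Re z"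
  by auto

lemma integral_fejer_mean:
  assumes n: "n \<in> prob_torus" and f: "continuous_on UNIV f"
  shows "(LINT x|n. fejer_mean N f x) =
     Re (\<Sum>p\<in>fejer_support N. of_real (fejer_coeff N p) * fcoef f p * (LINT x|n. character p x))"
proof -
  have char: "integrable n (character p)" for p
    by (rule integrable_continuous_torus [OF n]) (intro continuous_intros)
  have "complex_of_real (LINT x|n. fejer_mean N f x) = (LINT x|n. of_real (fejer_mean N f x))"
    by (rule integral_complex_of_real [symmetric])
  also have "\<dots> = (\<Sum>p\<in>fejer_support N. LINT x|n. of_real (fejer_coeff N p) * fcoef f p * character p x)"
    unfolding fejer_mean_eq [OF f] by (intro Bochner_Integration.integral_sum integrable_mult_right char)
  also have "\<dots> = (\<Sum>p\<in>fejer_support N. of_real (fejer_coeff N p) * fcoef f p * (LINT x|n. character p x))"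
    by (simp only: integral_mult_right_zero)
  finally show ?thesis by (rule Re_eqI)
qed

lemma integral_character_conj:
  assumes "continuous_on UNIV f"
  shows "(LINT x|haar. of_real (f x) * character p x) = cnj (fcoef f p)"
proof -
  have "cnj (fcoef f p) = (LINT x|haar. cnj (of_real (f x) * cnj (character p x)))"
    unfolding fcoef_def by (rule Bochner_Integration.integral_cnj [symmetric])
  then show ?thesis by simp
qed

text \<open>
  The measure \<open>n'\<close> is \<open>exp (- \<tau> (-\<Delta>)\<^sup>s)\<close> applied to the convolution of \<open>n\<close> with the Fejer kernel.  Smoothing by the
  kernel leaves finitely many frequencies, so the density is a trigonometric polynomial even at \<open>\<tau> = 0\<close>.
\<close>

definition smoothed_heat_flow :: "real \<Rightarrow> nat \<Rightarrow> real \<Rightarrow> (real ^ 'd) measure \<Rightarrow> (real ^ 'd) measure \<Rightarrow> bool" where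
  "smoothed_heat_flow s N \<tau> n n' \<longleftrightarrow> n' \<in> prob_torus \<and> (\<forall>f. continuous_on UNIV f \<longrightarrow> (LINT x|n'. f x) =
     (\<Sum>p\<in>fejer_support N. exp (- (\<tau> * frac_symbol s p)) * (fejer_coeff N p * Re (fcoef f p * (LINT x|n. character p x)))))"

text \<open>
  The convolution of \<open>n\<close> with the kernel is a nonnegative trigonometric polynomial, and the multiplier
  \<open>exp (- \<tau> |2 \<pi> k|\<^sup>2\<^sup>s)\<close> keeps it nonnegative.
\<close>

lemma heat_flow_competitor:
  fixes n :: "(real ^ 'd) measure"
  assumes s: "0 < s" "s < 1" and N: "0 < N" and \<tau>: "0 \<le> \<tau>" and n: "n \<in> prob_torus"
  shows "\<exists>n'. smoothed_heat_flow s N \<tau> n n'"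
proof -
  define F where "F p = (LINT x|n. character p x)" for p
  define c where "c p = of_real (fejer_coeff N p) * cnj (F p)" for p
  define \<rho> where "\<rho> x = (\<Sum>p\<in>fejer_support N. exp (- (\<tau> * frac_symbol s p)) * Re (c p * character p x))" for x
  interpret n: prob_space n by (rule prob_torusD(1) [OF n])
  have char: "integrable n (\<lambda>y. character p (f y))" if "continuous_on UNIV f" for p and f :: "real ^ 'd \<Rightarrow> real ^ 'd"
    using that by (intro integrable_continuous_torus [OF n] continuous_intros)
  have "0 \<le> (\<Sum>p\<in>fejer_support N. Re (c p * character p x))" for x
  proof -
    have "(\<Sum>p\<in>fejer_support N. of_real (fejer_coeff N p) * (F p * cnj (character p x))) =
       (\<Sum>p\<in>fejer_support N. LINT y|n. of_real (fejer_coeff N p) * character p (y - x))"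
      unfolding F_def character_diff_arg by (simp only: integral_mult_left_zero integral_mult_right_zero)
    also have "\<dots> = (LINT y|n. (\<Sum>p\<in>fejer_support N. of_real (fejer_coeff N p) * character p (y - x)))"
      by (intro Bochner_Integration.integral_sum [symmetric] integrable_mult_right char continuous_intros)
    also have "\<dots> = of_real (LINT y|n. fejer_kernel N (y - x))"
      by (simp only: fejer_kernel_eq [symmetric] integral_complex_of_real)
    finally have "Re (\<Sum>p\<in>fejer_support N. of_real (fejer_coeff N p) * (F p * cnj (character p x))) = (LINT y|n. fejer_kernel N (y - x))"
      by simp
    moreover have "Re (of_real (fejer_coeff N p) * (F p * cnj (character p x))) = Re (c p * character p x)" for p
      by (simp add: c_def algebra_simps del: character_simps)
    moreover have "0 \<le> (LINT y|n. fejer_kernel N (y - x))"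
      by (intro integral_nonneg_AE) (simp add: fejer_kernel_nonneg)
    ultimately show ?thesis by (simp only: Re_sum)
  qed
  then have \<rho>_nonneg: "0 \<le> \<rho> x" for x
    unfolding \<rho>_def
    by (intro positivity_preservingD [OF negative_definiteD [OF negative_definite_frac_symbol [OF s] \<tau>]]) auto
  have \<rho>_cont: "continuous_on UNIV \<rho>" unfolding \<rho>_def by (intro continuous_intros)
  have [measurable]: "\<rho> \<in> borel_measurable borel" by (rule borel_measurable_continuous_onI [OF \<rho>_cont])
  have \<rho>_int: "(LINT x|haar. \<rho> x * f x) =
     (\<Sum>p\<in>fejer_support N. exp (- (\<tau> * frac_symbol s p)) * (fejer_coeff N p * Re (fcoef f p * F p)))"
    if f: "continuous_on UNIV f" for f
  proof -
    have int: "integrable haar (\<lambda>x. c p * (of_real (f x) * character p x))" for p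
      by (intro integrable_haar_continuous continuous_intros f)
    have "(LINT x|haar. \<rho> x * f x) =
        (LINT x|haar. (\<Sum>p\<in>fejer_support N. exp (- (\<tau> * frac_symbol s p)) * Re (c p * (of_real (f x) * character p x))))"
    proof (intro Bochner_Integration.integral_cong refl)
      fix x
      have "Re (c p * (of_real (f x) * character p x)) = Re (c p * character p x) * f x" for p
        using Re_of_real_mult [of "f x" "c p * character p x"] by (simp only: mult_ac)
      then show "\<rho> x * f x = (\<Sum>p\<in>fejer_support N. exp (- (\<tau> * frac_symbol s p)) * Re (c p * (of_real (f x) * character p x)))"
        by (simp only: \<rho>_def sum_distrib_right mult.assoc)
    qed
    also have "\<dots> = (\<Sum>p\<in>fejer_support N. exp (- (\<tau> * frac_symbol s p)) * (LINT x|haar. Re (c p * (of_real (f x) * character p x))))"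
      using int by (subst Bochner_Integration.integral_sum) (auto intro!: integrable_Re integrable_mult_right simp del: times_complex.sel)
    also have "\<dots> = (\<Sum>p\<in>fejer_support N. exp (- (\<tau> * frac_symbol s p)) * (fejer_coeff N p * Re (fcoef f p * F p)))"
    proof (intro sum.cong refl)
      fix p
      have "(LINT x|haar. Re (c p * (of_real (f x) * character p x))) = Re (c p * cnj (fcoef f p))"
        by (simp only: integral_Re [OF int] integral_mult_right_zero integral_character_conj [OF f])
      also have "\<dots> = Re (of_real (fejer_coeff N p) * cnj (fcoef f p * F p))"
        by (simp only: c_def complex_cnj_mult mult_ac)
      also have "\<dots> = fejer_coeff N p * Re (fcoef f p * F p)"
        by (simp only: Re_of_real_mult cnj.sel)
      finally show "exp (- (\<tau> * frac_symbol s p)) * (LINT x|haar. Re (c p * (of_real (f x) * character p x))) =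
         exp (- (\<tau> * frac_symbol s p)) * (fejer_coeff N p * Re (fcoef f p * F p))" by simp
    qed
    finally show ?thesis .
  qed
  define n' where "n' = density haar \<rho>"
  have n'_int: "(LINT x|n'. f x) = (LINT x|haar. \<rho> x * f x)" if "continuous_on UNIV f" for f
    unfolding n'_def using borel_measurable_continuous_onI [OF that] \<rho>_nonneg
    by (subst integral_density) auto
  have "emeasure n' (space n') = 1"
  proof -
    have fcoef1: "fcoef (\<lambda>_. 1) p = (if p = 0 then 1 else 0)" for p :: "int ^ 'd"
      using integral_haar_character [of "- p"] by (simp add: fcoef_def)
    have zero_mem: "(0 :: int ^ 'd) \<in> fejer_support N"
      using fejer_coeff_0 [OF N, where 'd = 'd] fejer_coeff_eq_0 [of "0 :: int ^ 'd" N] by auto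
    have "(LINT x|haar. \<rho> x) = (\<Sum>p\<in>fejer_support N. exp (- (\<tau> * frac_symbol s p)) *
        (fejer_coeff N p * Re (fcoef (\<lambda>_. 1) p * F p)))"
      using \<rho>_int [OF continuous_on_const [of UNIV 1]] by (simp only: mult_1_right)
    also have "\<dots> = (\<Sum>p\<in>(fejer_support N :: (int ^ 'd) set). if p = 0 then fejer_coeff N (0 :: int ^ 'd) * Re (F 0) * exp (- (\<tau> * frac_symbol s (0 :: int ^ 'd))) else 0)"
      unfolding fcoef1 by (rule sum.cong) simp_all
    also have "\<dots> = 1"
      using zero_mem fejer_coeff_0 [OF N, where 'd = 'd] n.prob_space by (simp add: F_def frac_symbol_def)
    finally have "(LINT x|haar. \<rho> x) = 1" .
    moreover have "emeasure n' (space n') = (\<integral>\<^sup>+ x. ennreal (\<rho> x) \<partial>haar)"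
      unfolding n'_def by (subst emeasure_density) auto
    moreover have "(\<integral>\<^sup>+ x. ennreal (\<rho> x) \<partial>haar) = ennreal (LINT x|haar. \<rho> x)"
      using \<rho>_nonneg by (intro nn_integral_eq_integral integrable_haar_continuous \<rho>_cont) auto
    ultimately show ?thesis by simp
  qed
  then have "prob_space n'" by (rule prob_spaceI)
  moreover have "AE x in n'. x \<in> cell"
    unfolding n'_def by (subst AE_density) (auto simp: AE_haar)
  moreover have "sets n' = sets borel" by (simp add: n'_def)
  ultimately have "n' \<in> prob_torus"
    by (simp add: prob_torus_def)
  then show ?thesis
    using n'_int \<rho>_int unfolding F_def smoothed_heat_flow_def by (intro exI [of _ n']) auto
qed

text \<open>
  Each frequency \<open>p\<close> contributes the product of \<open>fcoef u p\<close> with the difference of the \<open>p\<close>-th coefficients of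
  competitor and solution, which is zero at \<open>t0\<close>.  In its derivative the symbol of the fractional Laplacian cancels
  between \<open>u\<close> and the measures.  What remains is the source \<open>H\<close>, integrated against both measures, and the drift, whose
  factor \<open>2 \<pi> \<i> p\<close> turns \<open>fcoef u p\<close> into the coefficients of the gradient of \<open>u\<close>.
\<close>

lemma duality_identity:
  fixes u H :: "real ^ 'd \<Rightarrow> real \<Rightarrow> real" and b :: "real ^ 'd \<Rightarrow> real \<Rightarrow> real ^ 'd"
    and m m' :: "real \<Rightarrow> (real ^ 'd) measure"
  assumes u: "C_2s_1 s T u"
    and H: "\<And>t. t \<in> {0<..<T} \<Longrightarrow> frac_laplacian s (\<lambda>x. u x t) (\<lambda>x. time_deriv T u x t - H x t)"
      "\<And>t. t \<in> {0<..<T} \<Longrightarrow> continuous_on UNIV (\<lambda>x. H x t)"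
    and m: "\<And>t. t \<in> {0<..<T} \<Longrightarrow> m t \<in> prob_torus"
      "\<And>p. continuous_on {0<..<T} (\<lambda>t. LINT x|m t. character p x)"
    and b: "\<And>t. t \<in> {0<..<T} \<Longrightarrow> continuous_on UNIV (\<lambda>x. b x t)"
    and fp: "solves_fokker_planck s T b m"
    and t01: "0 < t0" "t0 \<le> t1" "t1 < T"
    and m': "\<And>t. t \<in> {t0..t1} \<Longrightarrow> smoothed_heat_flow s N (t - t0) (m t0) (m' t)"
  defines "e \<equiv> \<lambda>t. (LINT x|m' t. H x t) - (LINT x|m t. fejer_mean N (\<lambda>x. H x t) x) +
      (\<Sum>j\<in>UNIV. LINT x|m t. b x t $ j * fejer_mean N (\<lambda>x. grad (\<lambda>y. u y t) x $ j) x)"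
  shows "set_integrable lborel {t0..t1} e"
    and "(LINT t:{t0..t1}|lborel. e t) = (LINT x|m' t1. u x t1) - (LINT x|m t1. fejer_mean N (\<lambda>x. u x t1) x)"
proof -
  have I: "{t0..t1} \<subseteq> {0<..<T}" and I': "{t0..t1} \<subseteq> {0..T}" using t01 by auto
  have cu: "continuous_on (UNIV \<times> {0..T}) (\<lambda>(x, t). u x t)"
    and cd: "continuous_on (UNIV \<times> {0..T}) (\<lambda>(x, t). time_deriv T u x t)"
    and cg: "continuous_on (UNIV \<times> {0..T}) (\<lambda>(x, t). grad (\<lambda>y. u y t) x)"
    and du: "\<And>x t. t \<in> {0..T} \<Longrightarrow> (\<lambda>y. u y t) differentiable (at x)"
    and pu: "\<And>t. t \<in> {0..T} \<Longrightarrow> periodic (\<lambda>x. u x t)"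
    using u unfolding C_2s_1_def by blast+
  have cut: "continuous_on UNIV (\<lambda>x. u x t)" and cdt: "continuous_on UNIV (\<lambda>x. time_deriv T u x t)"
    and cgt: "continuous_on UNIV (grad (\<lambda>y. u y t))" if "t \<in> {0..T}" for t
    using continuous_on_slice [OF cu that] continuous_on_slice [OF cd that] continuous_on_slice [OF cg that] by auto
  define F where "F p t = (LINT x|m t. character p x)" for p t
  define R where "R p t = exp (- ((t - t0) * frac_symbol s p)) *\<^sub>R F p t0" for p t
  define B where "B p t = 2 * pi * \<i> * (LINT x|m t. of_real (b x t \<bullet> int_vec p) * character p x)" for p t
  define G where "G p t = fcoef (\<lambda>x. u x t) p" for p t
  define Q where "Q p t = fcoef (\<lambda>x. H x t) p * (R p t - F p t) + G p t * B p t" for p t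
  have b_int: "integrable (m t) (\<lambda>x. b x t)" if "t \<in> {0<..<T}" for t
    by (rule integrable_continuous_torus [OF m(1) [OF that] b [OF that]])
  have Q: "set_integrable lborel {t0..t1} (Q p)" "(LINT t:{t0..t1}|lborel. Q p t) = G p t1 * (R p t1 - F p t1)" for p
  proof -
    define h where "h t = of_real (frac_symbol s p) * F p t + B p t" for t
    \<comment> \<open>\<open>- h\<close> is the derivative of the coefficient of \<open>m\<close>, and \<open>\<phi>\<close> that of the difference \<open>R p - F p\<close>.\<close>
    define \<phi> where "\<phi> t = h t - of_real (frac_symbol s p) * R p t" for t
    define G' where "G' t = fcoef (\<lambda>x. time_deriv T u x t) p" for t
    have dR: "(R p has_vector_derivative - of_real (frac_symbol s p) * R p t) (at t within X)" for t X
    proof -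
      have "((\<lambda>t. exp (- ((t - t0) * frac_symbol s p))) has_real_derivative - frac_symbol s p * exp (- ((t - t0) * frac_symbol s p))) (at t within X)"
        by (auto intro!: derivative_eq_intros)
      from has_vector_derivative_scaleR [OF this has_vector_derivative_const [of "F p t0"]]
      show ?thesis by (simp add: R_def [abs_def] scaleR_conv_of_real mult.assoc)
    qed
    have cR: "continuous_on X (R p)" for X
      unfolding R_def by (intro continuous_intros)
    have cF: "continuous_on {t0..t1} (F p)"
      unfolding F_def by (rule continuous_on_subset [OF m(2) I])
    have mode: "set_integrable lborel {t0..t} h" "F p t - F p t0 = - (LINT \<tau>:{t0..t}|lborel. h \<tau>)" if "t \<in> {t0..t1}" for t
      using fokker_planck_mode [OF fp m(1) m(2) b_int, of t0 t p] that t01 unfolding h_def F_def B_def by auto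
    have R_int: "set_integrable lborel {t0..t} (\<lambda>t. of_real (frac_symbol s p) * R p t)" for t
      by (intro borel_integrable_atLeastAtMost' continuous_intros cR)
    have R_diff: "(LINT \<tau>:{t0..t}|lborel. of_real (frac_symbol s p) * R p \<tau>) = R p t0 - R p t" if "t0 \<le> t" for t
    proof -
      have "(LINT \<tau>|lborel. indicator {t0..t} \<tau> *\<^sub>R (- of_real (frac_symbol s p) * R p \<tau>)) = R p t - R p t0"
        by (rule integral_FTC_atLeastAtMost [OF that dR]) (intro continuous_intros cR)
      moreover have "indicator {t0..t} \<tau> *\<^sub>R (- of_real (frac_symbol s p) * R p \<tau>) =
          - (indicator {t0..t} \<tau> *\<^sub>R (of_real (frac_symbol s p) * R p \<tau>))" for \<tau>
        by (simp only: mult_minus_left scaleR_minus_right)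
      ultimately have "- (LINT \<tau>:{t0..t}|lborel. of_real (frac_symbol s p) * R p \<tau>) = R p t - R p t0"
        by (simp only: set_lebesgue_integral_def Bochner_Integration.integral_minus)
      from arg_cong [OF this, of uminus] show ?thesis
        by (simp only: minus_minus minus_diff_eq)
    qed
    have \<phi>_int: "set_integrable lborel {t0..t1} \<phi>"
      unfolding \<phi>_def using mode(1) [of t1] t01 by (intro set_integral_diff R_int) auto
    have \<phi>_eq: "(R p t - F p t) - (R p t0 - F p t0) = (LINT \<tau>:{t0..t}|lborel. \<phi> \<tau>)" if t: "t \<in> {t0..t1}" for t
    proof -
      have "(LINT \<tau>:{t0..t}|lborel. \<phi> \<tau>) = (LINT \<tau>:{t0..t}|lborel. h \<tau>) - (LINT \<tau>:{t0..t}|lborel. of_real (frac_symbol s p) * R p \<tau>)"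
        unfolding \<phi>_def by (intro set_integral_diff mode(1) [OF t] R_int)
      moreover have "(LINT \<tau>:{t0..t}|lborel. h \<tau>) = F p t0 - F p t"
        using arg_cong [OF mode(2) [OF t], of uminus] by (simp only: minus_minus minus_diff_eq)
      ultimately show ?thesis using R_diff [of t] t by simp
    qed
    have dG: "(G p has_vector_derivative G' t) (at t within {t0..t1})" if "t \<in> {t0..t1}" for t
      unfolding G_def [abs_def] G'_def
      by (rule has_vector_derivative_within_subset [OF fcoef_time_derivative [OF u] I']) (use that I' in auto)
    have cG': "continuous_on {t0..t1} G'"
      unfolding G'_def by (rule continuous_on_subset [OF continuous_on_fcoef [OF cd] I'])
    note product = product_rule_absolutely_continuous [OF t01(2) \<phi>_int \<phi>_eq
        continuous_on_diff [OF cR cF] dG cG']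
    have Q_eq: "G' t * (R p t - F p t) + G p t * \<phi> t = Q p t" if t: "t \<in> {t0..t1}" for t
    proof -
      have tT: "t \<in> {0<..<T}" "t \<in> {0..T}" using t I by auto
      have "fcoef (\<lambda>x. time_deriv T u x t - H x t) p = of_real (frac_symbol s p) * G p t"
        unfolding G_def by (rule fcoef_frac_laplacian [OF cut [OF tT(2)] H(1) [OF tT(1)]])
      moreover have "fcoef (\<lambda>x. time_deriv T u x t - H x t) p = G' t - fcoef (\<lambda>x. H x t) p"
        unfolding G'_def fcoef_def of_real_diff left_diff_distrib
        by (intro Bochner_Integration.integral_diff integrable_haar_continuous continuous_intros cdt H(2) tT)
      ultimately have "G' t = fcoef (\<lambda>x. H x t) p + of_real (frac_symbol s p) * G p t"
        by (simp add: algebra_simps)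
      then show ?thesis
        by (simp add: Q_def \<phi>_def h_def algebra_simps)
    qed
    have eq: "indicator {t0..t1} t *\<^sub>R (G' t * (R p t - F p t) + G p t * \<phi> t) = indicator {t0..t1} t *\<^sub>R Q p t" for t
      using Q_eq [of t] by (cases "t \<in> {t0..t1}") (simp_all only: indicator_simps scaleR_zero_left not_False_eq_True)
    show "set_integrable lborel {t0..t1} (Q p)"
      using product(1) unfolding set_integrable_def eq .
    have "R p t0 = F p t0" by (simp add: R_def)
    then show "(LINT t:{t0..t1}|lborel. Q p t) = G p t1 * (R p t1 - F p t1)"
      using product(2) unfolding set_lebesgue_integral_def eq by simp
  qed
  define S where "S t = (\<Sum>p\<in>fejer_support N. of_real (fejer_coeff N p) * Q p t)" for t
  have S_int: "set_integrable lborel {t0..t1} S"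
    using Q(1) unfolding S_def set_integrable_def scaleR_sum_right
    by (intro Bochner_Integration.integrable_sum) (simp flip: mult_scaleR_right)
  have m'_eq: "(LINT x|m' t. f x) = Re (\<Sum>p\<in>fejer_support N. of_real (fejer_coeff N p) * (fcoef f p * R p t))"
    if "t \<in> {t0..t1}" "continuous_on UNIV f" for t f
  proof -
    have "Re (of_real (fejer_coeff N p) * (fcoef f p * R p t)) =
      exp (- ((t - t0) * frac_symbol s p)) * (fejer_coeff N p * Re (fcoef f p * (LINT x|m t0. character p x)))" for p
      by (simp add: R_def F_def algebra_simps)
    moreover have "(LINT x|m' t. f x) =
       (\<Sum>p\<in>fejer_support N. exp (- ((t - t0) * frac_symbol s p)) * (fejer_coeff N p * Re (fcoef f p * (LINT x|m t0. character p x))))"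
      using m' [OF that(1)] that(2) by (simp only: smoothed_heat_flow_def)
    ultimately show ?thesis by (simp only: Re_sum)
  qed
  have m_eq: "(LINT x|m t. fejer_mean N f x) = Re (\<Sum>p\<in>fejer_support N. of_real (fejer_coeff N p) * (fcoef f p * F p t))"
    if "t \<in> {t0..t1}" "continuous_on UNIV f" for t f
    using integral_fejer_mean [OF m(1) that(2), of t] that(1) I by (auto simp: F_def mult.assoc simp del: Re_sum)
  have b_eq: "(\<Sum>j\<in>UNIV. LINT x|m t. b x t $ j * fejer_mean N (\<lambda>x. grad (\<lambda>y. u y t) x $ j) x) =
      Re (\<Sum>p\<in>fejer_support N. of_real (fejer_coeff N p) * (G p t * B p t))" if t: "t \<in> {t0..t1}" for t
  proof -
    have tT: "t \<in> {0<..<T}" "t \<in> {0..T}" using t I by auto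
    have cbj: "continuous_on UNIV (\<lambda>x. b x t $ j)" for j by (intro continuous_intros b tT)
    have cgj: "continuous_on UNIV (\<lambda>x. grad (\<lambda>y. u y t) x $ j)" for j by (intro continuous_intros cgt tT)
    have int: "integrable (m t) (\<lambda>x. of_real (b x t $ j) * character p x)" for j p
      by (intro integrable_continuous_torus [OF m(1) [OF tT(1)]] continuous_intros cbj)
    have "complex_of_real (LINT x|m t. b x t $ j * fejer_mean N (\<lambda>x. grad (\<lambda>y. u y t) x $ j) x) =
       (\<Sum>p\<in>fejer_support N. of_real (fejer_coeff N p) * (G p t * (2 * pi * \<i> * of_int (p $ j) * (LINT x|m t. of_real (b x t $ j) * character p x))))" for j
    proof -
      have "complex_of_real (LINT x|m t. b x t $ j * fejer_mean N (\<lambda>x. grad (\<lambda>y. u y t) x $ j) x) =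
         (LINT x|m t. of_real (b x t $ j) * of_real (fejer_mean N (\<lambda>x. grad (\<lambda>y. u y t) x $ j) x))"
        by (simp flip: integral_complex_of_real)
      also have "\<dots> = (LINT x|m t. (\<Sum>p\<in>fejer_support N. (of_real (fejer_coeff N p) * fcoef (\<lambda>x. grad (\<lambda>y. u y t) x $ j) p) * (of_real (b x t $ j) * character p x)))"
        unfolding fejer_mean_eq [OF cgj] sum_distrib_left by (simp only: mult_ac)
      also have "\<dots> = (\<Sum>p\<in>fejer_support N. LINT x|m t. (of_real (fejer_coeff N p) * fcoef (\<lambda>x. grad (\<lambda>y. u y t) x $ j) p) * (of_real (b x t $ j) * character p x))"
        by (intro Bochner_Integration.integral_sum integrable_mult_right int)
      also have "\<dots> = (\<Sum>p\<in>fejer_support N. of_real (fejer_coeff N p) * (G p t * (2 * pi * \<i> * of_int (p $ j) * (LINT x|m t. of_real (b x t $ j) * character p x))))"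
        unfolding integral_mult_right_zero fcoef_partial_derivative [OF du [OF tT(2)] cgt [OF tT(2)] pu [OF tT(2)]] G_def
        by (simp only: mult_ac)
      finally show ?thesis .
    qed
    then have "complex_of_real (\<Sum>j\<in>UNIV. LINT x|m t. b x t $ j * fejer_mean N (\<lambda>x. grad (\<lambda>y. u y t) x $ j) x) =
      (\<Sum>j\<in>UNIV. \<Sum>p\<in>fejer_support N. of_real (fejer_coeff N p) * (G p t * (2 * pi * \<i> * of_int (p $ j) * (LINT x|m t. of_real (b x t $ j) * character p x))))"
      by (simp only: of_real_sum)
    also have "\<dots> = (\<Sum>p\<in>fejer_support N. \<Sum>j\<in>UNIV. of_real (fejer_coeff N p) * (G p t * (2 * pi * \<i> * of_int (p $ j) * (LINT x|m t. of_real (b x t $ j) * character p x))))"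
      by (rule sum.swap)
    also have "\<dots> = (\<Sum>p\<in>fejer_support N. of_real (fejer_coeff N p) * (G p t * B p t))"
    proof (intro sum.cong refl)
      fix p
      have "of_real (b x t \<bullet> int_vec p) * character p x = (\<Sum>j\<in>UNIV. of_int (p $ j) * (of_real (b x t $ j) * character p x))" for x
        by (simp add: inner_vec_def int_vec_def sum_distrib_left sum_distrib_right mult_ac)
      then have "B p t = 2 * pi * \<i> * (\<Sum>j\<in>UNIV. LINT x|m t. of_int (p $ j) * (of_real (b x t $ j) * character p x))"
        unfolding B_def by (simp only:) (subst Bochner_Integration.integral_sum, auto intro!: integrable_mult_right int)
      then have "B p t = 2 * pi * \<i> * (\<Sum>j\<in>UNIV. of_int (p $ j) * (LINT x|m t. of_real (b x t $ j) * character p x))"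
        by (simp only: integral_mult_right_zero)
      then show "(\<Sum>j\<in>UNIV. of_real (fejer_coeff N p) * (G p t * (2 * pi * \<i> * of_int (p $ j) * (LINT x|m t. of_real (b x t $ j) * character p x)))) =
         of_real (fejer_coeff N p) * (G p t * B p t)"
        by (simp only: sum_distrib_left mult_ac)
    qed
    finally show ?thesis by (rule Re_eqI)
  qed
  have e_eq: "e t = Re (S t)" if t: "t \<in> {t0..t1}" for t
  proof -
    have tT: "t \<in> {0<..<T}" using t I by auto
    show ?thesis
      unfolding e_def m'_eq [OF t H(2) [OF tT]] m_eq [OF t H(2) [OF tT]] b_eq [OF t] S_def Q_def
      by (simp only: distrib_left right_diff_distrib sum.distrib sum_subtractf minus_complex.sel plus_complex.sel)
  qed
  have eq: "indicator {t0..t1} t *\<^sub>R e t = indicator {t0..t1} t *\<^sub>R Re (S t)" for t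
    using e_eq [of t] by (cases "t \<in> {t0..t1}") (simp_all only: indicator_simps scaleR_zero_left not_False_eq_True)
  have eqS: "indicator {t0..t1} t *\<^sub>R Re (S t) = Re (indicator {t0..t1} t *\<^sub>R S t)" for t
    by simp
  show "set_integrable lborel {t0..t1} e"
    using S_int unfolding set_integrable_def eq eqS by (rule integrable_Re)
  have "(LINT t:{t0..t1}|lborel. e t) = Re (LINT t:{t0..t1}|lborel. S t)"
    using S_int unfolding set_lebesgue_integral_def set_integrable_def eq eqS by (rule integral_Re)
  also have "(LINT t:{t0..t1}|lborel. S t) = (\<Sum>p\<in>fejer_support N. of_real (fejer_coeff N p) * (G p t1 * (R p t1 - F p t1)))"
  proof -
    have "(LINT t:{t0..t1}|lborel. S t) = (\<Sum>p\<in>fejer_support N. (LINT t:{t0..t1}|lborel. of_real (fejer_coeff N p) * Q p t))"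
      using Q(1) unfolding S_def set_lebesgue_integral_def set_integrable_def scaleR_sum_right
      by (intro Bochner_Integration.integral_sum) (simp flip: mult_scaleR_right)
    then show ?thesis by (simp only: set_integral_mult_right Q(2))
  qed
  also have "Re \<dots> = (LINT x|m' t1. u x t1) - (LINT x|m t1. fejer_mean N (\<lambda>x. u x t1) x)"
  proof -
    have t1: "t1 \<in> {t0..t1}" "t1 \<in> {0..T}" using t01 by auto
    show ?thesis
      unfolding m'_eq [OF t1(1) cut [OF t1(2)]] m_eq [OF t1(1) cut [OF t1(2)]] G_def
      by (simp only: right_diff_distrib sum_subtractf minus_complex.sel)
  qed
  finally show "(LINT t:{t0..t1}|lborel. e t) = (LINT x|m' t1. u x t1) - (LINT x|m t1. fejer_mean N (\<lambda>x. u x t1) x)" .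
qed

section \<open>Periodic functions and the terminal datum\<close>

text \<open>
  Measurability of \<open>f\<close> in time is not known, so monotone convergence is applied to the simple functions below \<open>f\<close>.
\<close>

lemma nn_integral_exhaust_interval:
  fixes f :: "real \<Rightarrow> ennreal"
  assumes T: "0 < T" and bound: "\<And>a b. 0 < a \<Longrightarrow> a \<le> b \<Longrightarrow> b < T \<Longrightarrow> (\<integral>\<^sup>+ t\<in>{a..b}. f t \<partial>lborel) \<le> B"
  shows "(\<integral>\<^sup>+ t\<in>{0..T}. f t \<partial>lborel) \<le> B"
  unfolding nn_integral_def [of lborel "\<lambda>t. f t * indicator {0..T} t"]
proof (rule SUP_least)
  fix g assume "g \<in> {g. simple_function lborel g \<and> g \<le> (\<lambda>t. f t * indicator {0..T} t)}"
  then have g: "simple_function lborel g" and le: "\<And>t. g t \<le> f t * indicator {0..T} t"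
    by (auto simp: le_fun_def)
  have [measurable]: "g \<in> borel_measurable lborel"
    by (rule borel_measurable_simple_function [OF g])
  define A where "A n = {T / real (n + 3)..T - T / real (n + 3)}" for n
  have shrink: "T / real (n + 3) \<le> T / real (k + 3)" if "k \<le> n" for k n
    using T that by (intro divide_left_mono) auto
  have A_mono: "A k \<subseteq> A n" if "k \<le> n" for k n
    using shrink [OF that] by (auto simp: A_def)
  have "integral\<^sup>S lborel g = (\<integral>\<^sup>+ t. g t \<partial>lborel)"
    by (rule nn_integral_eq_simple_integral [OF g, symmetric])
  also have "\<dots> = (\<integral>\<^sup>+ t. (SUP n. g t * indicator (A n) t) \<partial>lborel)"
  proof (rule nn_integral_cong_AE)
    show "AE t in lborel. g t = (SUP n. g t * indicator (A n) t)"
      using AE_lborel_singleton [of 0] AE_lborel_singleton [of T]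
    proof eventually_elim
      case (elim t)
      show ?case
      proof (cases "t \<in> {0..T}")
        case True
        then have t: "0 < t" "t < T" using elim by auto
        have "(\<lambda>n. T / real (n + 3)) \<longlonglongrightarrow> 0"
          by (rule LIMSEQ_ignore_initial_segment [OF lim_const_over_n])
        then have "eventually (\<lambda>n. T / real (n + 3) < min t (T - t)) sequentially"
          using t by (intro order_tendstoD) auto
        then obtain n where "T / real (n + 3) < min t (T - t)"
          unfolding eventually_sequentially by blast
        then have "t \<in> A n" by (auto simp: A_def)
        then have "g t \<le> g t * indicator (A n) t" by simp
        also have "\<dots> \<le> (SUP n. g t * indicator (A n) t)" by (rule SUP_upper) simp
        finally show ?thesis
          by (intro antisym SUP_least) (auto simp: indicator_def)
      next
        case False
        then have "g t = 0" using le [of t] by simp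
        then show ?thesis by simp
      qed
    qed
  qed
  also have "\<dots> = (SUP n. \<integral>\<^sup>+ t. g t * indicator (A n) t \<partial>lborel)"
  proof (rule nn_integral_monotone_convergence_SUP)
    show "incseq (\<lambda>n t. g t * indicator (A n) t)"
      using A_mono by (auto simp: incseq_def le_fun_def indicator_def)
    show "(\<lambda>t. g t * indicator (A n) t) \<in> borel_measurable lborel" for n
      unfolding A_def by measurable
  qed
  also have "\<dots> \<le> B"
  proof (rule SUP_least)
    fix n
    have third: "T / real (n + 3) \<le> T / 3" using T by (intro divide_left_mono) auto
    have "(\<integral>\<^sup>+ t. g t * indicator (A n) t \<partial>lborel) \<le> (\<integral>\<^sup>+ t\<in>A n. f t \<partial>lborel)"
    proof (rule nn_integral_mono)
      fix t
      have "g t \<le> f t" using le [of t] by (cases "t \<in> {0..T}") auto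
      then show "g t * indicator (A n) t \<le> f t * indicator (A n) t" by (intro mult_right_mono) auto
    qed
    also have "\<dots> \<le> B"
      unfolding A_def using T third by (intro bound) auto
    finally show "(\<integral>\<^sup>+ t. g t * indicator (A n) t \<partial>lborel) \<le> B" .
  qed
  finally show "integral\<^sup>S lborel g \<le> B" .
qed

lemma periodic_frechet_derivative:
  fixes f :: "real ^ 'd \<Rightarrow> 'b::real_normed_vector"
  assumes per: "periodic f" and diff: "\<And>x. f differentiable (at x)"
  shows "periodic (\<lambda>x. frechet_derivative f (at x))"
  unfolding periodic_def
proof (intro allI)
  fix x i
  have "((\<lambda>y. f (y + axis i 1)) has_derivative (\<lambda>h. frechet_derivative f (at (x + axis i 1)) h)) (at x)"
    by (rule has_derivative_compose [of "\<lambda>y. y + axis i 1" "\<lambda>h. h"])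
      (use diff frechet_derivative_works in \<open>auto intro!: derivative_eq_intros\<close>)
  then have "(f has_derivative frechet_derivative f (at (x + axis i 1))) (at x)"
    using per by (simp add: periodic_def)
  then show "frechet_derivative f (at (x + axis i 1)) = frechet_derivative f (at x)"
    by (rule frechet_derivative_at)
qed

lemma periodic_grad:
  assumes "periodic f" "\<And>x. f differentiable (at x)"
  shows "periodic (grad f)"
  using periodic_frechet_derivative [OF assms] by (simp add: periodic_def grad_def)

lemma periodic_continuous_bounded:
  fixes f :: "real ^ 'd \<Rightarrow> 'b::real_normed_vector"
  assumes "periodic f" "continuous_on UNIV f"
  shows "\<exists>B. \<forall>x. norm (f x) \<le> B"
proof -
  have "bounded (f ` cbox 0 1)"
    by (intro compact_imp_bounded compact_continuous_image compact_cbox continuous_on_subset [OF assms(2)] subset_UNIV)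
  then obtain B where B: "\<forall>x\<in>cbox 0 1. norm (f x) \<le> B" unfolding bounded_iff by auto
  have "norm (f x) \<le> B" for x
  proof -
    obtain k where "x + int_vec k \<in> cell" using exists_cell_representative by blast
    then have "norm (f (x + int_vec k)) \<le> B" using B cell_subset_cbox by blast
    then show ?thesis by (simp only: periodic_int_vec [OF assms(1)])
  qed
  then show ?thesis by blast
qed

text \<open>
  The four terms of the norm are suprema in the reals; they are nonnegative because the sets are bounded, by periodicity
  and continuity or by the Hoelder condition.
\<close>

lemma C2_holder_abs_le_norm:
  fixes f :: "real ^ 'd \<Rightarrow> real"
  assumes f: "C2_holder \<beta> f" and \<beta>: "0 < \<beta>"
  shows "\<bar>f x\<bar> \<le> C2_holder_norm \<beta> f"
proof -
  have per: "periodic f" and d1: "\<And>x. f differentiable (at x)" and d2: "\<And>x. grad f differentiable (at x)"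
    using f by (auto simp: C2_holder_def twice_differentiable_def)
  obtain C where C: "\<And>x y. norm (hess f x - hess f y) \<le> C * dist x y powr \<beta>"
    using f unfolding C2_holder_def holder_def by blast
  have per_g: "periodic (grad f)" by (rule periodic_grad [OF per d1])
  have per_h: "periodic (hess f)"
    using periodic_frechet_derivative [OF per_g d2] by (simp add: periodic_def hess_def jacobian_def)
  have cont_h: "continuous_on UNIV (hess f)"
    unfolding continuous_on_def
  proof (intro ballI)
    fix x :: "real ^ 'd"
    have "continuous_on UNIV (\<lambda>y. C * dist y x powr \<beta>)"
      using \<beta> by (intro continuous_on_mult continuous_on_const continuous_on_powr' continuous_on_dist continuous_on_id) auto
    then have "((\<lambda>y. C * dist y x powr \<beta>) \<longlongrightarrow> C * dist x x powr \<beta>) (at x)"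
      unfolding continuous_on_def by blast
    then have lim: "((\<lambda>y. C * dist y x powr \<beta>) \<longlongrightarrow> 0) (at x)"
      by simp
    have "((\<lambda>y. hess f y - hess f x) \<longlongrightarrow> 0) (at x)"
      by (rule Lim_null_comparison [OF _ lim]) (simp add: C)
    then show "(hess f \<longlongrightarrow> hess f x) (at x)" by (simp add: LIM_zero_iff)
  qed
  have cont: "continuous_on UNIV f" "continuous_on UNIV (grad f)"
    using d1 d2 by (auto simp: differentiable_imp_continuous_on differentiable_on_def)
  have sup: "norm (g x) \<le> (SUP x. norm (g x))"
    if "periodic g" "continuous_on UNIV g" for x and g :: "real ^ 'd \<Rightarrow> 'c::real_normed_vector"
    using periodic_continuous_bounded [OF that] by (intro cSUP_upper) (auto simp: bdd_above_def)
  have "0 \<le> holder_seminorm \<beta> (hess f)"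
  proof -
    let ?S = "{(x, y). x \<noteq> (y :: real ^ 'd)}"
    let ?q = "\<lambda>(x, y). norm (hess f x - hess f y) / dist x y powr \<beta>"
    have "?q z \<le> C" if "z \<in> ?S" for z
      using that C [of "fst z" "snd z"] by (auto simp: case_prod_unfold divide_simps)
    then have "bdd_above (?q ` ?S)" by (auto simp: bdd_above_def)
    moreover have "(0, axis undefined 1) \<in> ?S" by (simp add: eq_commute [of 0])
    ultimately have "?q (0, axis undefined 1) \<le> holder_seminorm \<beta> (hess f)"
      unfolding holder_seminorm_def by (rule cSUP_upper [rotated])
    moreover have "0 \<le> ?q (0, axis undefined 1)" by simp
    ultimately show ?thesis by linarith
  qed
  moreover have "0 \<le> (SUP x. norm (grad f x))"
    using norm_ge_zero [of "grad f 0"] sup [OF per_g cont(2), of 0] by linarith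
  moreover have "0 \<le> (SUP x. norm (hess f x))"
    using norm_ge_zero [of "hess f 0"] sup [OF per_h cont_h, of 0] by linarith
  moreover have "\<bar>f x\<bar> \<le> (SUP x. \<bar>f x\<bar>)"
    using sup [OF per cont(1), of x] by simp
  ultimately show ?thesis unfolding C2_holder_norm_def by linarith
qed

lemma admissible_data_terminal_bound:
  assumes "admissible_data C0 \<beta>0 \<epsilon>0 s m0 uT" "0 < \<beta>0"
  shows "\<bar>uT x\<bar> \<le> C0"
proof -
  have "C2_holder \<beta>0 uT" and
    le: "(LINT x|m0. (norm x)\<^sup>2) + H2_norm (s - 1 + \<epsilon>0) m0 + C2_holder_norm \<beta>0 uT \<le> C0"
    using assms(1) by (auto simp: admissible_data_def)
  then have "\<bar>uT x\<bar> \<le> C2_holder_norm \<beta>0 uT"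
    using assms(2) by (intro C2_holder_abs_le_norm)
  moreover have "0 \<le> (LINT x|m0. (norm x)\<^sup>2)" by simp
  moreover have "0 \<le> H2_norm (s - 1 + \<epsilon>0) m0"
    unfolding H2_norm_def set_lebesgue_integral_def by (intro real_sqrt_ge_zero integral_nonneg_AE) auto
  ultimately show ?thesis using le by linarith
qed

lemma periodic_time_deriv:
  assumes u: "C_2s_1 s T u" and T: "0 < T" and t: "t \<in> {0..T}"
  shows "periodic (\<lambda>x. time_deriv T u x t)"
  unfolding periodic_def
proof (intro allI)
  fix x i
  have per: "u (x + axis i 1) \<tau> = u x \<tau>" if "\<tau> \<in> {0..T}" for \<tau>
    using u that unfolding C_2s_1_def periodic_def by blast
  have "(\<lambda>\<tau>. u x \<tau>) differentiable (at t within {0..T})"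
    using u t unfolding C_2s_1_def by blast
  then have "((\<lambda>\<tau>. u x \<tau>) has_vector_derivative time_deriv T u x t) (at t within {0..T})"
    unfolding time_deriv_def by (rule iffD1 [OF vector_derivative_works])
  then have "((\<lambda>\<tau>. u (x + axis i 1) \<tau>) has_vector_derivative time_deriv T u x t) (at t within {0..T})"
    by (rule has_vector_derivative_transform [OF t, rotated]) (rule per)
  then show "time_deriv T u (x + axis i 1) t = time_deriv T u x t"
    unfolding time_deriv_def [of T u "x + axis i 1"]
    using T t by (intro vector_derivative_within_closed_interval)
qed

section \<open>The a priori estimate\<close>

lemma weak_continuous_character:
  assumes "continuous_map (top_of_set S) prob_torus_top m"
  shows "continuous_on S (\<lambda>t. LINT x|m t. character p x)" and "\<And>t. t \<in> S \<Longrightarrow> m t \<in> prob_torus"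
proof -
  let ?\<F> = "{\<phi>. continuous_on UNIV \<phi> \<and> periodic \<phi>}"
  have weak: "continuous_map (top_of_set S) (weak_topology prob_torus ?\<F>) m"
    using assms by (simp only: prob_torus_top_def)
  have Re: "(\<lambda>x. Re (character p x)) \<in> ?\<F>" and Im: "(\<lambda>x. Im (character p x)) \<in> ?\<F>"
    using periodic_character [of p] by (auto simp: periodic_def intro!: continuous_intros)
  show m: "m t \<in> prob_torus" if "t \<in> S" for t
    by (rule weak_topology_continuous_integral(2) [OF weak Re that])
  have "(LINT x|m t. character p x) = Complex (LINT x|m t. Re (character p x)) (LINT x|m t. Im (character p x))" if "t \<in> S" for t
  proof -
    have "integrable (m t) (character p)"
      by (intro integrable_continuous_torus [OF m [OF that]] continuous_intros)
    then show ?thesis by (simp add: complex_eq_iff)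
  qed
  moreover have "continuous_on S (\<lambda>t. Complex (LINT x|m t. Re (character p x)) (LINT x|m t. Im (character p x)))"
    by (intro continuous_on_Complex weak_topology_continuous_integral(1) [OF weak] Re Im)
  ultimately show "continuous_on S (\<lambda>t. LINT x|m t. character p x)"
    by (simp cong: continuous_on_cong)
qed

lemma integral_le_of_close:
  fixes f g :: "real ^ 'd \<Rightarrow> real"
  assumes n: "n \<in> prob_torus" and f: "continuous_on UNIV f" and g: "continuous_on UNIV g"
    and le: "\<And>x. f x \<le> g x + \<epsilon>"
  shows "(LINT x|n. f x) \<le> (LINT x|n. g x) + \<epsilon>"
proof -
  interpret prob_space n by (rule prob_torusD(1) [OF n])
  have "(LINT x|n. f x) \<le> (LINT x|n. g x + \<epsilon>)"
    by (intro integral_mono integrable_continuous_torus [OF n] continuous_intros f g le)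
  also have "\<dots> = (LINT x|n. g x) + \<epsilon>"
    using integrable_continuous_torus [OF n g] prob_space by simp
  finally show ?thesis .
qed

lemma integral_abs_le_bound:
  fixes f :: "real ^ 'd \<Rightarrow> real"
  assumes n: "n \<in> prob_torus" and f: "continuous_on UNIV f" and le: "\<And>x. \<bar>f x\<bar> \<le> K"
  shows "\<bar>LINT x|n. f x\<bar> \<le> K"
proof -
  have "f x \<le> 0 + K" "- f x \<le> 0 + K" for x using le [of x] by linarith+
  note le = this
  have "(LINT x|n. f x) \<le> (LINT x|n. 0) + K"
    by (rule integral_le_of_close [OF n f continuous_on_const le(1)])
  moreover have "(LINT x|n. - f x) \<le> (LINT x|n. 0) + K"
    by (rule integral_le_of_close [OF n continuous_on_minus [OF f] continuous_on_const le(2)])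
  ultimately show ?thesis by simp
qed

text \<open>
  For every \<open>\<epsilon> > 0\<close> the Fejer order \<open>N\<close> is chosen such that the means of \<open>H\<close> and of the gradient of \<open>u\<close> are
  \<open>\<epsilon>\<close>-close on \<open>[t0, t1]\<close>.  Closed subintervals of \<open>(0, T)\<close> are needed here: the fractional Laplacian of \<open>u\<close> is continuous
  only on the open time interval.  The function \<open>Y\<close> below is an integrable majorant of the moments, and \<open>W(\<epsilon>)\<close>
  bounds its integral; the claim is the limit \<open>\<epsilon> \<rightarrow> 0\<close>.
\<close>

lemma energy_bound_interval:
  fixes L :: "'d::finite lagrangian" and u :: "real ^ 'd \<Rightarrow> real \<Rightarrow> real"
  assumes s: "0 < s" "s < 1" and r: "1 \<le> r" and C0: "0 < C0" and \<theta>: "0 < \<theta>" and T: "0 < T"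
    and adm: "admissible_lagrangian r C0 L" and sol: "mfgc_solution s \<theta> T L m0 uT u m \<mu>"
    and t01: "0 < t0" "t0 \<le> t1" "t1 < T" and K: "\<And>x. \<bar>u x t1\<bar> \<le> K"
  shows "(\<integral>\<^sup>+ t\<in>{t0..t1}. ennpowr (Lambda r (\<mu> t)) r \<partial>lborel)
     \<le> ennreal (C0 * \<theta> powr r * (2 * C0 * (t1 - t0) + 2 * K / \<theta>))"
proof -
  define P where "P t = grad (\<lambda>y. u y t)" for t
  define H where "H x t = hamiltonian_scaled \<theta> L x (P t x) (\<mu> t)" for x t
  define b where "b x t = D_p_hamiltonian \<theta> L x (P t x) (\<mu> t)" for x t
  define d where "d = real CARD('d)"
  have u: "C_2s_1 s T u" and mcont: "continuous_map (top_of_set {0..T}) prob_torus_top m"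
    and \<mu>: "\<And>t. t \<in> {0..T} \<Longrightarrow> \<mu> t \<in> prob_torus_ctrl"
    and ham: "\<And>t x. t \<in> {0..T} \<Longrightarrow> hamiltonian_defined \<theta> L x (P t x) (\<mu> t)"
    and hjb: "solves_hjb s \<theta> T L u \<mu>" and fp: "solves_fokker_planck s T b m"
    and graph: "\<And>t. t \<in> {0..T} \<Longrightarrow> \<mu> t = distr (m t) borel (\<lambda>x. (x, - D_p_hamiltonian \<theta> L x (P t x) (\<mu> t)))"
    using sol unfolding mfgc_solution_def b_def P_def by blast+
  have cd: "continuous_on (UNIV \<times> {0..T}) (\<lambda>(x, t). time_deriv T u x t)"
    and cg: "continuous_on (UNIV \<times> {0..T}) (\<lambda>(x, t). P t x)"
    and cu: "continuous_on (UNIV \<times> {0..T}) (\<lambda>(x, t). u x t)"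
    and du: "\<And>x t. t \<in> {0..T} \<Longrightarrow> (\<lambda>y. u y t) differentiable (at x)"
    and pu: "\<And>t. t \<in> {0..T} \<Longrightarrow> periodic (\<lambda>x. u x t)"
    using u unfolding C_2s_1_def P_def by blast+
  obtain g where cgg: "continuous_on (UNIV \<times> {0<..<T}) (\<lambda>(x, t). g x t)"
    and lap: "\<And>t. t \<in> {0<..<T} \<Longrightarrow> frac_laplacian s (\<lambda>x. u x t) (\<lambda>x. g x t)"
    and eq: "\<And>t x. t \<in> {0<..<T} \<Longrightarrow> - time_deriv T u x t + g x t + H x t = 0"
    using hjb unfolding solves_hjb_def H_def P_def by blast
  have J: "{t0..t1} \<subseteq> {0<..<T}" "{t0..t1} \<subseteq> {0..T}" using t01 by auto
  have H_eq: "H x t = time_deriv T u x t - g x t" if "t \<in> {0<..<T}" for x t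
    using eq [OF that, of x] by simp
  have contH: "continuous_on (UNIV \<times> {t0..t1}) (\<lambda>(x, t). H x t)"
  proof -
    have "continuous_on (UNIV \<times> {t0..t1}) (\<lambda>z. (case z of (x, t) \<Rightarrow> time_deriv T u x t) - (case z of (x, t) \<Rightarrow> g x t))"
      using J by (intro continuous_on_diff continuous_on_subset [OF cd] continuous_on_subset [OF cgg]) auto
    then show ?thesis
      by (rule continuous_on_eq) (use J H_eq in auto)
  qed
  have contHt: "continuous_on UNIV (\<lambda>x. H x t)" if t: "t \<in> {0<..<T}" for t
  proof -
    have "continuous_on UNIV (\<lambda>x. time_deriv T u x t - g x t)"
      using t by (intro continuous_intros continuous_on_slice [OF cd] continuous_on_slice [OF cgg]) auto
    then show ?thesis by (simp only: H_eq [OF t])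
  qed
  have perH: "periodic (\<lambda>x. H x t)" if t: "t \<in> {0<..<T}" for t
  proof -
    have "periodic (\<lambda>x. time_deriv T u x t)" using t by (intro periodic_time_deriv [OF u T]) auto
    moreover have "periodic (\<lambda>x. g x t)" using lap [OF t] by (simp add: frac_laplacian_def)
    ultimately show ?thesis by (simp add: H_eq [OF t] periodic_def)
  qed
  have lapH: "frac_laplacian s (\<lambda>x. u x t) (\<lambda>x. time_deriv T u x t - H x t)" if t: "t \<in> {0<..<T}" for t
    using lap [OF t] by (simp add: H_eq [OF t])
  have m: "m t \<in> prob_torus" if "t \<in> {0..T}" for t
    using weak_continuous_character(2) [OF mcont that] .
  have mchar: "continuous_on {0<..<T} (\<lambda>t. LINT x|m t. character p x)" for p
    by (rule continuous_on_subset [OF weak_continuous_character(1) [OF mcont]]) auto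
  have cP: "continuous_on UNIV (P t)" if "t \<in> {0..T}" for t
    using continuous_on_slice [OF cg that] by simp
  have contb: "continuous_on UNIV (\<lambda>x. b x t)" if t: "t \<in> {0..T}" for t
    unfolding b_def by (rule optimal_feedback(1) [OF adm \<mu> [OF t] \<theta> cP [OF t] ham [OF t]])
  define Br where "Br t = (LINT x|m t. norm (b x t) powr r)" for t
  have \<Lambda>: "ennpowr (Lambda r (\<mu> t)) r = ennreal (Br t)" if t: "t \<in> {0..T}" for t
    unfolding Br_def b_def using r
    by (intro energy_inequality(1) [OF adm _ C0 \<mu> [OF t] \<theta> cP [OF t] ham [OF t] m [OF t] m [OF t] graph [OF t]]) auto
  have contbr: "continuous_on UNIV (\<lambda>x. norm (b x t) powr r)" if "t \<in> {0..T}" for t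
    using r contb [OF that] by (intro continuous_on_powr' continuous_on_norm continuous_on_const) auto
  define W where "W \<epsilon> = ((2 * C0 + \<epsilon> * (1 + d) / \<theta>) * (t1 - t0) + 2 * K / \<theta>) / (1 / (C0 * \<theta> powr r) - \<epsilon> * d / \<theta>)" for \<epsilon>
  have step: "(\<integral>\<^sup>+ t\<in>{t0..t1}. ennpowr (Lambda r (\<mu> t)) r \<partial>lborel) \<le> ennreal (W \<epsilon>)"
    if \<epsilon>: "0 < \<epsilon>" "\<epsilon> * d / \<theta> < 1 / (C0 * \<theta> powr r)" for \<epsilon>
  proof -
    define \<kappa> where "\<kappa> = 1 / (C0 * \<theta> powr r) - \<epsilon> * d / \<theta>"
    have \<kappa>: "0 < \<kappa>" using \<epsilon>(2) by (simp add: \<kappa>_def)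
    have evH: "eventually (\<lambda>N. \<forall>t\<in>{t0..t1}. \<forall>x. \<bar>fejer_mean N (\<lambda>x. H x t) x - H x t\<bar> \<le> \<epsilon>) sequentially"
      using perH J by (intro fejer_mean_uniform_limit contH \<epsilon>(1)) auto
    have evP: "eventually (\<lambda>N. \<forall>t\<in>{t0..t1}. \<forall>x. \<bar>fejer_mean N (\<lambda>x. P t x $ j) x - P t x $ j\<bar> \<le> \<epsilon>) sequentially" for j
    proof (intro fejer_mean_uniform_limit \<epsilon>(1))
      have "continuous_on (UNIV \<times> {t0..t1}) (\<lambda>z. (case z of (x, t) \<Rightarrow> P t x) $ j)"
        using J by (intro continuous_intros continuous_on_subset [OF cg]) auto
      then show "continuous_on (UNIV \<times> {t0..t1}) (\<lambda>(x, t). P t x $ j)"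
        by (simp add: case_prod_unfold)
      show "periodic (\<lambda>x. P t x $ j)" if "t \<in> {t0..t1}" for t
        using periodic_grad [OF pu du] that J(2) by (auto simp: periodic_def P_def)
    qed auto
    have "eventually (\<lambda>N. \<forall>j\<in>UNIV. \<forall>t\<in>{t0..t1}. \<forall>x. \<bar>fejer_mean N (\<lambda>x. P t x $ j) x - P t x $ j\<bar> \<le> \<epsilon>) sequentially"
      using evP by (intro eventually_ball_finite) auto
    then have "eventually (\<lambda>N. 0 < N \<and> (\<forall>t\<in>{t0..t1}. \<forall>x. \<bar>fejer_mean N (\<lambda>x. H x t) x - H x t\<bar> \<le> \<epsilon>) \<and>
        (\<forall>j\<in>UNIV. \<forall>t\<in>{t0..t1}. \<forall>x. \<bar>fejer_mean N (\<lambda>x. P t x $ j) x - P t x $ j\<bar> \<le> \<epsilon>)) sequentially"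
      using evH eventually_gt_at_top [of 0] by eventually_elim (intro conjI)
    from eventually_happens' [OF sequentially_bot this] obtain N where *: "0 < N \<and>
        (\<forall>t\<in>{t0..t1}. \<forall>x. \<bar>fejer_mean N (\<lambda>x. H x t) x - H x t\<bar> \<le> \<epsilon>) \<and>
        (\<forall>j\<in>UNIV. \<forall>t\<in>{t0..t1}. \<forall>x. \<bar>fejer_mean N (\<lambda>x. P t x $ j) x - P t x $ j\<bar> \<le> \<epsilon>)"
      by (elim exE)
    then have N: "0 < N"
      and NH: "\<And>t x. t \<in> {t0..t1} \<Longrightarrow> \<bar>fejer_mean N (\<lambda>x. H x t) x - H x t\<bar> \<le> \<epsilon>"
      and NP: "\<And>j t x. t \<in> {t0..t1} \<Longrightarrow> \<bar>fejer_mean N (\<lambda>x. P t x $ j) x - P t x $ j\<bar> \<le> \<epsilon>"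
      by auto
    have t0T: "t0 \<in> {0..T}" using t01 by auto
    define m' where "m' t = (SOME n'. smoothed_heat_flow s N (t - t0) (m t0) n')" for t
    have flow: "smoothed_heat_flow s N (t - t0) (m t0) (m' t)" if "t \<in> {t0..t1}" for t
    proof -
      have "0 \<le> t - t0" using that by simp
      from someI_ex [OF heat_flow_competitor [OF s N this m [OF t0T]]] show ?thesis
        unfolding m'_def .
    qed
    have m': "m' t \<in> prob_torus" if "t \<in> {t0..t1}" for t
      by (rule conjunct1 [OF flow [OF that, unfolded smoothed_heat_flow_def]])
    define e where "e t = (LINT x|m' t. H x t) - (LINT x|m t. fejer_mean N (\<lambda>x. H x t) x) +
      (\<Sum>j\<in>UNIV. LINT x|m t. b x t $ j * fejer_mean N (\<lambda>x. P t x $ j) x)" for t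
    have e: "set_integrable lborel {t0..t1} e"
      "(LINT t:{t0..t1}|lborel. e t) = (LINT x|m' t1. u x t1) - (LINT x|m t1. fejer_mean N (\<lambda>x. u x t1) x)"
      unfolding e_def P_def
      by (rule duality_identity [OF u lapH contHt _ mchar _ fp t01 flow]; use m contb in auto)+
    have e_le: "(LINT t:{t0..t1}|lborel. e t) \<le> 2 * K"
    proof -
      have t1: "t1 \<in> {0..T}" "t1 \<in> {t0..t1}" using t01 by auto
      have cu1: "continuous_on UNIV (\<lambda>x. u x t1)" by (rule continuous_on_slice [OF cu t1(1)])
      have "\<bar>LINT x|m' t1. u x t1\<bar> \<le> K"
        by (rule integral_abs_le_bound [OF m' [OF t1(2)] cu1 K])
      moreover have "\<bar>LINT x|m t1. fejer_mean N (\<lambda>x. u x t1) x\<bar> \<le> K"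
        by (intro integral_abs_le_bound [OF m [OF t1(1)]] continuous_on_fejer_mean cu1 fejer_mean_bound [OF N] K)
      ultimately show ?thesis unfolding e(2) by linarith
    qed
    \<comment> \<open>The error \<open>\<epsilon> d \<integral> |b|\<^sup>r dm\<close> has been moved to the left, which leaves the factor \<open>\<kappa>\<close> there.\<close>
    define Y where "Y t = (2 * C0 + (e t + \<epsilon> * (1 + d)) / \<theta>) / \<kappa>" for t
    have Y: "Br t \<le> Y t" if t: "t \<in> {t0..t1}" for t
    proof -
      have tT: "t \<in> {0..T}" "t \<in> {0<..<T}" using t J by auto
      note cH = contHt [OF tT(2)] and cb = contb [OF tT(1)] and c_P = cP [OF tT(1)] and mt = m [OF tT(1)]
      have cbj: "continuous_on UNIV (\<lambda>x. b x t $ j)" and cPj: "continuous_on UNIV (\<lambda>x. P t x $ j)" for j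
        by (intro continuous_intros cb c_P)+
      have H_le: "(LINT x|m t. fejer_mean N (\<lambda>x. H x t) x) \<le> (LINT x|m t. H x t) + \<epsilon>"
      proof (rule integral_le_of_close [OF mt continuous_on_fejer_mean [OF cH] cH])
        show "fejer_mean N (\<lambda>x. H x t) x \<le> H x t + \<epsilon>" for x using NH [OF t, of x] by linarith
      qed
      have bP: "(LINT x|m t. b x t $ j * P t x $ j) - \<epsilon> * (1 + Br t) \<le> (LINT x|m t. b x t $ j * fejer_mean N (\<lambda>x. P t x $ j) x)" for j
      proof -
        have int: "integrable (m t) (\<lambda>x. b x t $ j * P t x $ j)" "integrable (m t) (\<lambda>x. \<epsilon> * (1 + norm (b x t) powr r))"
          by (intro integrable_continuous_torus [OF mt] continuous_intros cbj cPj contbr tT)+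
        have "(LINT x|m t. b x t $ j * P t x $ j - \<epsilon> * (1 + norm (b x t) powr r)) \<le> (LINT x|m t. b x t $ j * fejer_mean N (\<lambda>x. P t x $ j) x)"
        proof (rule integral_mono)
          show "integrable (m t) (\<lambda>x. b x t $ j * P t x $ j - \<epsilon> * (1 + norm (b x t) powr r))"
            by (intro Bochner_Integration.integrable_diff int)
          show "integrable (m t) (\<lambda>x. b x t $ j * fejer_mean N (\<lambda>x. P t x $ j) x)"
            by (intro integrable_continuous_torus [OF mt] continuous_intros cbj continuous_on_fejer_mean cPj)
          fix x
          have "norm (b x t) \<le> 1 + norm (b x t) powr r"
          proof (cases "norm (b x t) \<le> 1")
            case False
            then have "norm (b x t) powr 1 \<le> norm (b x t) powr r" using r by (intro powr_mono) auto
            then show ?thesis using False by simp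
          qed (smt (verit) powr_ge_zero)
          then have "\<bar>b x t $ j\<bar> \<le> 1 + norm (b x t) powr r"
            using component_le_norm_cart [of "b x t" j] by linarith
          then have "\<bar>b x t $ j * (fejer_mean N (\<lambda>x. P t x $ j) x - P t x $ j)\<bar> \<le> (1 + norm (b x t) powr r) * \<epsilon>"
            unfolding abs_mult using NP [OF t, of j x] by (intro mult_mono) auto
          then show "b x t $ j * P t x $ j - \<epsilon> * (1 + norm (b x t) powr r) \<le> b x t $ j * fejer_mean N (\<lambda>x. P t x $ j) x"
            by (simp add: algebra_simps abs_le_iff)
        qed
        moreover have "(LINT x|m t. b x t $ j * P t x $ j - \<epsilon> * (1 + norm (b x t) powr r)) = (LINT x|m t. b x t $ j * P t x $ j) - \<epsilon> * (1 + Br t)"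
        proof -
          interpret prob_space "m t" by (rule prob_torusD(1) [OF mt])
          have "integrable (m t) (\<lambda>x. norm (b x t) powr r)"
            by (intro integrable_continuous_torus [OF mt] contbr tT)
          then have "(LINT x|m t. \<epsilon> * (1 + norm (b x t) powr r)) = \<epsilon> * (1 + Br t)"
            using prob_space by (simp add: Br_def)
          then show ?thesis using Bochner_Integration.integral_diff [OF int] by simp
        qed
        ultimately show ?thesis by linarith
      qed
      have "(LINT x|m t. b x t \<bullet> P t x) = (\<Sum>j\<in>UNIV. LINT x|m t. b x t $ j * P t x $ j)"
        unfolding inner_vec_def inner_real_def
        by (intro Bochner_Integration.integral_sum integrable_continuous_torus [OF mt] continuous_intros cbj cPj)
      moreover have "(\<Sum>j\<in>UNIV. (LINT x|m t. b x t $ j * P t x $ j) - \<epsilon> * (1 + Br t)) \<le>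
          (\<Sum>j\<in>UNIV. LINT x|m t. b x t $ j * fejer_mean N (\<lambda>x. P t x $ j) x)"
        by (intro sum_mono bP)
      ultimately have "(LINT x|m t. b x t \<bullet> P t x) - d * (\<epsilon> * (1 + Br t)) \<le> (\<Sum>j\<in>UNIV. LINT x|m t. b x t $ j * fejer_mean N (\<lambda>x. P t x $ j) x)"
        by (simp add: sum_subtractf d_def)
      then have "(LINT x|m' t. H x t) - ((LINT x|m t. H x t) + \<epsilon>) + ((LINT x|m t. b x t \<bullet> P t x) - d * (\<epsilon> * (1 + Br t))) \<le> e t"
        unfolding e_def using H_le by linarith
      moreover have "(LINT x|m t. b x t \<bullet> P t x - H x t) = (LINT x|m t. b x t \<bullet> P t x) - (LINT x|m t. H x t)"
        by (intro Bochner_Integration.integral_diff integrable_continuous_torus [OF mt] continuous_intros cb c_P cH)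
      ultimately have e_ge: "(LINT x|m t. b x t \<bullet> P t x - H x t) + (LINT x|m' t. H x t) \<le> e t + \<epsilon> * (1 + d) + \<epsilon> * d * Br t"
        by (simp add: algebra_simps)
      have "Br t / (C0 * \<theta> powr r) - 2 * C0 \<le> ((LINT x|m t. b x t \<bullet> P t x - H x t) + (LINT x|m' t. H x t)) / \<theta>"
        unfolding Br_def b_def H_def using r
        by (intro energy_inequality(2) [OF adm _ C0 \<mu> [OF tT(1)] \<theta> c_P ham [OF tT(1)] mt m' [OF t] graph [OF tT(1)]]) auto
      also have "\<dots> \<le> (e t + \<epsilon> * (1 + d) + \<epsilon> * d * Br t) / \<theta>"
        using e_ge \<theta> by (intro divide_right_mono) auto
      finally have "Br t * \<kappa> \<le> 2 * C0 + (e t + \<epsilon> * (1 + d)) / \<theta>"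
        by (simp add: \<kappa>_def algebra_simps add_divide_distrib)
      then show ?thesis using \<kappa> by (simp add: Y_def field_simps)
    qed
    have Br_nonneg: "0 \<le> Br t" for t by (simp add: Br_def integral_nonneg_AE)
    have const_int: "set_integrable lborel {t0..t1} (\<lambda>t. c :: real)" for c
      by (intro borel_integrable_atLeastAtMost' continuous_on_const)
    have Y_eq: "Y t = (2 * C0 + \<epsilon> * (1 + d) / \<theta>) / \<kappa> + 1 / (\<theta> * \<kappa>) * e t" for t
      by (simp add: Y_def add_divide_distrib)
    have e': "set_integrable lborel {t0..t1} (\<lambda>t. 1 / (\<theta> * \<kappa>) * e t)"
      by (intro set_integrable_mult_right e(1))
    have Y_int: "set_integrable lborel {t0..t1} Y"
      unfolding Y_eq [abs_def] by (intro set_integral_add const_int e')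
    have "(LINT t:{t0..t1}|lborel. Y t) = (2 * C0 + \<epsilon> * (1 + d) / \<theta>) / \<kappa> * (t1 - t0) + 1 / (\<theta> * \<kappa>) * (LINT t:{t0..t1}|lborel. e t)"
      unfolding Y_eq set_integral_add(2) [OF const_int e'] using t01 by (simp add: set_lebesgue_integral_def mult.commute)
    also have "\<dots> \<le> (2 * C0 + \<epsilon> * (1 + d) / \<theta>) / \<kappa> * (t1 - t0) + 1 / (\<theta> * \<kappa>) * (2 * K)"
      using e_le \<theta> \<kappa> by (intro add_left_mono mult_left_mono) auto
    also have "\<dots> = W \<epsilon>"
    proof -
      have "A / k * y + 1 / (\<theta> * k) * z = (A * y + z / \<theta>) / k" for A k y z :: real
        by (simp add: add_divide_distrib)
      then show ?thesis unfolding W_def \<kappa>_def [symmetric] .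
    qed
    finally have Y_le: "(LINT t:{t0..t1}|lborel. Y t) \<le> W \<epsilon>" .
    have "(\<integral>\<^sup>+ t\<in>{t0..t1}. ennpowr (Lambda r (\<mu> t)) r \<partial>lborel) \<le> (\<integral>\<^sup>+ t. ennreal (indicator {t0..t1} t *\<^sub>R Y t) \<partial>lborel)"
    proof (rule nn_integral_mono)
      fix t
      show "ennpowr (Lambda r (\<mu> t)) r * indicator {t0..t1} t \<le> ennreal (indicator {t0..t1} t *\<^sub>R Y t)"
        using \<Lambda> [of t] Y [of t] J(2) by (cases "t \<in> {t0..t1}") (auto simp: ennreal_leI subset_iff)
    qed
    also have "\<dots> = ennreal (LINT t:{t0..t1}|lborel. Y t)"
      unfolding set_lebesgue_integral_def
    proof (rule nn_integral_eq_integral [OF Y_int [unfolded set_integrable_def]])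
      show "AE t in lborel. 0 \<le> indicator {t0..t1} t *\<^sub>R Y t"
      proof (intro AE_I2)
        fix t
        show "0 \<le> indicator {t0..t1} t *\<^sub>R Y t"
          using Y [of t] Br_nonneg [of t] by (cases "t \<in> {t0..t1}") auto
      qed
    qed
    also have "\<dots> \<le> ennreal (W \<epsilon>)" by (rule ennreal_leI [OF Y_le])
    finally show ?thesis .
  qed
  have pos: "0 < 1 / (C0 * \<theta> powr r)" using C0 \<theta> by simp
  have "(W \<longlongrightarrow> ((2 * C0 + 0 * (1 + d) / \<theta>) * (t1 - t0) + 2 * K / \<theta>) / (1 / (C0 * \<theta> powr r) - 0 * d / \<theta>)) (at_right 0)"
    unfolding W_def using pos \<theta> by (intro tendsto_intros) auto
  then have lim: "((\<lambda>\<epsilon>. ennreal (W \<epsilon>)) \<longlongrightarrow> ennreal (C0 * \<theta> powr r * (2 * C0 * (t1 - t0) + 2 * K / \<theta>))) (at_right 0)"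
    by (intro tendsto_ennrealI) (simp add: mult.commute)
  have "((\<lambda>\<epsilon>. \<epsilon> * d / \<theta>) \<longlongrightarrow> 0 * d / \<theta>) (at_right 0)"
    using \<theta> by (intro tendsto_intros) auto
  then have "eventually (\<lambda>\<epsilon>. \<epsilon> * d / \<theta> < 1 / (C0 * \<theta> powr r)) (at_right 0)"
    using pos by (intro order_tendstoD(2)) auto
  moreover have "eventually (\<lambda>\<epsilon>::real. 0 < \<epsilon>) (at_right 0)"
    by (rule eventually_at_right_less)
  ultimately have "eventually (\<lambda>\<epsilon>. (\<integral>\<^sup>+ t\<in>{t0..t1}. ennpowr (Lambda r (\<mu> t)) r \<partial>lborel) \<le> ennreal (W \<epsilon>)) (at_right 0)"
    by eventually_elim (rule step)
  then show ?thesis by (intro tendsto_lowerbound [OF lim]) auto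
qed

lemma uniformly_close_to_terminal:
  fixes u :: "real ^ 'd \<Rightarrow> real \<Rightarrow> real"
  assumes T: "0 < T" and cont: "continuous_on (UNIV \<times> {0..T}) (\<lambda>(x, t). u x t)"
    and per: "\<And>t. t \<in> {0..T} \<Longrightarrow> periodic (\<lambda>x. u x t)" and \<epsilon>: "0 < \<epsilon>"
  shows "\<exists>\<delta>>0. \<forall>t\<in>{0..T}. T - \<delta> < t \<longrightarrow> (\<forall>x. \<bar>u x t - u x T\<bar> < \<epsilon>)"
proof -
  have comp: "compact (cbox (0 :: real ^ 'd) 1 \<times> {0..T})" by (intro compact_Times compact_cbox compact_Icc)
  have "uniformly_continuous_on (cbox 0 1 \<times> {0..T}) (\<lambda>(x, t). u x t)"
    by (intro compact_uniformly_continuous comp continuous_on_subset [OF cont]) auto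
  then obtain \<delta> where \<delta>: "\<delta> > 0" "\<forall>z\<in>cbox 0 1 \<times> {0..T}. \<forall>z'\<in>cbox 0 1 \<times> {0..T}. dist z' z < \<delta> \<longrightarrow>
      dist ((\<lambda>(x, t). u x t) z') ((\<lambda>(x, t). u x t) z) < \<epsilon>"
    unfolding uniformly_continuous_on_def using \<epsilon> by blast
  have "\<bar>u x t - u x T\<bar> < \<epsilon>" if t: "t \<in> {0..T}" "T - \<delta> < t" for x t
  proof -
    obtain k where k: "x + int_vec k \<in> cell" using exists_cell_representative by blast
    define y where "y = x + int_vec k"
    have "y \<in> cbox 0 1" using k cell_subset_cbox by (auto simp: y_def)
    then have "dist (u y t) (u y T) < \<epsilon>"
      using bspec [OF bspec [OF \<delta>(2), of "(y, T)"], of "(y, t)"] t T by (auto simp: dist_Pair_Pair dist_real_def)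
    moreover have "u y t = u x t" "u y T = u x T"
      unfolding y_def using periodic_int_vec [OF per [OF t(1)], of x k] periodic_int_vec [OF per, of T x k] T by auto
    ultimately show ?thesis by (simp add: dist_real_def)
  qed
  then show ?thesis using \<delta>(1) by blast
qed

theorem lemma3p3:
  fixes L :: "'d::finite lagrangian"
    and m0 :: "(real ^ 'd) measure" and uT :: "real ^ 'd \<Rightarrow> real"
    and u :: "real ^ 'd \<Rightarrow> real \<Rightarrow> real"
    and m :: "real \<Rightarrow> (real ^ 'd) measure"
    and \<mu> :: "real \<Rightarrow> ((real ^ 'd) \<times> (real ^ 'd)) measure"
    and T q q' C0 \<beta>0 \<epsilon>0 s \<theta> :: real
  assumes "0 < T" and "1 < q" and "q' = q / (q - 1)" and "0 < C0"
    and "0 < \<beta>0" and "\<beta>0 < 1" and "0 < \<epsilon>0"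
    and "1/2 < s" and "s < 1"
    and "admissible_lagrangian q' C0 L"
    and "admissible_data C0 \<beta>0 \<epsilon>0 s m0 uT"
    and "0 < \<theta>" and "\<theta> \<le> 1"
    and "mfgc_solution s \<theta> T L m0 uT u m \<mu>"
  shows "(\<integral>\<^sup>+ t\<in>{0..T}. ennpowr (Lambda q' (\<mu> t)) q' \<partial>lborel)
           \<le> ennreal (2 * C0\<^sup>2 * \<theta> powr q' * (1 + T))"
proof (rule nn_integral_exhaust_interval [OF \<open>0 < T\<close>])
  fix t0 t1 :: real
  assume t01: "0 < t0" "t0 \<le> t1" "t1 < T"
  note T = \<open>0 < T\<close> and \<theta> = \<open>0 < \<theta>\<close> and C0 = \<open>0 < C0\<close>
  have s: "0 < s" "s < 1" using assms(8,9) by auto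
  have q': "1 \<le> q'" using assms(2) by (simp add: assms(3) le_divide_eq)
  have u: "C_2s_1 s T u" and terminal: "\<And>x. u x T = \<theta> * uT x"
    using assms(14) unfolding mfgc_solution_def by blast+
  have cu: "continuous_on (UNIV \<times> {0..T}) (\<lambda>(x, t). u x t)"
    and pu: "\<And>t. t \<in> {0..T} \<Longrightarrow> periodic (\<lambda>x. u x t)"
    using u unfolding C_2s_1_def by blast+
  have uT: "\<bar>u x T\<bar> \<le> \<theta> * C0" for x
    unfolding terminal abs_mult using admissible_data_terminal_bound [OF assms(11,5), of x] \<theta>
    by (simp add: mult_left_mono)
  let ?I = "\<lambda>t1. \<integral>\<^sup>+ t\<in>{t0..t1}. ennpowr (Lambda q' (\<mu> t)) q' \<partial>lborel"
  define V where "V \<eta> = C0 * \<theta> powr q' * (2 * C0 * T + 2 * (\<theta> * C0 + \<eta>) / \<theta>)" for \<eta>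
  have step: "?I t1 \<le> ennreal (V \<eta>)" if \<eta>: "0 < \<eta>" for \<eta>
  proof -
    obtain \<delta> where \<delta>: "\<delta> > 0" "\<forall>t\<in>{0..T}. T - \<delta> < t \<longrightarrow> (\<forall>x. \<bar>u x t - u x T\<bar> < \<eta>)"
      using uniformly_close_to_terminal [OF T cu pu \<eta>] by blast
    \<comment> \<open>Enlarging the interval towards \<open>T\<close> only increases the integral and makes the boundary term sharp.\<close>
    define t2 where "t2 = max t1 (T - \<delta> / 2)"
    have t2: "t1 \<le> t2" "t2 < T" "T - \<delta> < t2" "t2 \<in> {0..T}"
      using t01 \<delta>(1) by (auto simp: t2_def)
    have K: "\<bar>u x t2\<bar> \<le> \<theta> * C0 + \<eta>" for x
    proof -
      have "\<bar>u x t2 - u x T\<bar> < \<eta>" using \<delta>(2) t2 by blast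
      then show ?thesis using uT [of x] by linarith
    qed
    have "?I t1 \<le> ?I t2"
      using t2(1) by (intro nn_integral_mono) (auto simp: indicator_def)
    also have "\<dots> \<le> ennreal (C0 * \<theta> powr q' * (2 * C0 * (t2 - t0) + 2 * (\<theta> * C0 + \<eta>) / \<theta>))"
      by (rule energy_bound_interval [OF s q' C0 \<theta> T assms(10,14)]) (use t01 t2 K in auto)
    also have "\<dots> \<le> ennreal (V \<eta>)"
      unfolding V_def using C0 \<theta> t01 t2 by (intro ennreal_leI mult_left_mono add_right_mono) auto
    finally show ?thesis .
  qed
  have "(V \<longlongrightarrow> C0 * \<theta> powr q' * (2 * C0 * T + 2 * (\<theta> * C0 + 0) / \<theta>)) (at_right 0)"
    unfolding V_def using \<theta> by (intro tendsto_intros) auto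
  also have "C0 * \<theta> powr q' * (2 * C0 * T + 2 * (\<theta> * C0 + 0) / \<theta>) = 2 * C0\<^sup>2 * \<theta> powr q' * (1 + T)"
    using \<theta> by (simp add: power2_eq_square algebra_simps)
  finally have lim: "((\<lambda>\<eta>. ennreal (V \<eta>)) \<longlongrightarrow> ennreal (2 * C0\<^sup>2 * \<theta> powr q' * (1 + T))) (at_right 0)"
    by (rule tendsto_ennrealI)
  have "eventually (\<lambda>\<eta>. ?I t1 \<le> ennreal (V \<eta>)) (at_right 0)"
    using eventually_at_right_less [of "0 :: real"] by eventually_elim (rule step)
  then show "?I t1 \<le> ennreal (2 * C0\<^sup>2 * \<theta> powr q' * (1 + T))"
    by (intro tendsto_lowerbound [OF lim]) auto
qed

end
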